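(* Let $(A,\mathfrak m,k)$ be a commutative Noetherian local ring, let $M$ be a nonzero finitely generated $A$-module having reducible complexity, and let $N$ be a nonzero finitely generated $A$-module. If $\operatorname{cx}M>0$, let $K_0=M$, let $K_1,\dots,K_c$ be $A$-modules and let $\eta_i\in\operatorname{Ext}_A^{|\eta_i|}(K_{i-1},K_{i-1})$ ($i=1,\dots,c$) be homogeneous elements of positive degree $|\eta_i|$, given by exact sequences $$0\to K_{i-1}\to K_i\to\Omega_A^{|\eta_i|-1}(K_{i-1})\to 0 ,$$ such that $\operatorname{depth}K_i=\operatorname{depth}M$ and $\operatorname{cx}K_i<\operatorname{cx}K_{i-1}$ for $i=1,\dots,c$, and $\operatorname{cx}K_c=0$. (If $\operatorname{cx}M=0$, put $c=0$, so that $|\eta_1|+\cdots+|\eta_c|-c=0$.) Put $\mathrm p^A(M,N)=\sup\{n\mid\operatorname{Ext}_A^n(M,N)\ne0\}$. Then the following are equivalent. (i) There exists an integer $t>\operatorname{depth}A-\operatorname{depth}M$ such that $\operatorname{Ext}_A^{t+i}(M,N)=0$ for $0\le i\le|\eta_1|+\cdots+|\eta_c|-c$. (ii) $\mathrm p^A(M,N)<\infty$. (iii) $\mathrm p^A(M,N)=\operatorname{depth}A-\operatorname{depth}M$.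
   Context: All modules are finitely generated. Complexity: for an $A$-module $X$ the $n$-th Betti number is $\beta_n(X)=\dim_k\operatorname{Ext}_A^n(X,k)$, and $\operatorname{cx}X=\inf\{t\in\mathbb N_0 \mid \exists\, a\in\mathbb R \text{ with } \beta_n(X)\le a n^{t-1}\text{ for } n\gg 0\}$ (where $\mathbb N_0=\{0,1,2,\dots\}$; the value is $\infty$ if no such $t$ exists). Thus $\operatorname{cx}X=0$ iff $X$ has finite projective dimension. Syzygies and $K_\eta$: if $\cdots\to P_1\to P_0\to X\to 0$ is the minimal free resolution of $X$, then $\Omega_A^n(X)$ denotes the cokernel of $P_{n+1}\to P_n$ (so $\Omega_A^0(X)=X$). For a homogeneous element $\eta\in\operatorname{Ext}_A^*(X,Y)$ of degree $|\eta|>0$, choose a map $f_\eta:\Omega_A^{|\eta|}(X)\to Y$ representing $\eta$, and let $K_\eta$ be the pushout of $f_\eta$ and the inclusion $\Omega_A^{|\eta|}(X)\hookrightarrow P_{|\eta|-1}$. There is an exact sequence $0\to Y\to K_\eta\to\Omega_A^{|\eta|-1}(X)\to 0$ (the exact sequence giving $\eta$), and up to isomorphism $K_\eta$ is independent of the choice of $f_\eta$. In the claim, $K_i=K_{\eta_i}$. Reducible complexity: the class of $A$-modules having reducible complexity is defined inductively, inside the class of $A$-modules of finite complexity, by: (1) every module of finite projective dimension has reducible complexity; (2) a module $X$ with $0<\operatorname{cx}X<\infty$ has reducible complexity if there is a homogeneous $\eta\in\operatorname{Ext}_A^*(X,X)$ of positive degree such that $\operatorname{cx}K_\eta<\operatorname{cx}X$,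 $\operatorname{depth}K_\eta=\operatorname{depth}X$, and $K_\eta$ has reducible complexity. Consequently modules $K_i$ and elements $\eta_i$ as in the claim always exist when $M$ has reducible complexity and $\operatorname{cx}M>0$. *)

theory Defs
  imports
    "Jordan_Normal_Form.Missing_VectorSpace"
    "HOL-Algebra.QuotRing"
    "HOL-Algebra.Ring_Divisibility"
    "HOL-Library.Extended_Real"
begin

hide_const (open) Multiset.mult Modules.module Modules.module_hom

section \<open>Noetherian local rings and finitely generated modules\<close>

definition max_ideal :: "('a, 'r) ring_scheme \<Rightarrow> 'a set" where
  "max_ideal R = (THE \<mm>. maximalideal \<mm> R)"

definition noetherian_local_ring :: "('a, 'r) ring_scheme \<Rightarrow> bool" where
  "noetherian_local_ring R \<longleftrightarrow> cring R \<and> noetherian_ring R \<and> (\<exists>!\<mm>. maximalideal \<mm> R)"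

definition fg_module :: "('a, 'r) ring_scheme \<Rightarrow> ('a, 'b) module \<Rightarrow> bool" where
  "fg_module R M \<longleftrightarrow>
     module R M \<and> (\<exists>S. finite S \<and> S \<subseteq> carrier M \<and> LinearCombinations.module.span R M S = carrier M)"

definition zero_module :: "('a, 'b) module \<Rightarrow> bool" where
  "zero_module M \<longleftrightarrow> carrier M = {\<zero>\<^bsub>M\<^esub>}"

definition module_isomorphic ::
  "('a, 'r) ring_scheme \<Rightarrow> ('a, 'b) module \<Rightarrow> ('a, 'c) module \<Rightarrow> bool" where
  "module_isomorphic R M N \<longleftrightarrow>
     module R M \<and> module R N \<and> (\<exists>f\<in>module_hom R M N. bij_betw f (carrier M) (carrier N))"

text \<open>The fields \<open>mult\<close> and \<open>one\<close>, which every module record inherits from rings, have no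
  meaning for a module; below they are filled with arbitrary values.\<close>

definition ring_module :: "('a, 'r) ring_scheme \<Rightarrow> ('a, 'a) module" where
  "ring_module R = \<lparr>carrier = carrier R, mult = (\<lambda>x y. x \<otimes>\<^bsub>R\<^esub> y), one = \<one>\<^bsub>R\<^esub>,
     zero = \<zero>\<^bsub>R\<^esub>, add = (\<lambda>x y. x \<oplus>\<^bsub>R\<^esub> y), smult = (\<lambda>r x. r \<otimes>\<^bsub>R\<^esub> x)\<rparr>"

definition quot_module :: "('a, 'b) module \<Rightarrow> 'b set \<Rightarrow> ('a, 'b set) module" where
  "quot_module M U = \<lparr>carrier = a_rcosets\<^bsub>M\<^esub> U, mult = (\<lambda>_ _. U), one = U,
     zero = U, add = set_add M, smult = (\<lambda>r C. \<Union>x\<in>C. U +>\<^bsub>M\<^esub> (r \<odot>\<^bsub>M\<^esub> x))\<rparr>"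

definition hom_module ::
  "('a, 'r) ring_scheme \<Rightarrow> ('a, 'b) module \<Rightarrow> ('a, 'c) module \<Rightarrow> ('a, 'b \<Rightarrow> 'c) module" where
  "hom_module R M N = \<lparr>carrier = module_hom R M N \<inter> extensional (carrier M),
     mult = (\<lambda>_ _. \<lambda>x\<in>carrier M. \<zero>\<^bsub>N\<^esub>), one = (\<lambda>x\<in>carrier M. \<zero>\<^bsub>N\<^esub>),
     zero = (\<lambda>x\<in>carrier M. \<zero>\<^bsub>N\<^esub>),
     add = (\<lambda>f g. \<lambda>x\<in>carrier M. f x \<oplus>\<^bsub>N\<^esub> g x),
     smult = (\<lambda>r f. \<lambda>x\<in>carrier M. r \<odot>\<^bsub>N\<^esub> f x)\<rparr>"

text \<open>The pushout of \<open>B \<leftarrow> A \<rightarrow> C\<close> along \<open>f\<close> and \<open>g\<close>.\<close>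

definition pushout_module ::
  "('a, 'd) module \<Rightarrow> ('a, 'b) module \<Rightarrow> ('a, 'c) module \<Rightarrow> ('d \<Rightarrow> 'b) \<Rightarrow> ('d \<Rightarrow> 'c)
     \<Rightarrow> ('a, ('b \<times> 'c) set) module" where
  "pushout_module A B C f g =
     quot_module (direct_sum B C) ((\<lambda>a. (f a, \<ominus>\<^bsub>C\<^esub> g a)) ` carrier A)"


section \<open>Depth\<close>

text \<open>The submodule \<open>(x\<^sub>1, \<dots>, x\<^sub>n)M\<close>.\<close>

definition list_times_module :: "('a, 'r) ring_scheme \<Rightarrow> 'a list \<Rightarrow> ('a, 'b) module \<Rightarrow> 'b set" where
  "list_times_module R xs M = LinearCombinations.module.span R M {x \<odot>\<^bsub>M\<^esub> u | x u. x \<in> set xs \<and> u \<in> carrier M}"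

definition nonzerodivisor_on :: "'a \<Rightarrow> ('a, 'b) module \<Rightarrow> bool" where
  "nonzerodivisor_on x M \<longleftrightarrow> (\<forall>u\<in>carrier M. x \<odot>\<^bsub>M\<^esub> u = \<zero>\<^bsub>M\<^esub> \<longrightarrow> u = \<zero>\<^bsub>M\<^esub>)"

definition regular_sequence :: "('a, 'r) ring_scheme \<Rightarrow> ('a, 'b) module \<Rightarrow> 'a list \<Rightarrow> bool" where
  "regular_sequence R M xs \<longleftrightarrow>
     (\<forall>i<length xs. nonzerodivisor_on (xs ! i) (quot_module M (list_times_module R (take i xs) M)))
     \<and> \<not> zero_module (quot_module M (list_times_module R xs M))"

text \<open>The zero module has no regular sequence at all; its depth is \<open>\<infinity>\<close> by convention.\<close>

definition depth :: "('a, 'r) ring_scheme \<Rightarrow> ('a, 'b) module \<Rightarrow> enat" where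
  "depth R M = (if zero_module M then \<infinity>
     else Sup {enat (length xs) | xs. set xs \<subseteq> max_ideal R \<and> regular_sequence R M xs})"


section \<open>Resolutions\<close>

text \<open>Exactness of \<open>\<dots> \<rightarrow> P 1 \<rightarrow> P 0 \<rightarrow> X \<rightarrow> 0\<close>, where \<open>d i\<close> maps \<open>P (i + 1)\<close> to \<open>P i\<close>.\<close>

definition resolution ::
  "('a, 'r) ring_scheme \<Rightarrow> (nat \<Rightarrow> ('a, 'p) module) \<Rightarrow> (nat \<Rightarrow> 'p \<Rightarrow> 'p) \<Rightarrow> ('p \<Rightarrow> 'b)
     \<Rightarrow> ('a, 'b) module \<Rightarrow> bool" where
  "resolution R P d \<epsilon> X \<longleftrightarrow>
     (\<forall>i. module R (P i)) \<and>
     (\<forall>i. d i \<in> module_hom R (P (Suc i)) (P i)) \<and>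
     \<epsilon> \<in> module_hom R (P 0) X \<and>
     \<epsilon> ` carrier (P 0) = carrier X \<and>
     d 0 ` carrier (P 1) = {x \<in> carrier (P 0). \<epsilon> x = \<zero>\<^bsub>X\<^esub>} \<and>
     (\<forall>i. d (Suc i) ` carrier (P (Suc (Suc i))) = {x \<in> carrier (P (Suc i)). d i x = \<zero>\<^bsub>P i\<^esub>})"

text \<open>The free module of rank \<open>n\<close>; its elements are the functions \<open>{..<n} \<rightarrow>\<^sub>E carrier R\<close>.\<close>

definition free_module :: "('a, 'r) ring_scheme \<Rightarrow> nat \<Rightarrow> ('a, nat \<Rightarrow> 'a) module" where
  "free_module R n = ring.func_space R {..<n}"

text \<open>Minimality, \<open>d i (P (i + 1)) \<subseteq> \<mm> P i\<close>, says that all coordinates of the elements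
  \<open>d i x\<close> lie in the maximal ideal.\<close>

definition minimal_free_resolution ::
  "('a, 'r) ring_scheme \<Rightarrow> (nat \<Rightarrow> nat) \<Rightarrow> (nat \<Rightarrow> (nat \<Rightarrow> 'a) \<Rightarrow> (nat \<Rightarrow> 'a))
     \<Rightarrow> ((nat \<Rightarrow> 'a) \<Rightarrow> 'b) \<Rightarrow> ('a, 'b) module \<Rightarrow> bool" where
  "minimal_free_resolution R b d \<epsilon> X \<longleftrightarrow>
     resolution R (\<lambda>i. free_module R (b i)) d \<epsilon> X \<and>
     (\<forall>i. \<forall>x\<in>carrier (free_module R (b (Suc i))). \<forall>j<b i. d i x j \<in> max_ideal R)"

text \<open>Over a Noetherian local ring every finitely generated module has a minimal free resolution,
  unique up to isomorphism; one of them is fixed.\<close>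

definition min_res ::
  "('a, 'r) ring_scheme \<Rightarrow> ('a, 'b) module \<Rightarrow>
     (nat \<Rightarrow> nat) \<times> (nat \<Rightarrow> (nat \<Rightarrow> 'a) \<Rightarrow> (nat \<Rightarrow> 'a))" where
  "min_res R X = (SOME (b, d). \<exists>\<epsilon>. minimal_free_resolution R b d \<epsilon> X)"

definition res_module :: "('a, 'r) ring_scheme \<Rightarrow> ('a, 'b) module \<Rightarrow> nat \<Rightarrow> ('a, nat \<Rightarrow> 'a) module" where
  "res_module R X n = free_module R (fst (min_res R X) n)"

definition res_diff ::
  "('a, 'r) ring_scheme \<Rightarrow> ('a, 'b) module \<Rightarrow> nat \<Rightarrow> (nat \<Rightarrow> 'a) \<Rightarrow> (nat \<Rightarrow> 'a)" where
  "res_diff R X n = snd (min_res R X) n"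


section \<open>Ext\<close>

definition ext_cocycles ::
  "('a, 'r) ring_scheme \<Rightarrow> ('a, 'b) module \<Rightarrow> ('a, 'c) module \<Rightarrow> nat \<Rightarrow> ((nat \<Rightarrow> 'a) \<Rightarrow> 'c) set" where
  "ext_cocycles R X Y n =
     {f \<in> carrier (hom_module R (res_module R X n) Y).
        \<forall>x\<in>carrier (res_module R X (Suc n)). f (res_diff R X n x) = \<zero>\<^bsub>Y\<^esub>}"

definition ext_coboundaries ::
  "('a, 'r) ring_scheme \<Rightarrow> ('a, 'b) module \<Rightarrow> ('a, 'c) module \<Rightarrow> nat \<Rightarrow> ((nat \<Rightarrow> 'a) \<Rightarrow> 'c) set" where
  "ext_coboundaries R X Y n = (case n of
       0 \<Rightarrow> {\<zero>\<^bsub>hom_module R (res_module R X 0) Y\<^esub>}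
     | Suc m \<Rightarrow> (\<lambda>g. \<lambda>x\<in>carrier (res_module R X (Suc m)). g (res_diff R X m x)) `
                 carrier (hom_module R (res_module R X m) Y))"

text \<open>\<open>Ext\<^sup>n(X, Y)\<close>, as the \<open>n\<close>-th cohomology of \<open>Hom(P, Y)\<close> for the minimal free resolution
  \<open>P\<close> of \<open>X\<close>.\<close>

definition Ext ::
  "('a, 'r) ring_scheme \<Rightarrow> ('a, 'b) module \<Rightarrow> ('a, 'c) module \<Rightarrow> nat
     \<Rightarrow> ('a, ((nat \<Rightarrow> 'a) \<Rightarrow> 'c) set) module" where
  "Ext R X Y n = quot_module
     ((hom_module R (res_module R X n) Y)\<lparr>carrier := ext_cocycles R X Y n\<rparr>)
     (ext_coboundaries R X Y n)"

text \<open>Vanishing of \<open>Ext\<close> in an integer degree; it always vanishes in negative degrees.\<close>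

definition Ext_vanishes ::
  "('a, 'r) ring_scheme \<Rightarrow> ('a, 'b) module \<Rightarrow> ('a, 'c) module \<Rightarrow> int \<Rightarrow> bool" where
  "Ext_vanishes R X Y j \<longleftrightarrow> (0 \<le> j \<longrightarrow> zero_module (Ext R X Y (nat j)))"

text \<open>The supremum is taken in the extended reals, so it is \<open>-\<infinity>\<close> if \<open>Ext\<close> vanishes everywhere.\<close>

definition p_ext :: "('a, 'r) ring_scheme \<Rightarrow> ('a, 'b) module \<Rightarrow> ('a, 'c) module \<Rightarrow> ereal" where
  "p_ext R X Y = Sup {ereal (real_of_int j) | j. \<not> Ext_vanishes R X Y j}"


section \<open>Betti numbers and complexity\<close>

definition residue_module :: "('a, 'r) ring_scheme \<Rightarrow> ('a, 'a set) module" where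
  "residue_module R = quot_module (ring_module R) (max_ideal R)"

text \<open>An \<open>R\<close>-module annihilated by the maximal ideal, viewed as a vector space over the residue
  field: the coset of \<open>r\<close> acts as \<open>r\<close>.\<close>

definition residue_space :: "('a, 'b) module \<Rightarrow> ('a set, 'b) module" where
  "residue_space V = \<lparr>carrier = carrier V, mult = (\<lambda>x y. x \<otimes>\<^bsub>V\<^esub> y), one = \<one>\<^bsub>V\<^esub>,
     zero = \<zero>\<^bsub>V\<^esub>, add = (\<lambda>x y. x \<oplus>\<^bsub>V\<^esub> y),
     smult = (\<lambda>c v. the_elem ((\<lambda>r. r \<odot>\<^bsub>V\<^esub> v) ` c))\<rparr>"

definition betti :: "('a, 'r) ring_scheme \<Rightarrow> ('a, 'b) module \<Rightarrow> nat \<Rightarrow> nat" where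
  "betti R X n =
     vectorspace.dim (R Quot max_ideal R) (residue_space (Ext R X (residue_module R) n))"

definition complexity :: "('a, 'r) ring_scheme \<Rightarrow> ('a, 'b) module \<Rightarrow> enat" where
  "complexity R X = Inf {enat t | t. \<exists>a::real.
     \<forall>\<^sub>F n in sequentially. real (betti R X n) \<le> a * real n powr (real t - 1)}"


section \<open>Syzygies and the modules \<open>K\<^sub>\<eta>\<close>\<close>

definition syzygy ::
  "('a, 'r) ring_scheme \<Rightarrow> ('a, 'b) module \<Rightarrow> nat \<Rightarrow> ('a, (nat \<Rightarrow> 'a) set) module" where
  "syzygy R X n =
     quot_module (res_module R X n) (res_diff R X n ` carrier (res_module R X (Suc n)))"

text \<open>The inclusion of the \<open>n\<close>-th syzygy into \<open>P (n - 1)\<close>, for \<open>n > 0\<close>: the differential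
  \<open>P n \<rightarrow> P (n - 1)\<close> is constant on each coset of the image of \<open>P (n + 1)\<close>.\<close>

definition syzygy_incl ::
  "('a, 'r) ring_scheme \<Rightarrow> ('a, 'b) module \<Rightarrow> nat \<Rightarrow> (nat \<Rightarrow> 'a) set \<Rightarrow> (nat \<Rightarrow> 'a)" where
  "syzygy_incl R X n C = the_elem (res_diff R X (n - 1) ` C)"

text \<open>A map \<open>f\<close> from the \<open>n\<close>-th syzygy of \<open>X\<close> to \<open>Y\<close> represents the class \<open>\<eta>\<close> if its composition
  with the projection from \<open>P n\<close> is a cocycle in \<open>\<eta>\<close>.\<close>

definition represents ::
  "('a, 'r) ring_scheme \<Rightarrow> ('a, 'b) module \<Rightarrow> ('a, 'c) module \<Rightarrow> nat
     \<Rightarrow> ((nat \<Rightarrow> 'a) set \<Rightarrow> 'c) \<Rightarrow> ((nat \<Rightarrow> 'a) \<Rightarrow> 'c) set \<Rightarrow> bool" where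
  "represents R X Y n f \<eta> \<longleftrightarrow>
     f \<in> module_hom R (syzygy R X n) Y \<and>
     (\<lambda>x\<in>carrier (res_module R X n).
        f (res_diff R X n ` carrier (res_module R X (Suc n)) +>\<^bsub>res_module R X n\<^esub> x)) \<in> \<eta>"

text \<open>\<open>K\<close> is isomorphic to \<open>K\<^sub>\<eta>\<close>, where \<open>\<eta>\<close> is an element of \<open>Ext\<^sup>n(X, Y)\<close> and \<open>n > 0\<close>.\<close>

definition is_K ::
  "('a, 'r) ring_scheme \<Rightarrow> ('a, 'b) module \<Rightarrow> ('a, 'c) module \<Rightarrow> nat
     \<Rightarrow> ((nat \<Rightarrow> 'a) \<Rightarrow> 'c) set \<Rightarrow> ('a, 'd) module \<Rightarrow> bool" where
  "is_K R X Y n \<eta> K \<longleftrightarrow> (\<exists>f. represents R X Y n f \<eta> \<and>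
     module_isomorphic R K
       (pushout_module (syzygy R X n) Y (res_module R X (n - 1)) f (syzygy_incl R X n)))"


section \<open>Projective dimension and reducible complexity\<close>

text \<open>Up to isomorphism every finitely generated \<open>R\<close>-module is a quotient of some
  \<open>free_module R n\<close>, hence occurs in the following type. Quantification over all finitely
  generated modules is quantification over this type.\<close>

type_synonym 'a std_module = "('a, (nat \<Rightarrow> 'a) set) module"

definition projective_module :: "('a, 'r) ring_scheme \<Rightarrow> ('a, 'p) module \<Rightarrow> bool" where
  "projective_module R P \<longleftrightarrow> fg_module R P \<and>
     (\<forall>(B :: 'a std_module) (C :: 'a std_module) g h.
        fg_module R B \<and> fg_module R C \<and>
        g \<in> module_hom R B C \<and> g ` carrier B = carrier C \<and> h \<in> module_hom R P C \<longrightarrow>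
        (\<exists>l\<in>module_hom R P B. \<forall>x\<in>carrier P. g (l x) = h x))"

definition finite_projective_dimension :: "('a, 'r) ring_scheme \<Rightarrow> ('a, 'b) module \<Rightarrow> bool" where
  "finite_projective_dimension R X \<longleftrightarrow>
     (\<exists>(P :: nat \<Rightarrow> 'a std_module) d \<epsilon>. resolution R P d \<epsilon> X \<and>
        (\<forall>i. projective_module R (P i)) \<and> (\<exists>n. \<forall>i>n. zero_module (P i)))"

inductive std_reducible_complexity :: "('a, 'r) ring_scheme \<Rightarrow> 'a std_module \<Rightarrow> bool"
  for R :: "('a, 'r) ring_scheme" where
  finite_pd: "fg_module R X \<Longrightarrow> finite_projective_dimension R X \<Longrightarrow> std_reducible_complexity R X"
| reduce: "fg_module R X \<Longrightarrow> 0 < complexity R X \<Longrightarrow> complexity R X < \<infinity> \<Longrightarrow>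
     0 < n \<Longrightarrow> \<eta> \<in> carrier (Ext R X X n) \<Longrightarrow> fg_module R K \<Longrightarrow> is_K R X X n \<eta> K \<Longrightarrow>
     complexity R K < complexity R X \<Longrightarrow> depth R K = depth R X \<Longrightarrow>
     std_reducible_complexity R K \<Longrightarrow> std_reducible_complexity R X"

definition reducible_complexity :: "('a, 'r) ring_scheme \<Rightarrow> ('a, 'b) module \<Rightarrow> bool" where
  "reducible_complexity R M \<longleftrightarrow>
     (\<exists>X :: 'a std_module. module_isomorphic R M X \<and> std_reducible_complexity R X)"

end

(* Vanishing of Ext is handled on free resolutions: "acyclic_at R b d N n" says that every n-cocycle of
   Hom(P, N) is a coboundary. Mapping cones give the two-out-of-three properties of vanishing for the
   sequences 0 -> K_(i-1) -> K_i -> Omega(K_(i-1)) -> 0. As K_c has complexity 0, its minimal resolution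
   is finite; by Auslander-Buchsbaum and Nakayama, Ext^j(K_c, N) vanishes for j > p = depth A - depth M
   and not for j = p. Going down the chain, a gap of the given length makes all Ext^j(K_(i-1), N) with
   j > p vanish, since they are isomorphic to Ext^(j + |eta_i|)(K_(i-1), N). That Ext^p(K_(i-1), N) is
   nonzero follows from the same sequence if p > 0; for p = 0 it follows because Ext^*(X, N) does not
   vanish in all degrees for nonzero X and N. Depth is read off from Ext(k, -). *)

theory Submission
  imports Defs
begin

hide_fact (open) Modules.module_hom_def Modules.module_def

section \<open>Homomorphisms and free modules\<close>

text \<open>The bound (sum of the |eta_i|) - c is the cost of the links: Ext^j(K_i, N) vanishes once
  Ext^j(K_(i-1), N) and Ext^(j+|eta_i|-1)(K_(i-1), N) do, so a window of zeros shrinks by |eta_i| -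
  1 per link. On the way back the window of K_(i-1) still contains |eta_i| consecutive degrees, a
  full period of the shift by |eta_i|. The number p is the same for all links because the depths
  agree. Two obstacles shape the development. \<open>Ext\<close> is built from one chosen minimal
  resolution, while a mapping cone need not be minimal, so vanishing must be shown independent of
  the resolution. And vanishing alone is too coarse for Auslander-Buchsbaum: there a single cocycle
  is followed that is no coboundary but becomes one in a larger module, so part of the long exact
  sequence is stated for individual cochains. The chain needs exact sequences in the first argument
  of Ext, depth needs them in the second; both are chases with cochains, and connecting
  homomorphisms are never formed as maps.\<close>

lemma homI:
  assumes "\<And>x. x \<in> carrier M \<Longrightarrow> f x \<in> carrier N"
    and "\<And>x y. x \<in> carrier M \<Longrightarrow> y \<in> carrier M \<Longrightarrow> f (x \<oplus>\<^bsub>M\<^esub> y) = f x \<oplus>\<^bsub>N\<^esub> f y"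
    and "\<And>r x. r \<in> carrier R \<Longrightarrow> x \<in> carrier M \<Longrightarrow> f (r \<odot>\<^bsub>M\<^esub> x) = r \<odot>\<^bsub>N\<^esub> f x"
  shows "f \<in> module_hom R M N"
  using assms by (auto simp: module_hom_def)

lemma hom_closed: "f \<in> module_hom R M N \<Longrightarrow> x \<in> carrier M \<Longrightarrow> f x \<in> carrier N"
  by (auto simp: module_hom_def)

lemma hom_add:
  "f \<in> module_hom R M N \<Longrightarrow> x \<in> carrier M \<Longrightarrow> y \<in> carrier M \<Longrightarrow> f (x \<oplus>\<^bsub>M\<^esub> y) = f x \<oplus>\<^bsub>N\<^esub> f y"
  by (auto simp: module_hom_def)

lemma hom_smult:
  "f \<in> module_hom R M N \<Longrightarrow> r \<in> carrier R \<Longrightarrow> x \<in> carrier M \<Longrightarrow> f (r \<odot>\<^bsub>M\<^esub> x) = r \<odot>\<^bsub>N\<^esub> f x"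
  by (auto simp: module_hom_def)

lemma mod_homI: "module R M \<Longrightarrow> module R N \<Longrightarrow> f \<in> module_hom R M N \<Longrightarrow> mod_hom R M N f"
  by (simp add: mod_hom_def mod_hom_axioms_def)

lemma hom_zero:
  "module R M \<Longrightarrow> module R N \<Longrightarrow> f \<in> module_hom R M N \<Longrightarrow> f \<zero>\<^bsub>M\<^esub> = \<zero>\<^bsub>N\<^esub>"
  by (rule mod_hom.f0_is_0[OF mod_homI])

lemma hom_neg:
  "module R M \<Longrightarrow> module R N \<Longrightarrow> f \<in> module_hom R M N \<Longrightarrow> x \<in> carrier M \<Longrightarrow>
    f (\<ominus>\<^bsub>M\<^esub> x) = \<ominus>\<^bsub>N\<^esub> f x"
  by (rule mod_hom.f_neg[OF mod_homI])

lemma hom_minus: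
  "module R M \<Longrightarrow> module R N \<Longrightarrow> f \<in> module_hom R M N \<Longrightarrow> x \<in> carrier M \<Longrightarrow> y \<in> carrier M \<Longrightarrow>
    f (x \<ominus>\<^bsub>M\<^esub> y) = f x \<ominus>\<^bsub>N\<^esub> f y"
  by (rule mod_hom.f_minus[OF mod_homI])

lemma hom_cong:
  assumes "module R M" "f \<in> module_hom R M N" "\<And>x. x \<in> carrier M \<Longrightarrow> g x = f x"
  shows "g \<in> module_hom R M N"
proof -
  interpret M: Module.module R M by fact
  show ?thesis using assms(2,3) by (auto simp: module_hom_def)
qed

lemma hom_comp: "f \<in> module_hom R L M \<Longrightarrow> g \<in> module_hom R M N \<Longrightarrow> (\<lambda>x. g (f x)) \<in> module_hom R L N"
  by (auto simp: module_hom_def Pi_iff)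

lemma hom_id: "(\<lambda>x. x) \<in> module_hom R M M"
  by (auto simp: module_hom_def)

lemma hom_const_zero: "module R N \<Longrightarrow> (\<lambda>x. \<zero>\<^bsub>N\<^esub>) \<in> module_hom R M N"
proof -
  assume "module R N"
  then interpret N: Module.module R N .
  show ?thesis by (auto simp: module_hom_def)
qed

lemma hom_plus:
  assumes "module R N" "f \<in> module_hom R M N" "g \<in> module_hom R M N"
  shows "(\<lambda>x. f x \<oplus>\<^bsub>N\<^esub> g x) \<in> module_hom R M N"
proof -
  interpret N: Module.module R N by fact
  note [simp] = hom_closed[OF assms(2)] hom_closed[OF assms(3)]
  show ?thesis
    by (rule homI) (auto simp: hom_add[OF assms(2)] hom_add[OF assms(3)] hom_smult[OF assms(2)]
        hom_smult[OF assms(3)] N.a_ac N.smult_r_distr)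
qed

lemma hom_uminus:
  assumes "module R N" "f \<in> module_hom R M N"
  shows "(\<lambda>x. \<ominus>\<^bsub>N\<^esub> f x) \<in> module_hom R M N"
proof -
  interpret N: Module.module R N by fact
  note [simp] = hom_closed[OF assms(2)]
  show ?thesis
    by (rule homI) (auto simp: hom_add[OF assms(2)] hom_smult[OF assms(2)] N.minus_add N.smult_r_minus N.a_comm)
qed

lemma hom_diff:
  assumes "module R N" "f \<in> module_hom R M N" "g \<in> module_hom R M N"
  shows "(\<lambda>x. f x \<ominus>\<^bsub>N\<^esub> g x) \<in> module_hom R M N"
  unfolding a_minus_def by (intro hom_plus hom_uminus assms)

lemma hom_scale:
  assumes "module R N" "f \<in> module_hom R M N" "r \<in> carrier R"
  shows "(\<lambda>x. r \<odot>\<^bsub>N\<^esub> f x) \<in> module_hom R M N"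
proof -
  interpret N: Module.module R N by fact
  note [simp] = hom_closed[OF assms(2)]
  show ?thesis
    by (rule homI) (auto simp: hom_add[OF assms(2)] hom_smult[OF assms(2)] N.smult_r_distr assms(3)
        N.R.m_comm simp flip: N.smult_assoc1)
qed

lemma hom_finsum:
  assumes "module R N" "finite A" "\<And>i. i \<in> A \<Longrightarrow> f i \<in> module_hom R M N"
  shows "(\<lambda>x. \<Oplus>\<^bsub>N\<^esub>i\<in>A. f i x) \<in> module_hom R M N"
proof -
  interpret N: Module.module R N by fact
  have cl: "f i x \<in> carrier N" if "i \<in> A" "x \<in> carrier M" for i x
    using hom_closed assms(3) that by metis
  show ?thesis
  proof (rule homI)
    fix x assume "x \<in> carrier M"
    then show "(\<Oplus>\<^bsub>N\<^esub>i\<in>A. f i x) \<in> carrier N" using cl by (intro N.finsum_closed) auto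
  next
    fix x y assume xy: "x \<in> carrier M" "y \<in> carrier M"
    have "(\<Oplus>\<^bsub>N\<^esub>i\<in>A. f i (x \<oplus>\<^bsub>M\<^esub> y)) = (\<Oplus>\<^bsub>N\<^esub>i\<in>A. f i x \<oplus>\<^bsub>N\<^esub> f i y)"
      using xy cl hom_add[OF assms(3)] by (intro N.finsum_cong') auto
    also have "\<dots> = (\<Oplus>\<^bsub>N\<^esub>i\<in>A. f i x) \<oplus>\<^bsub>N\<^esub> (\<Oplus>\<^bsub>N\<^esub>i\<in>A. f i y)"
      using xy cl by (intro N.finsum_addf) auto
    finally show "(\<Oplus>\<^bsub>N\<^esub>i\<in>A. f i (x \<oplus>\<^bsub>M\<^esub> y)) = (\<Oplus>\<^bsub>N\<^esub>i\<in>A. f i x) \<oplus>\<^bsub>N\<^esub> (\<Oplus>\<^bsub>N\<^esub>i\<in>A. f i y)" .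
  next
    fix r x assume rx: "r \<in> carrier R" "x \<in> carrier M"
    have "(\<Oplus>\<^bsub>N\<^esub>i\<in>A. f i (r \<odot>\<^bsub>M\<^esub> x)) = (\<Oplus>\<^bsub>N\<^esub>i\<in>A. r \<odot>\<^bsub>N\<^esub> f i x)"
      using rx cl hom_smult[OF assms(3)] by (intro N.finsum_cong') auto
    also have "\<dots> = r \<odot>\<^bsub>N\<^esub> (\<Oplus>\<^bsub>N\<^esub>i\<in>A. f i x)"
      using rx cl assms(2) by (subst N.finsum_smult_ldistr) auto
    finally show "(\<Oplus>\<^bsub>N\<^esub>i\<in>A. f i (r \<odot>\<^bsub>M\<^esub> x)) = r \<odot>\<^bsub>N\<^esub> (\<Oplus>\<^bsub>N\<^esub>i\<in>A. f i x)" .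
  qed
qed

lemma (in abelian_group) minus_eq_zero_iff:
  assumes "x \<in> carrier G" "y \<in> carrier G"
  shows "x \<ominus> y = \<zero> \<longleftrightarrow> x = y"
  using assms by (metis minus_eq minus_minus minus_equality a_inv_closed r_neg)

lemma (in abelian_group) minus_plus_cancel:
  assumes "x \<in> carrier G" "y \<in> carrier G"
  shows "x \<ominus> y \<oplus> y = x"
  using assms by (simp add: minus_eq a_assoc l_neg)

lemma ring_module_simps [simp]:
  "carrier (ring_module R) = carrier R"
  "x \<oplus>\<^bsub>ring_module R\<^esub> y = x \<oplus>\<^bsub>R\<^esub> y"
  "r \<odot>\<^bsub>ring_module R\<^esub> x = r \<otimes>\<^bsub>R\<^esub> x"
  "\<zero>\<^bsub>ring_module R\<^esub> = \<zero>\<^bsub>R\<^esub>"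
  by (simp_all add: ring_module_def)

section \<open>Free modules: standard basis, linear extension and lifting\<close>

definition unitv :: "('a, 'r) ring_scheme \<Rightarrow> nat \<Rightarrow> nat \<Rightarrow> nat \<Rightarrow> 'a" where
  "unitv R n i = (\<lambda>j\<in>{..<n}. if j = i then \<one>\<^bsub>R\<^esub> else \<zero>\<^bsub>R\<^esub>)"

definition lin :: "('a, 'b) module \<Rightarrow> nat \<Rightarrow> (nat \<Rightarrow> 'b) \<Rightarrow> (nat \<Rightarrow> 'a) \<Rightarrow> 'b" where
  "lin N n y x = (\<Oplus>\<^bsub>N\<^esub>i\<in>{..<n}. x i \<odot>\<^bsub>N\<^esub> y i)"

context cring
begin

lemma ring_module_module: "module R (ring_module R)"
  by (rule module_criteria)
    (auto simp: is_cring a_assoc a_comm a_lcomm m_assoc l_distr r_distr intro!: bexI[of _ "\<ominus> _"] r_neg)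

lemma free_simps [simp]:
  "x \<in> carrier (free_module R n) \<longleftrightarrow> x \<in> {..<n} \<rightarrow>\<^sub>E carrier R"
  "x \<oplus>\<^bsub>free_module R n\<^esub> y = (\<lambda>i\<in>{..<n}. x i \<oplus> y i)"
  "r \<odot>\<^bsub>free_module R n\<^esub> x = (\<lambda>i\<in>{..<n}. r \<otimes> x i)"
  "\<zero>\<^bsub>free_module R n\<^esub> = (\<lambda>i\<in>{..<n}. \<zero>)"
  by (simp_all add: free_module_def func_space_def)

lemma free_module_module: "module R (free_module R n)"
  unfolding free_module_def by (rule func_space_is_module)

lemma free_minus [simp]:
  assumes "x \<in> {..<n} \<rightarrow>\<^sub>E carrier R" "y \<in> {..<n} \<rightarrow>\<^sub>E carrier R"
  shows "x \<ominus>\<^bsub>free_module R n\<^esub> y = (\<lambda>i\<in>{..<n}. x i \<ominus> y i)"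
proof -
  interpret F: Module.module R "free_module R n" by (rule free_module_module)
  have yneg: "(\<lambda>i\<in>{..<n}. \<ominus> y i) \<in> carrier (free_module R n)" using assms by (auto simp: PiE_iff)
  have "(\<lambda>i\<in>{..<n}. \<ominus> y i) \<oplus>\<^bsub>free_module R n\<^esub> y = \<zero>\<^bsub>free_module R n\<^esub>"
    using assms by (auto simp: PiE_iff l_neg intro!: restrict_ext)
  then have "\<ominus>\<^bsub>free_module R n\<^esub> y = (\<lambda>i\<in>{..<n}. \<ominus> y i)"
    using F.minus_equality yneg assms by simp
  then show ?thesis by (auto simp: a_minus_def intro!: restrict_ext)
qed

lemma free_eqI:
  "x \<in> {..<n} \<rightarrow>\<^sub>E carrier R \<Longrightarrow> y \<in> {..<n} \<rightarrow>\<^sub>E carrier R \<Longrightarrow> (\<And>i. i < n \<Longrightarrow> x i = y i) \<Longrightarrow> x = y"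
  by (rule PiE_ext) auto

lemma free_coord: "x \<in> {..<n} \<rightarrow>\<^sub>E carrier R \<Longrightarrow> i < n \<Longrightarrow> x i \<in> carrier R"
  by auto

lemma unitv_closed [simp]: "unitv R n i \<in> {..<n} \<rightarrow>\<^sub>E carrier R"
  by (auto simp: unitv_def)

lemma unitv_apply: "j < n \<Longrightarrow> unitv R n i j = (if j = i then \<one> else \<zero>)"
  by (simp add: unitv_def)

lemma lin_hom:
  assumes "module R N" "\<And>i. i < n \<Longrightarrow> y i \<in> carrier N"
  shows "lin N n y \<in> module_hom R (free_module R n) N"
proof -
  interpret N: Module.module R N by fact
  have "(\<lambda>x. x i \<odot>\<^bsub>N\<^esub> y i) \<in> module_hom R (free_module R n) N" if "i < n" for i
    using that assms(2)[OF that] free_coord[OF _ that]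
    by (intro homI) (simp_all add: N.smult_l_distr N.smult_assoc1)
  then show ?thesis unfolding lin_def by (intro hom_finsum assms(1)) auto
qed

lemma lin_unitv:
  assumes "module R N" "\<And>i. i < n \<Longrightarrow> y i \<in> carrier N" "i < n"
  shows "lin N n y (unitv R n i) = y i"
proof -
  interpret N: Module.module R N by fact
  have "lin N n y (unitv R n i) = (\<Oplus>\<^bsub>N\<^esub>j\<in>{..<n}. if i = j then y j else \<zero>\<^bsub>N\<^esub>)"
    unfolding lin_def using assms(2) by (intro N.finsum_cong') (auto simp: unitv_apply)
  also have "\<dots> = y i" using assms(2,3) by (intro N.finsum_singleton) auto
  finally show ?thesis .
qed

text \<open>Induction on the number \<open>k\<close> of leading coordinates that may be nonzero, so
  that no finite sums have to be handled. The step splits off coordinate \<open>k\<close> as a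
  multiple of a basis vector, and both maps respect the splitting.\<close>

lemma hom_free_eq:
  assumes N: "module R N" and f: "f \<in> module_hom R (free_module R n) N"
    and g: "g \<in> module_hom R (free_module R n) N"
    and eq: "\<And>i. i < n \<Longrightarrow> f (unitv R n i) = g (unitv R n i)"
    and x: "x \<in> {..<n} \<rightarrow>\<^sub>E carrier R"
  shows "f x = g x"
proof -
  interpret N: Module.module R N by fact
  let ?F = "free_module R n"
  have "\<forall>x\<in>{..<n} \<rightarrow>\<^sub>E carrier R. (\<forall>j<n. k \<le> j \<longrightarrow> x j = \<zero>) \<longrightarrow> f x = g x" if "k \<le> n" for k
    using that
  proof (induction k)
    case 0
    show ?case
    proof (intro ballI impI)
      fix x assume x: "x \<in> {..<n} \<rightarrow>\<^sub>E carrier R" "\<forall>j<n. 0 \<le> j \<longrightarrow> x j = \<zero>"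
      then have "x = \<zero>\<^bsub>?F\<^esub>" by (intro free_eqI[of _ n]) auto
      then show "f x = g x" using hom_zero[OF free_module_module N] f g by metis
    qed
  next
    case (Suc k)
    then have k: "k < n" by simp
    show ?case
    proof (intro ballI impI)
      fix x assume x: "x \<in> {..<n} \<rightarrow>\<^sub>E carrier R" "\<forall>j<n. Suc k \<le> j \<longrightarrow> x j = \<zero>"
      define x' where "x' = (\<lambda>j\<in>{..<n}. if j = k then \<zero> else x j)"
      have x': "x' \<in> {..<n} \<rightarrow>\<^sub>E carrier R" using x by (auto simp: x'_def PiE_iff)
      have xk: "x k \<in> carrier R" using x k by auto
      have dec: "x = x' \<oplus>\<^bsub>?F\<^esub> (x k \<odot>\<^bsub>?F\<^esub> unitv R n k)"
        using x xk by (intro free_eqI[of _ n]) (auto simp: x'_def unitv_apply PiE_iff)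
      have u: "x k \<odot>\<^bsub>?F\<^esub> unitv R n k \<in> carrier ?F" using xk by (auto simp: unitv_apply)
      have "f x' = g x'" using Suc x' x by (auto simp: x'_def not_less_eq_eq)
      moreover have "h x = h x' \<oplus>\<^bsub>N\<^esub> x k \<odot>\<^bsub>N\<^esub> h (unitv R n k)" if h: "h \<in> module_hom R ?F N" for h
        by (subst dec) (use hom_add[OF h _ u] x' hom_smult[OF h xk] in \<open>simp del: free_simps(2,3)\<close>)
      ultimately show "f x = g x" using f g eq[OF k] by metis
    qed
  qed
  from this[of n] x show ?thesis by auto
qed

lemma hom_free_lin:
  assumes N: "module R N" and f: "f \<in> module_hom R (free_module R n) N"
    and x: "x \<in> {..<n} \<rightarrow>\<^sub>E carrier R"
  shows "f x = lin N n (\<lambda>i. f (unitv R n i)) x"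
proof (rule hom_free_eq[OF N f _ _ x])
  have c: "f (unitv R n i) \<in> carrier N" for i using hom_closed[OF f] by simp
  show "lin N n (\<lambda>i. f (unitv R n i)) \<in> module_hom R (free_module R n) N" by (rule lin_hom[OF N c])
  show "f (unitv R n i) = lin N n (\<lambda>i. f (unitv R n i)) (unitv R n i)" if "i < n" for i
    by (rule lin_unitv[OF N c that, symmetric])
qed

lemma coord_hom: "i < n \<Longrightarrow> (\<lambda>x. x i) \<in> module_hom R (free_module R n) (ring_module R)"
  by (rule homI) auto

lemma tuple_hom:
  assumes M: "module R M" and "\<And>i. i < n \<Longrightarrow> g i \<in> module_hom R M (ring_module R)"
  shows "(\<lambda>x. \<lambda>i\<in>{..<n}. g i x) \<in> module_hom R M (free_module R n)"
proof -
  interpret M: Module.module R M by fact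
  show ?thesis
    using hom_closed[OF assms(2)] hom_add[OF assms(2)] hom_smult[OF assms(2)]
    by (intro homI) (auto intro!: restrict_ext)
qed

text \<open>Projectivity of the free module in a relative form: \<open>g\<close> need not be
  surjective, only the values of \<open>h\<close> must lie in its image. For an injective
  \<open>g\<close> the same statement factors a map through a submodule.\<close>

lemma hom_lift:
  fixes B :: "('a, 'c) module"
  assumes B: "module R B" and C: "module R C" and g: "g \<in> module_hom R B C"
    and h: "h \<in> module_hom R (free_module R n) C"
    and im: "\<And>x. x \<in> {..<n} \<rightarrow>\<^sub>E carrier R \<Longrightarrow> h x \<in> g ` carrier B"
  obtains l where "l \<in> module_hom R (free_module R n) B"
    "\<And>x. x \<in> {..<n} \<rightarrow>\<^sub>E carrier R \<Longrightarrow> g (l x) = h x"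
proof -
  have "\<forall>i. \<exists>y\<in>carrier B. g y = h (unitv R n i)" using im[OF unitv_closed] by (metis imageE)
  then obtain y where y: "\<And>i. y i \<in> carrier B" "\<And>i. g (y i) = h (unitv R n i)" by metis
  have l: "lin B n y \<in> module_hom R (free_module R n) B" by (intro lin_hom B y(1))
  have "g (lin B n y x) = h x" if "x \<in> {..<n} \<rightarrow>\<^sub>E carrier R" for x
    by (rule hom_free_eq[OF C hom_comp[OF l g] h _ that]) (simp add: lin_unitv[OF B y(1)] y(2))
  then show ?thesis using that l by blast
qed

end

section \<open>Submodules and quotients\<close>

abbreviation submod :: "('a, 'r) ring_scheme \<Rightarrow> 'b set \<Rightarrow> ('a, 'b) module \<Rightarrow> bool" where
  "submod R U M \<equiv> LinearCombinations.submodule R U M"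

lemma submodI:
  assumes "module R M" "U \<subseteq> carrier M" "\<zero>\<^bsub>M\<^esub> \<in> U"
    "\<And>v w. v \<in> U \<Longrightarrow> w \<in> U \<Longrightarrow> v \<oplus>\<^bsub>M\<^esub> w \<in> U"
    "\<And>c v. c \<in> carrier R \<Longrightarrow> v \<in> U \<Longrightarrow> c \<odot>\<^bsub>M\<^esub> v \<in> U"
  shows "submod R U M"
  using assms by (simp add: LinearCombinations.submodule_def)

lemma submodD:
  assumes "submod R U M"
  shows "module R M" "U \<subseteq> carrier M" "\<zero>\<^bsub>M\<^esub> \<in> U"
    "\<And>v w. v \<in> U \<Longrightarrow> w \<in> U \<Longrightarrow> v \<oplus>\<^bsub>M\<^esub> w \<in> U"
    "\<And>c v. c \<in> carrier R \<Longrightarrow> v \<in> U \<Longrightarrow> c \<odot>\<^bsub>M\<^esub> v \<in> U"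
  using assms by (simp_all add: LinearCombinations.submodule_def)

lemma submod_neg: "submod R U M \<Longrightarrow> x \<in> U \<Longrightarrow> \<ominus>\<^bsub>M\<^esub> x \<in> U"
proof -
  assume U: "submod R U M" and x: "x \<in> U"
  interpret M: Module.module R M by (rule submodD(1)[OF U])
  have "\<ominus>\<^bsub>M\<^esub> x = (\<ominus>\<^bsub>R\<^esub> \<one>\<^bsub>R\<^esub>) \<odot>\<^bsub>M\<^esub> x"
    using submodD(2)[OF U] x by (subst M.smult_l_minus) auto
  then show ?thesis using submodD(5)[OF U _ x] by simp
qed

lemma submod_minus: "submod R U M \<Longrightarrow> x \<in> U \<Longrightarrow> y \<in> U \<Longrightarrow> x \<ominus>\<^bsub>M\<^esub> y \<in> U"
  by (simp add: a_minus_def submodD(4) submod_neg)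

lemma submod_module: "submod R U M \<Longrightarrow> module R (M\<lparr>carrier := U\<rparr>)"
  using module.submodule_is_module[OF submodD(1)] by blast

lemma submod_carrier: "module R M \<Longrightarrow> submod R (carrier M) M"
proof -
  assume "module R M"
  then interpret M: Module.module R M .
  show ?thesis by (rule submodI) (auto intro: M.module_axioms)
qed

lemma submod_image:
  "module R M \<Longrightarrow> module R N \<Longrightarrow> f \<in> module_hom R M N \<Longrightarrow> submod R (f ` carrier M) N"
  using mod_hom.im_is_submodule[OF mod_homI] mod_hom.im_def[OF mod_homI] by metis

lemma submod_image':
  assumes "module R N" "f \<in> module_hom R M N" "submod R U M"
  shows "submod R (f ` U) N"
proof -
  have "f \<in> module_hom R (M\<lparr>carrier := U\<rparr>) N"
    using submodD(2)[OF assms(3)]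
    by (intro homI) (auto simp: hom_add[OF assms(2)] hom_smult[OF assms(2)] subset_iff
        intro: hom_closed[OF assms(2)])
  from submod_image[OF submod_module[OF assms(3)] assms(1) this] show ?thesis by simp
qed

lemma submod_vimage:
  assumes "module R M" "module R N" "f \<in> module_hom R M N" "submod R U N"
  shows "submod R {x \<in> carrier M. f x \<in> U} M"
proof -
  interpret M: Module.module R M by fact
  show ?thesis
    using submodD(3-5)[OF assms(4)] hom_zero[OF assms(1-3)] hom_add[OF assms(3)] hom_smult[OF assms(3)]
    by (intro submodI assms(1)) auto
qed

lemma submod_zero: "module R M \<Longrightarrow> submod R {\<zero>\<^bsub>M\<^esub>} M"
proof -
  assume "module R M"
  then interpret M: Module.module R M .
  show ?thesis by (rule submodI) (auto intro: M.module_axioms)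
qed

lemma submod_kernel:
  fixes N :: "('a, 'c) module"
  assumes "module R M" "module R N" "f \<in> module_hom R M N"
  shows "submod R {x \<in> carrier M. f x = \<zero>\<^bsub>N\<^esub>} M"
  using submod_vimage[OF assms submod_zero[OF assms(2)]] by simp

lemma hom_into_submod:
  assumes "f \<in> module_hom R L M" "\<And>x. x \<in> carrier L \<Longrightarrow> f x \<in> U"
  shows "f \<in> module_hom R L (M\<lparr>carrier := U\<rparr>)"
  using assms by (auto simp: module_hom_def)

lemma hom_from_submod:
  assumes "submod R U M"
  shows "(\<lambda>x. x) \<in> module_hom R (M\<lparr>carrier := U\<rparr>) M"
  using submodD(2)[OF assms] by (auto simp: module_hom_def)

section \<open>Cosets and quotient modules\<close>

context
  fixes R :: "('a, 'r) ring_scheme" and M :: "('a, 'b) module" and U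
  assumes U: "submod R U M"
begin

interpretation M: Module.module R M by (rule submodD(1)[OF U])

interpretation U: abelian_subgroup U M
proof (rule abelian_subgroupI3)
  show "additive_subgroup U M"
    by (rule additive_subgroup.intro, rule subgroup.intro)
      (use submodD[OF U] submod_neg[OF U] in \<open>auto simp: a_inv_def\<close>)
  show "abelian_group M" by (rule M.abelian_group_axioms)
qed

lemma coset_eq_iff:
  assumes "x \<in> carrier M" "y \<in> carrier M"
  shows "U +>\<^bsub>M\<^esub> x = U +>\<^bsub>M\<^esub> y \<longleftrightarrow> x \<ominus>\<^bsub>M\<^esub> y \<in> U"
proof
  assume "U +>\<^bsub>M\<^esub> x = U +>\<^bsub>M\<^esub> y"
  then have "x \<in> U +>\<^bsub>M\<^esub> y" using U.a_rcos_self[OF assms(1)] by simp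
  then obtain h where h: "h \<in> U" "x = h \<oplus>\<^bsub>M\<^esub> y" by (auto simp: a_r_coset_def')
  have "h \<in> carrier M" using h(1) submodD(2)[OF U] by auto
  then have "x \<ominus>\<^bsub>M\<^esub> y = h" using h(2) assms by (simp add: a_minus_def M.a_assoc M.r_neg)
  then show "x \<ominus>\<^bsub>M\<^esub> y \<in> U" using h by simp
next
  assume "x \<ominus>\<^bsub>M\<^esub> y \<in> U"
  moreover have "x = (x \<ominus>\<^bsub>M\<^esub> y) \<oplus>\<^bsub>M\<^esub> y" using assms by (simp add: a_minus_def M.a_assoc M.l_neg)
  ultimately have "x \<in> U +>\<^bsub>M\<^esub> y" by (auto simp: a_r_coset_def')
  then show "U +>\<^bsub>M\<^esub> x = U +>\<^bsub>M\<^esub> y"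
    using M.a_repr_independence[OF _ assms(2) U.a_subgroup] by metis
qed

lemma coset_self: "x \<in> carrier M \<Longrightarrow> x \<in> U +>\<^bsub>M\<^esub> x"
  by (rule U.a_rcos_self)

lemma coset_zero: "U +>\<^bsub>M\<^esub> \<zero>\<^bsub>M\<^esub> = U"
  using submodD(2)[OF U] by (rule M.a_coset_add_zero)

lemma coset_subset: "x \<in> carrier M \<Longrightarrow> U +>\<^bsub>M\<^esub> x \<subseteq> carrier M"
  using submodD(2)[OF U] by (rule M.a_r_coset_subset_G)

lemma coset_memD: "x \<in> carrier M \<Longrightarrow> y \<in> U +>\<^bsub>M\<^esub> x \<Longrightarrow> U +>\<^bsub>M\<^esub> y = U +>\<^bsub>M\<^esub> x"
  using M.a_repr_independence[OF _ _ U.a_subgroup] by metis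

lemma quot_simps:
  "carrier (quot_module M U) = (\<lambda>x. U +>\<^bsub>M\<^esub> x) ` carrier M"
  "\<zero>\<^bsub>quot_module M U\<^esub> = U"
  "x \<in> carrier M \<Longrightarrow> y \<in> carrier M \<Longrightarrow>
     (U +>\<^bsub>M\<^esub> x) \<oplus>\<^bsub>quot_module M U\<^esub> (U +>\<^bsub>M\<^esub> y) = U +>\<^bsub>M\<^esub> (x \<oplus>\<^bsub>M\<^esub> y)"
  "r \<in> carrier R \<Longrightarrow> x \<in> carrier M \<Longrightarrow>
     r \<odot>\<^bsub>quot_module M U\<^esub> (U +>\<^bsub>M\<^esub> x) = U +>\<^bsub>M\<^esub> (r \<odot>\<^bsub>M\<^esub> x)"
proof -
  show "carrier (quot_module M U) = (\<lambda>x. U +>\<^bsub>M\<^esub> x) ` carrier M"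
    by (auto simp: quot_module_def A_RCOSETS_def')
  show "\<zero>\<^bsub>quot_module M U\<^esub> = U" by (simp add: quot_module_def)
  show "(U +>\<^bsub>M\<^esub> x) \<oplus>\<^bsub>quot_module M U\<^esub> (U +>\<^bsub>M\<^esub> y) = U +>\<^bsub>M\<^esub> (x \<oplus>\<^bsub>M\<^esub> y)"
    if "x \<in> carrier M" "y \<in> carrier M" using U.a_rcos_sum that by (simp add: quot_module_def)
  assume r: "r \<in> carrier R" and x: "x \<in> carrier M"
  \<comment> \<open>The scalar action is a union of cosets over all representatives. These cosets
    coincide, so the union collapses to one of them.\<close>
  have "U +>\<^bsub>M\<^esub> (r \<odot>\<^bsub>M\<^esub> x') = U +>\<^bsub>M\<^esub> (r \<odot>\<^bsub>M\<^esub> x)" if x': "x' \<in> U +>\<^bsub>M\<^esub> x" for x'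
  proof -
    have c: "x' \<in> carrier M" using coset_subset[OF x] x' by auto
    have "x' \<ominus>\<^bsub>M\<^esub> x \<in> U" using coset_memD[OF x x'] coset_eq_iff[OF c x] by simp
    then have "r \<odot>\<^bsub>M\<^esub> (x' \<ominus>\<^bsub>M\<^esub> x) \<in> U" using submodD(5)[OF U r] by simp
    moreover have "r \<odot>\<^bsub>M\<^esub> (x' \<ominus>\<^bsub>M\<^esub> x) = r \<odot>\<^bsub>M\<^esub> x' \<ominus>\<^bsub>M\<^esub> r \<odot>\<^bsub>M\<^esub> x"
      using c x r by (simp add: a_minus_def M.smult_r_distr M.smult_r_minus)
    ultimately show ?thesis using coset_eq_iff r c x by simp
  qed
  then have "(\<Union>x'\<in>U +>\<^bsub>M\<^esub> x. U +>\<^bsub>M\<^esub> (r \<odot>\<^bsub>M\<^esub> x')) = (\<Union>x'\<in>U +>\<^bsub>M\<^esub> x. U +>\<^bsub>M\<^esub> (r \<odot>\<^bsub>M\<^esub> x))"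
    by (rule SUP_cong[OF refl])
  also have "\<dots> = U +>\<^bsub>M\<^esub> (r \<odot>\<^bsub>M\<^esub> x)" using coset_self[OF x] by blast
  finally show "r \<odot>\<^bsub>quot_module M U\<^esub> (U +>\<^bsub>M\<^esub> x) = U +>\<^bsub>M\<^esub> (r \<odot>\<^bsub>M\<^esub> x)"
    by (simp add: quot_module_def)
qed

lemma quot_module_module: "module R (quot_module M U)"
proof (rule module_criteria)
  show "cring R" by (rule M.R.is_cring)
  have 0: "U = U +>\<^bsub>M\<^esub> \<zero>\<^bsub>M\<^esub>" by (simp add: coset_zero)
  note q = quot_simps
  show "\<zero>\<^bsub>quot_module M U\<^esub> \<in> carrier (quot_module M U)" using 0 by (auto simp: q(1,2))
  show "\<forall>v\<in>carrier (quot_module M U). v \<oplus>\<^bsub>quot_module M U\<^esub> \<zero>\<^bsub>quot_module M U\<^esub> = v"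
    by (simp add: q(1,2)) (subst 0, simp add: q(3))
  show "\<forall>v\<in>carrier (quot_module M U). \<exists>neg_v\<in>carrier (quot_module M U).
      v \<oplus>\<^bsub>quot_module M U\<^esub> neg_v = \<zero>\<^bsub>quot_module M U\<^esub>"
  proof
    fix v assume "v \<in> carrier (quot_module M U)"
    then obtain x where "x \<in> carrier M" "v = U +>\<^bsub>M\<^esub> x" by (auto simp: q(1))
    then show "\<exists>neg_v\<in>carrier (quot_module M U). v \<oplus>\<^bsub>quot_module M U\<^esub> neg_v = \<zero>\<^bsub>quot_module M U\<^esub>"
      by (intro bexI[of _ "U +>\<^bsub>M\<^esub> (\<ominus>\<^bsub>M\<^esub> x)"]) (auto simp: q M.r_neg coset_zero)
  qed
qed (auto simp: quot_simps M.a_assoc M.a_comm M.a_lcomm M.smult_assoc1 M.smult_l_distr M.smult_r_distr)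

lemma quot_proj_hom: "(\<lambda>x. U +>\<^bsub>M\<^esub> x) \<in> module_hom R M (quot_module M U)"
  by (rule homI) (auto simp: quot_simps)

lemma quot_zero_iff: "x \<in> carrier M \<Longrightarrow> U +>\<^bsub>M\<^esub> x = \<zero>\<^bsub>quot_module M U\<^esub> \<longleftrightarrow> x \<in> U"
  using coset_eq_iff[of x "\<zero>\<^bsub>M\<^esub>"] by (simp add: quot_simps coset_zero M.minus_eq M.add.inv_one[folded a_inv_def])

lemma zero_quot_iff: "zero_module (quot_module M U) \<longleftrightarrow> carrier M \<subseteq> U"
proof -
  have "zero_module (quot_module M U) \<longleftrightarrow> (\<forall>x\<in>carrier M. U +>\<^bsub>M\<^esub> x = \<zero>\<^bsub>quot_module M U\<^esub>)"
    unfolding zero_module_def using module.axioms(2)[OF quot_module_module] M.zero_closed by (auto simp: quot_simps(1))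
  then show ?thesis using quot_zero_iff by auto
qed

end

lemma zero_module_iff: "module R M \<Longrightarrow> zero_module M \<longleftrightarrow> (\<forall>x\<in>carrier M. x = \<zero>\<^bsub>M\<^esub>)"
proof -
  assume "module R M"
  then interpret M: Module.module R M .
  show ?thesis by (auto simp: zero_module_def)
qed

text \<open>The universal property of a quotient, for an arbitrary surjection \<open>p\<close>:
  \<open>g\<close> is applied to a chosen preimage, and the kernel condition makes the result
  independent of the choice, hence linear.\<close>

lemma hom_factor:
  assumes F: "module R F" and M: "module R M" and N: "module R N"
    and p: "p \<in> module_hom R F M" "p ` carrier F = carrier M"
    and g: "g \<in> module_hom R F N"
    and ker: "\<And>x. x \<in> carrier F \<Longrightarrow> p x = \<zero>\<^bsub>M\<^esub> \<Longrightarrow> g x = \<zero>\<^bsub>N\<^esub>"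
  obtains h where "h \<in> module_hom R M N" "\<And>x. x \<in> carrier F \<Longrightarrow> h (p x) = g x"
proof -
  interpret F: Module.module R F by fact
  interpret M: Module.module R M by fact
  interpret N: Module.module R N by fact
  define s where "s y = (SOME x. x \<in> carrier F \<and> p x = y)" for y
  have s: "s y \<in> carrier F \<and> p (s y) = y" if "y \<in> carrier M" for y
    unfolding s_def by (rule someI_ex) (use that in \<open>unfold p(2)[symmetric], blast\<close>)
  have eq: "g x = g x'" if "x \<in> carrier F" "x' \<in> carrier F" "p x = p x'" for x x'
  proof -
    have "p (x \<ominus>\<^bsub>F\<^esub> x') = \<zero>\<^bsub>M\<^esub>"
      using that hom_minus[OF F M p(1)] M.minus_eq_zero_iff hom_closed[OF p(1)] by simp
    then have "g x \<ominus>\<^bsub>N\<^esub> g x' = \<zero>\<^bsub>N\<^esub>"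
      using ker[of "x \<ominus>\<^bsub>F\<^esub> x'"] that hom_minus[OF F N g] by simp
    then show ?thesis using N.minus_eq_zero_iff hom_closed[OF g] that by simp
  qed
  show ?thesis
  proof (rule that)
    show *: "g (s (p x)) = g x" if "x \<in> carrier F" for x
      using eq[of "s (p x)" x] s[of "p x"] that hom_closed[OF p(1)] by simp
    show "(\<lambda>y. g (s y)) \<in> module_hom R M N"
    proof (rule homI)
      fix y assume "y \<in> carrier M" then show "g (s y) \<in> carrier N" using s hom_closed[OF g] by simp
    next
      fix y z assume "y \<in> carrier M" "z \<in> carrier M"
      then show "g (s (y \<oplus>\<^bsub>M\<^esub> z)) = g (s y) \<oplus>\<^bsub>N\<^esub> g (s z)"
        using *[of "s y \<oplus>\<^bsub>F\<^esub> s z"] s hom_add[OF p(1)] hom_add[OF g] by simp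
    next
      fix r y assume "r \<in> carrier R" "y \<in> carrier M"
      then show "g (s (r \<odot>\<^bsub>M\<^esub> y)) = r \<odot>\<^bsub>N\<^esub> g (s y)"
        using *[of "r \<odot>\<^bsub>F\<^esub> s y"] s hom_smult[OF p(1)] hom_smult[OF g] by simp
    qed
  qed
qed

section \<open>Noetherian modules\<close>

text \<open>Generation is expressed by a map from a free module instead of a spanning set:
  generators are then combined by composing and pairing homomorphisms, without rearranging linear
  combinations.\<close>

definition fg_sub :: "('a, 'r) ring_scheme \<Rightarrow> ('a, 'b) module \<Rightarrow> 'b set \<Rightarrow> bool" where
  "fg_sub R M U \<longleftrightarrow>
     (\<exists>n. \<exists>f\<in>module_hom R (free_module R n) M. f ` carrier (free_module R n) = U)"

text \<open>The splitting of R^(m+k) into R^m and R^k by concatenating coordinates. The sum has to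
  remain a \<open>free_module\<close>, since the resolutions below admit only modules of that form;
  a direct sum of modules would have another type.\<close>

definition fstp :: "nat \<Rightarrow> (nat \<Rightarrow> 'a) \<Rightarrow> nat \<Rightarrow> 'a" where
  "fstp m x = (\<lambda>i\<in>{..<m}. x i)"

definition sndp :: "nat \<Rightarrow> nat \<Rightarrow> (nat \<Rightarrow> 'a) \<Rightarrow> nat \<Rightarrow> 'a" where
  "sndp m k x = (\<lambda>i\<in>{..<k}. x (m + i))"

definition pairp :: "nat \<Rightarrow> nat \<Rightarrow> (nat \<Rightarrow> 'a) \<Rightarrow> (nat \<Rightarrow> 'a) \<Rightarrow> nat \<Rightarrow> 'a" where
  "pairp m k x y = (\<lambda>i\<in>{..<m + k}. if i < m then x i else y (i - m))"

context cring
begin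

lemma fstp_hom: "fstp m \<in> module_hom R (free_module R (m + k)) (free_module R m)"
  unfolding fstp_def[abs_def] by (intro tuple_hom free_module_module coord_hom) simp

lemma sndp_hom: "sndp m k \<in> module_hom R (free_module R (m + k)) (free_module R k)"
  unfolding sndp_def[abs_def] by (intro tuple_hom free_module_module coord_hom) simp

lemma fstp_closed: "x \<in> {..<m + k} \<rightarrow>\<^sub>E carrier R \<Longrightarrow> fstp m x \<in> {..<m} \<rightarrow>\<^sub>E carrier R"
  using hom_closed[OF fstp_hom] by simp

lemma sndp_closed: "x \<in> {..<m + k} \<rightarrow>\<^sub>E carrier R \<Longrightarrow> sndp m k x \<in> {..<k} \<rightarrow>\<^sub>E carrier R"
  using hom_closed[OF sndp_hom] by simp

lemma pairp_closed:
  "x \<in> {..<m} \<rightarrow>\<^sub>E carrier R \<Longrightarrow> y \<in> {..<k} \<rightarrow>\<^sub>E carrier R \<Longrightarrow>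
    pairp m k x y \<in> {..<m + k} \<rightarrow>\<^sub>E carrier R"
  by (auto simp: pairp_def intro!: free_coord[of y k])

lemma fstp_pairp: "x \<in> {..<m} \<rightarrow>\<^sub>E carrier R \<Longrightarrow> fstp m (pairp m k x y) = x"
  by (rule free_eqI[of _ m]) (auto simp: fstp_def pairp_def free_coord)

lemma sndp_pairp: "y \<in> {..<k} \<rightarrow>\<^sub>E carrier R \<Longrightarrow> sndp m k (pairp m k x y) = y"
  by (rule free_eqI[of _ k]) (auto simp: sndp_def pairp_def free_coord)

lemma pairp_fstp_sndp:
  assumes "x \<in> {..<m + k} \<rightarrow>\<^sub>E carrier R"
  shows "pairp m k (fstp m x) (sndp m k x) = x"
proof (rule free_eqI[OF pairp_closed[OF fstp_closed[OF assms] sndp_closed[OF assms]] assms])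
  fix i assume i: "i < m + k"
  then have "\<not> i < m \<Longrightarrow> i - m < k" by arith
  then show "pairp m k (fstp m x) (sndp m k x) i = x i"
    using i by (cases "i < m") (simp_all add: fstp_def sndp_def pairp_def)
qed

lemma pairp_hom:
  assumes M: "module R M" and f: "f \<in> module_hom R M (free_module R m)"
    and g: "g \<in> module_hom R M (free_module R k)"
  shows "(\<lambda>x. pairp m k (f x) (g x)) \<in> module_hom R M (free_module R (m + k))"
  unfolding pairp_def
proof (intro tuple_hom M)
  fix i assume i: "i < m + k"
  show "(\<lambda>x. if i < m then f x i else g x (i - m)) \<in> module_hom R M (ring_module R)"
    using hom_comp[OF f coord_hom[of i m]] hom_comp[OF g coord_hom[of "i - m" k]] i
    by (cases "i < m") auto
qed

lemma fg_subI:
  "f \<in> module_hom R (free_module R n) M \<Longrightarrow> f ` carrier (free_module R n) = U \<Longrightarrow> fg_sub R M U"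
  unfolding fg_sub_def by blast

text \<open>\<open>f\<close> followed by the projection to N/W agrees with the zero map on the
  basis, hence everywhere.\<close>

lemma free_image_subset:
  fixes N :: "('a, 'm) module"
  assumes W: "submod R W N" and f: "f \<in> module_hom R (free_module R n) N"
    and e: "\<And>i. i < n \<Longrightarrow> f (unitv R n i) \<in> W" and x: "x \<in> {..<n} \<rightarrow>\<^sub>E carrier R"
  shows "f x \<in> W"
proof -
  have c: "f y \<in> carrier N" if "y \<in> {..<n} \<rightarrow>\<^sub>E carrier R" for y using hom_closed[OF f] that by simp
  have "W +>\<^bsub>N\<^esub> f x = \<zero>\<^bsub>quot_module N W\<^esub>"
    by (rule hom_free_eq[OF quot_module_module[OF W] hom_comp[OF f quot_proj_hom[OF W]]
          hom_const_zero[OF quot_module_module[OF W]] _ x])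
      (use quot_zero_iff[OF W c[OF unitv_closed]] e in simp)
  then show ?thesis using quot_zero_iff[OF W c[OF x]] by simp
qed

lemma fg_module_iff:
  fixes M :: "('a, 'm) module"
  shows "fg_module R M \<longleftrightarrow> module R M \<and> fg_sub R M (carrier M)"
proof (intro iffI conjI)
  assume "fg_module R M"
  then obtain S where M: "module R M" and S: "finite S" "S \<subseteq> carrier M"
    "LinearCombinations.module.span R M S = carrier M" unfolding fg_module_def by blast
  show "module R M" by fact
  interpret M: Module.module R M by fact
  obtain y :: "nat \<Rightarrow> 'm" and n where y: "S = y ` {..<n}"
    using finite_imp_nat_seg_image_inj_on[OF S(1)] by (metis lessThan_def)
  have yc: "y i \<in> carrier M" if "i < n" for i using S(2) y that by auto
  have l: "lin M n y \<in> module_hom R (free_module R n) M" by (intro lin_hom M yc)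
  have sub: "submod R (lin M n y ` carrier (free_module R n)) M"
    by (rule submod_image[OF free_module_module M l])
  have "y i \<in> lin M n y ` carrier (free_module R n)" if "i < n" for i
    using lin_unitv[OF M, of n y i, OF yc that] by (metis free_simps(1) image_eqI unitv_closed)
  then have "S \<subseteq> lin M n y ` carrier (free_module R n)" using y by auto
  then have "carrier M \<subseteq> lin M n y ` carrier (free_module R n)"
    using M.span_is_subset[OF _ sub] S(3) by blast
  then show "fg_sub R M (carrier M)"
    unfolding fg_sub_def using l submodD(2)[OF sub] by blast
next
  assume *: "module R M \<and> fg_sub R M (carrier M)"
  then have M: "module R M" by blast
  interpret M: Module.module R M by fact
  from * obtain n f where f: "f \<in> module_hom R (free_module R n) M"
    "f ` carrier (free_module R n) = carrier M" unfolding fg_sub_def by blast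
  let ?S = "(\<lambda>i. f (unitv R n i)) ` {..<n}"
  have S: "?S \<subseteq> carrier M" using hom_closed[OF f(1)] by auto
  have "f x \<in> M.span ?S" if "x \<in> {..<n} \<rightarrow>\<^sub>E carrier R" for x
    by (rule free_image_subset[OF M.span_is_submodule[OF S] f(1) _ that])
      (use M.in_own_span[OF S] in auto)
  then have "carrier M \<subseteq> M.span ?S" unfolding f(2)[symmetric] by auto
  then have "M.span ?S = carrier M" using M.span_is_subset2[OF S] by blast
  then show "fg_module R M" unfolding fg_module_def using M S by blast
qed

lemma fg_moduleI:
  fixes M :: "('a, 'm) module"
  shows "module R M \<Longrightarrow> f \<in> module_hom R (free_module R n) M \<Longrightarrow> f ` carrier (free_module R n) = carrier M \<Longrightarrow>
    fg_module R M"
  unfolding fg_module_iff fg_sub_def by blast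

lemma fg_moduleE:
  fixes M :: "('a, 'm) module"
  assumes "fg_module R M"
  obtains n f where "module R M" "f \<in> module_hom R (free_module R n) M"
    "f ` carrier (free_module R n) = carrier M"
  using assms unfolding fg_module_iff fg_sub_def by blast

lemma fg_quot:
  fixes M :: "('a, 'm) module"
  assumes "fg_module R M" "submod R U M"
  shows "fg_module R (quot_module M U)"
proof -
  obtain n f where f: "f \<in> module_hom R (free_module R n) M"
    "f ` carrier (free_module R n) = carrier M"
    using fg_moduleE[OF assms(1)] by metis
  have "(\<lambda>x. U +>\<^bsub>M\<^esub> f x) ` carrier (free_module R n) = carrier (quot_module M U)"
    unfolding quot_simps(1)[OF assms(2)] f(2)[symmetric] by (simp only: image_image)
  then show ?thesis
    by (rule fg_moduleI[OF quot_module_module[OF assms(2)] hom_comp[OF f(1) quot_proj_hom[OF assms(2)]]])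
qed

lemma fg_image:
  fixes M :: "('a, 'm) module" and N :: "('a, 'n) module"
  assumes "fg_module R M" "module R N" "g \<in> module_hom R M N" "g ` carrier M = carrier N"
  shows "fg_module R N"
proof -
  obtain n f where f: "f \<in> module_hom R (free_module R n) M"
    "f ` carrier (free_module R n) = carrier M"
    using fg_moduleE[OF assms(1)] by metis
  have "(\<lambda>x. g (f x)) ` carrier (free_module R n) = carrier N"
    unfolding assms(4)[symmetric] f(2)[symmetric] by (simp only: image_image)
  then show ?thesis by (rule fg_moduleI[OF assms(2) hom_comp[OF f(1) assms(3)]])
qed

lemma fg_free: "fg_module R (free_module R n)"
  by (rule fg_moduleI[OF free_module_module hom_id]) simp

lemma fg_ring: "fg_module R (ring_module R)"
proof (rule fg_image[OF fg_free[of 1] ring_module_module])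
  show "(\<lambda>x. x 0) \<in> module_hom R (free_module R 1) (ring_module R)" by (rule coord_hom) simp
  show "(\<lambda>x. x 0) ` carrier (free_module R 1) = carrier (ring_module R)"
  proof (intro equalityI subsetI)
    fix r assume "r \<in> carrier (ring_module R)"
    then show "r \<in> (\<lambda>x. x 0) ` carrier (free_module R 1)"
      by (intro image_eqI[of _ _ "\<lambda>i\<in>{..<1}. r"]) auto
  qed auto
qed

lemma submod_ring_ideal: "submod R I (ring_module R) \<longleftrightarrow> ideal I R"
proof
  assume I: "submod R I (ring_module R)"
  note I' = submodD[OF I, simplified]
  have neg: "\<ominus> x \<in> I" if "x \<in> I" for x
  proof -
    have "\<ominus> x = (\<ominus> \<one>) \<otimes> x" using that I'(2) by (simp add: subset_iff l_minus)
    then show ?thesis using I'(5)[of "\<ominus> \<one>" x] that by simp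
  qed
  have mr: "x \<otimes> r \<in> I" if "x \<in> I" "r \<in> carrier R" for x r
    using I'(5)[of r x] I'(2) that m_comm by (metis subsetD)
  show "ideal I R"
    by (rule idealI, rule ring_axioms, rule subgroup.intro)
      (use I' neg mr in \<open>auto simp: a_inv_def[symmetric] m_comm subset_iff\<close>)
next
  assume "ideal I R"
  then interpret ideal I R .
  show "submod R I (ring_module R)"
    by (rule submodI[OF ring_module_module]) (auto simp: I_l_closed a_subset)
qed

end

section \<open>Finite generation of submodules and chain conditions over a Noetherian ring\<close>

locale noeth_cring = cring R + noetherian_ring R for R (structure)
begin

lemma ideal_fg:
  assumes I: "submod R I (ring_module R)"
  shows "fg_sub R (ring_module R) I"
proof -
  have "ideal I R" using I by (simp add: submod_ring_ideal)
  then obtain A where A: "A \<subseteq> carrier R" "finite A" "I = Idl A" using finetely_gen by blast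
  obtain y :: "nat \<Rightarrow> 'a" and n where y: "A = y ` {..<n}"
    using finite_imp_nat_seg_image_inj_on[OF A(2)] by (metis lessThan_def)
  have yc: "y i \<in> carrier (ring_module R)" if "i < n" for i using A(1) y that by auto
  have l: "lin (ring_module R) n y \<in> module_hom R (free_module R n) (ring_module R)"
    by (intro lin_hom ring_module_module yc)
  let ?J = "lin (ring_module R) n y ` carrier (free_module R n)"
  have J: "submod R ?J (ring_module R)"
    by (rule submod_image[OF free_module_module ring_module_module l])
  have yl: "lin (ring_module R) n y (unitv R n i) = y i" if "i < n" for i
    using lin_unitv[OF ring_module_module, of n y i, OF yc that] .
  have "y i \<in> ?J" if "i < n" for i using yl[OF that] by (metis free_simps(1) image_eqI unitv_closed)
  then have "I \<subseteq> ?J"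
    using genideal_minimal[of ?J A] J submod_ring_ideal A(3) y by auto
  moreover have lI: "lin (ring_module R) n y x \<in> I" if "x \<in> {..<n} \<rightarrow>\<^sub>E carrier R" for x
    by (rule free_image_subset[OF I l _ that]) (use yl genideal_self[OF A(1)] A(3) y in auto)
  then have "?J \<subseteq> I" by (simp add: image_subset_iff)
  ultimately show ?thesis by (intro fg_subI[OF l]) simp
qed

text \<open>Induction on the rank. The last coordinates of \<open>U\<close> form an ideal, whose
  generators lift to elements \<open>u\<close> of \<open>U\<close>. Subtracting a combination of
  these leaves an element of \<open>U\<close> with last coordinate zero, and such elements come from
  a submodule of R^n, to which the induction hypothesis applies.\<close>

lemma free_submod_fg: "submod R U (free_module R n) \<Longrightarrow> fg_sub R (free_module R n) U"
proof (induction n arbitrary: U)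
  case 0
  have "x = \<zero>\<^bsub>free_module R 0\<^esub>" if "x \<in> carrier (free_module R 0)" for x using that by auto
  then have "U = carrier (free_module R 0)" using submodD(2,3)[OF 0] by fastforce
  then show ?case unfolding fg_sub_def by (intro exI[of _ 0] bexI[OF _ hom_id]) auto
next
  case (Suc n)
  let ?F = "\<lambda>n. free_module R n"
  note FM = free_module_module
  interpret F: Module.module R "?F (Suc n)" by (rule FM)
  have UF: "x \<in> {..<Suc n} \<rightarrow>\<^sub>E carrier R" if "x \<in> U" for x using submodD(2)[OF Suc.prems] that by (metis free_simps(1) subsetD)
  have co: "(\<lambda>x. x n) \<in> module_hom R (?F (Suc n)) (ring_module R)" by (rule coord_hom) simp
  from ideal_fg[OF submod_image'[OF ring_module_module co Suc.prems]]
  obtain k g where g: "g \<in> module_hom R (?F k) (ring_module R)" "g ` carrier (?F k) = (\<lambda>x. x n) ` U"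
    unfolding fg_sub_def by blast
  have "\<forall>i. \<exists>u\<in>U. u n = g (unitv R k i)"
  proof
    fix i
    have "g (unitv R k i) \<in> (\<lambda>x. x n) ` U" unfolding g(2)[symmetric] by (intro imageI) simp
    then show "\<exists>u\<in>U. u n = g (unitv R k i)" by auto
  qed
  then obtain u where u: "\<And>i. u i \<in> U" "\<And>i. u i n = g (unitv R k i)" by metis
  have uc: "u i \<in> carrier (?F (Suc n))" for i using UF[OF u(1)] by simp
  define G where "G = lin (?F (Suc n)) k u"
  have G: "G \<in> module_hom R (?F k) (?F (Suc n))" unfolding G_def by (intro lin_hom FM uc)
  have Gu: "G (unitv R k i) = u i" if "i < k" for i unfolding G_def by (intro lin_unitv FM uc that)
  have GU: "G c \<in> U" if "c \<in> {..<k} \<rightarrow>\<^sub>E carrier R" for c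
    by (rule free_image_subset[OF Suc.prems G _ that]) (use Gu u in auto)
  have Gn: "G c n = g c" if "c \<in> {..<k} \<rightarrow>\<^sub>E carrier R" for c
    by (rule hom_free_eq[OF ring_module_module hom_comp[OF G co] g(1) _ that]) (use Gu u in auto)
  define E where "E = (\<lambda>x::nat \<Rightarrow> 'a. \<lambda>i\<in>{..<Suc n}. if i < n then x i else \<zero>)"
  have E: "E \<in> module_hom R (?F n) (?F (Suc n))"
    unfolding E_def
  proof (intro tuple_hom FM)
    fix i
    show "(\<lambda>x. if i < n then x i else \<zero>) \<in> module_hom R (?F n) (ring_module R)"
      using coord_hom[of i n] hom_const_zero[OF ring_module_module, of "?F n"] by (cases "i < n") auto
  qed
  from Suc.IH[OF submod_vimage[OF FM FM E Suc.prems]]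
  obtain m h where h: "h \<in> module_hom R (?F m) (?F n)"
    "h ` carrier (?F m) = {x \<in> carrier (?F n). E x \<in> U}" unfolding fg_sub_def by blast
  \<comment> \<open>Both kinds of generators together: \<open>m\<close> for the elements with last
    coordinate zero, \<open>k\<close> for the lifts of the generators of the ideal.\<close>
  define H where "H = (\<lambda>c. E (h (fstp m c)) \<oplus>\<^bsub>?F (Suc n)\<^esub> G (sndp m k c))"
  have H: "H \<in> module_hom R (?F (m + k)) (?F (Suc n))"
    unfolding H_def
    by (intro hom_plus FM hom_comp[OF hom_comp[OF fstp_hom h(1)] E] hom_comp[OF sndp_hom G])
  have EU: "E (h c) \<in> U" if "c \<in> {..<m} \<rightarrow>\<^sub>E carrier R" for c
  proof -
    have "h c \<in> h ` carrier (?F m)" using that by simp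
    then show ?thesis unfolding h(2) by simp
  qed
  have "H ` carrier (?F (m + k)) = U"
  proof (intro equalityI subsetI)
    fix x assume "x \<in> H ` carrier (?F (m + k))"
    then obtain c where c: "c \<in> {..<m + k} \<rightarrow>\<^sub>E carrier R" "x = H c" by auto
    show "x \<in> U" unfolding c(2) H_def
      by (intro submodD(4)[OF Suc.prems] EU GU fstp_closed[OF c(1)] sndp_closed[OF c(1)])
  next
    fix x assume x: "x \<in> U"
    then have "x n \<in> g ` carrier (?F k)" unfolding g(2) by blast
    then obtain c where c: "c \<in> {..<k} \<rightarrow>\<^sub>E carrier R" "x n = g c" by auto
    let ?z = "x \<ominus>\<^bsub>?F (Suc n)\<^esub> G c"
    have z: "?z \<in> U" by (intro submod_minus[OF Suc.prems] x GU c(1))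
    have xn: "x n \<in> carrier R" by (rule free_coord[OF UF[OF x]]) simp
    have zn: "?z n = \<zero>" using UF[OF x] UF[OF GU[OF c(1)]] Gn[OF c(1)] c(2) xn
      by (simp add: r_neg minus_eq)
    let ?y = "\<lambda>i\<in>{..<n}. ?z i"
    have y: "?y \<in> {..<n} \<rightarrow>\<^sub>E carrier R"
      unfolding restrict_PiE_iff using free_coord[OF UF[OF z]] by (simp del: free_minus)
    have Ey: "E ?y = ?z"
      using UF[OF z] hom_closed[OF E, of ?y] y zn
      by (intro free_eqI[of _ "Suc n"]) (auto simp: E_def less_Suc_eq)
    then have "?y \<in> h ` carrier (?F m)" unfolding h(2) using y z by simp
    then obtain c' where c': "c' \<in> {..<m} \<rightarrow>\<^sub>E carrier R" "?y = h c'" by auto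
    have "H (pairp m k c' c) = ?z \<oplus>\<^bsub>?F (Suc n)\<^esub> G c"
      unfolding H_def fstp_pairp[OF c'(1)] sndp_pairp[OF c(1)] c'(2)[symmetric] Ey ..
    also have "\<dots> = x" by (rule F.minus_plus_cancel) (use UF[OF x] UF[OF GU[OF c(1)]] in simp_all)
    finally show "x \<in> H ` carrier (?F (m + k))" using pairp_closed[OF c'(1) c(1)] by (metis free_simps(1) image_eqI)
  qed
  then show ?case by (rule fg_subI[OF H])
qed

context
  fixes M :: "('a, 'm) module"
  assumes fgM: "fg_module R M"
begin

lemma fg_submod:
  assumes U: "submod R U M"
  shows "fg_sub R M U"
proof -
  obtain n f where M: "module R M" and f: "f \<in> module_hom R (free_module R n) M"
    "f ` carrier (free_module R n) = carrier M"
    using fg_moduleE[OF fgM] by metis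
  from free_submod_fg[OF submod_vimage[OF free_module_module M f(1) U]]
  obtain k g where g: "g \<in> module_hom R (free_module R k) (free_module R n)"
    "g ` carrier (free_module R k) = {x \<in> carrier (free_module R n). f x \<in> U}"
    unfolding fg_sub_def by blast
  have "(\<lambda>x. f (g x)) ` carrier (free_module R k) = f ` {x \<in> carrier (free_module R n). f x \<in> U}"
    unfolding g(2)[symmetric] by (simp only: image_image)
  also have "\<dots> = U"
  proof -
    have "U \<subseteq> f ` carrier (free_module R n)" unfolding f(2) by (rule submodD(2)[OF U])
    then show ?thesis by blast
  qed
  finally show ?thesis by (rule fg_subI[OF hom_comp[OF g(1) f(1)]])
qed

lemma fg_submod_module:
  assumes "submod R U M"
  shows "fg_module R (M\<lparr>carrier := U\<rparr>)"
proof -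
  obtain n f where f: "f \<in> module_hom R (free_module R n) M" "f ` carrier (free_module R n) = U"
    using fg_submod[OF assms] unfolding fg_sub_def by blast
  have "f \<in> module_hom R (free_module R n) (M\<lparr>carrier := U\<rparr>)"
    using f by (intro hom_into_submod) auto
  then show ?thesis by (rule fg_moduleI[OF submod_module[OF assms]]) (simp add: f(2))
qed

text \<open>The union is finitely generated, and its finitely many generators already lie in one
  stage. A single repetition is enough for every contradiction drawn from it later.\<close>

lemma ascending_chain_stabilizes:
  assumes U: "\<And>i. submod R (U i) M" and mono: "\<And>i. U i \<subseteq> U (Suc i)"
  shows "\<exists>k. U (Suc k) = U k"
proof -
  have M: "module R M" using fgM by (simp add: fg_module_def)
  have mono': "U i \<subseteq> U j" if "i \<le> j" for i j :: nat using lift_Suc_mono_le[of U, OF mono that] .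
  have "submod R (\<Union>i. U i) M"
  proof (rule submodI[OF M])
    show "(\<Union>i. U i) \<subseteq> carrier M" using submodD(2)[OF U] by blast
    show "\<zero>\<^bsub>M\<^esub> \<in> (\<Union>i. U i)" using submodD(3)[OF U] by blast
    fix v w assume "v \<in> (\<Union>i. U i)" "w \<in> (\<Union>i. U i)"
    then obtain i j where "v \<in> U i" "w \<in> U j" by blast
    then have "v \<in> U (max i j)" "w \<in> U (max i j)"
      using mono'[of i "max i j"] mono'[of j "max i j"] by auto
    then show "v \<oplus>\<^bsub>M\<^esub> w \<in> (\<Union>i. U i)" using submodD(4)[OF U] by blast
  next
    fix c v assume "c \<in> carrier R" "v \<in> (\<Union>i. U i)"
    then show "c \<odot>\<^bsub>M\<^esub> v \<in> (\<Union>i. U i)" using submodD(5)[OF U] by blast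
  qed
  from fg_submod[OF this] obtain n f where f: "f \<in> module_hom R (free_module R n) M"
    "f ` carrier (free_module R n) = (\<Union>i. U i)" unfolding fg_sub_def by blast
  have "\<forall>i. \<exists>k. f (unitv R n i) \<in> U k"
  proof
    fix i
    have "f (unitv R n i) \<in> (\<Union>i. U i)" unfolding f(2)[symmetric] by (intro imageI) simp
    then show "\<exists>k. f (unitv R n i) \<in> U k" by blast
  qed
  then obtain k where k: "\<And>i. f (unitv R n i) \<in> U (k i)" by metis
  obtain K where K: "\<And>i. i < n \<Longrightarrow> k i \<le> K"
    using finite_nat_set_iff_bounded_le[of "k ` {..<n}"] by auto
  have "f x \<in> U K" if "x \<in> {..<n} \<rightarrow>\<^sub>E carrier R" for x
    by (rule free_image_subset[OF U f(1) _ that]) (use k mono'[OF K] in blast)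
  then have "(\<Union>i. U i) \<subseteq> U K" unfolding f(2)[symmetric] by auto
  then have "U (Suc K) = U K" using mono[of K] by blast
  then show ?thesis ..
qed

text \<open>Takes the place of Zorn's lemma: without a maximal member, iterating a choice of larger
  members would give a strictly increasing chain. It supplies maximal ideals as well as maximal
  annihilators.\<close>

lemma maximal_submod:
  assumes "\<U> \<noteq> {}" "\<And>U. U \<in> \<U> \<Longrightarrow> submod R U M"
  shows "\<exists>W\<in>\<U>. \<forall>V\<in>\<U>. W \<subseteq> V \<longrightarrow> V = W"
proof (rule ccontr)
  assume "\<not> ?thesis"
  then have "\<forall>W\<in>\<U>. \<exists>V\<in>\<U>. W \<subset> V" by blast
  then obtain s where s: "\<And>W. W \<in> \<U> \<Longrightarrow> s W \<in> \<U> \<and> W \<subset> s W" by metis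
  obtain W0 where W0: "W0 \<in> \<U>" using assms(1) by blast
  define U where "U i = (s ^^ i) W0" for i
  have U: "U i \<in> \<U>" for i by (induction i) (use W0 s in \<open>auto simp: U_def\<close>)
  have st: "U i \<subset> U (Suc i)" for i using s[OF U[of i]] by (simp add: U_def)
  have "\<exists>k. U (Suc k) = U k"
    by (rule ascending_chain_stabilizes[of U]) (use assms(2)[OF U] st in blast)+
  then obtain k where "U (Suc k) = U k" ..
  then show False using st[of k] by blast
qed

end

end

section \<open>Noetherian local rings\<close>

locale noeth_local =
  fixes R :: "('a, 'r) ring_scheme" (structure)
  assumes noeth_local: "noetherian_local_ring R"

sublocale noeth_local \<subseteq> noeth_cring R
  using noeth_local by (simp add: noetherian_local_ring_def noeth_cring_def)

context noeth_local
begin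

abbreviation "mm \<equiv> max_ideal R"

lemma mm_maximal: "maximalideal mm R"
  using noeth_local theI'[of "\<lambda>\<mm>. maximalideal \<mm> R"]
  unfolding noetherian_local_ring_def max_ideal_def by blast

lemma mm_unique: "maximalideal I R \<Longrightarrow> I = mm"
  using noeth_local mm_maximal unfolding noetherian_local_ring_def by blast

lemma mm_ideal: "ideal mm R"
  using mm_maximal by (simp add: maximalideal_def)

lemma mm_submod: "submod R mm (ring_module R)"
  by (simp add: submod_ring_ideal mm_ideal)

lemmas mm_closed = submodD(2-5)[OF mm_submod, simplified]

lemma mm_carrier [simp]: "x \<in> mm \<Longrightarrow> x \<in> carrier R"
  using mm_closed(1) by blast

lemma mm_mult_right: "x \<in> mm \<Longrightarrow> r \<in> carrier R \<Longrightarrow> x \<otimes> r \<in> mm"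
  by (subst m_comm) (auto intro: mm_closed(4))

lemma one_notin_mm: "\<one> \<notin> mm"
  using ideal.one_imp_carrier[OF mm_ideal] maximalideal.I_notcarr[OF mm_maximal] by blast

text \<open>A nonunit generates a proper ideal. A largest proper ideal above it is a maximal ideal,
  hence equal to \<open>mm\<close>, and would contain x.\<close>

lemma unit_outside_mm:
  assumes "x \<in> carrier R" "x \<notin> mm"
  obtains y where "y \<in> carrier R" "y \<otimes> x = \<one>"
proof (rule ccontr)
  assume "\<not> thesis"
  then have no: "\<And>y. y \<in> carrier R \<Longrightarrow> y \<otimes> x \<noteq> \<one>" using that by blast
  let ?P = "PIdl x"
  have "ideal ?P R" by (rule cgenideal_ideal[OF assms(1)])
  moreover have "\<one> \<notin> ?P"
  proof
    assume "\<one> \<in> ?P"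
    then obtain y where "y \<in> carrier R" "\<one> = y \<otimes> x" by (auto simp: cgenideal_def)
    then show False using no by metis
  qed
  ultimately have ne: "{I. ideal I R \<and> ?P \<subseteq> I \<and> \<one> \<notin> I} \<noteq> {}" by blast
  obtain W where W: "ideal W R" "?P \<subseteq> W" "\<one> \<notin> W"
    "\<And>V. ideal V R \<Longrightarrow> ?P \<subseteq> V \<Longrightarrow> \<one> \<notin> V \<Longrightarrow> W \<subseteq> V \<Longrightarrow> V = W"
    using maximal_submod[OF fg_ring ne] by (auto simp: submod_ring_ideal Ball_def Bex_def)
  have "maximalideal W R"
  proof (rule maximalidealI[OF W(1)])
    show "carrier R \<noteq> W" using W(3) by auto
    fix J assume J: "ideal J R" "W \<subseteq> J" "J \<subseteq> carrier R"
    show "J = W \<or> J = carrier R"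
      using W(4)[OF J(1)] J(2) W(2) ideal.one_imp_carrier[OF J(1)] by blast
  qed
  then have "x \<in> mm" using mm_unique W(2) cgenideal_self[OF assms(1)] by blast
  then show False using assms(2) by blast
qed

text \<open>Each coordinate of \<open>f w\<close> is a sum of multiples of the entries
  \<open>w j\<close>, and \<open>mm\<close> is an ideal.\<close>

lemma free_hom_mm:
  assumes f: "f \<in> module_hom R (free_module R n) (free_module R k)"
    and w: "w \<in> {..<n} \<rightarrow>\<^sub>E carrier R" "\<And>j. j < n \<Longrightarrow> w j \<in> mm" and i: "i < k"
  shows "f w i \<in> mm"
proof -
  interpret I: Module.module R "ring_module R" by (rule ring_module_module)
  note h = hom_comp[OF f coord_hom[OF i]]
  have "f w i = lin (ring_module R) n (\<lambda>j. f (unitv R n j) i) w"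
    by (rule hom_free_lin[OF ring_module_module h w(1)])
  also have "lin (ring_module R) n (\<lambda>j. f (unitv R n j) i) w \<in> mm"
  proof -
    have c: "f (unitv R n j) i \<in> carrier R" for j using hom_closed[OF h, of "unitv R n j"] by simp
    have "(\<Oplus>\<^bsub>ring_module R\<^esub>j\<in>A. w j \<otimes> f (unitv R n j) i) \<in> mm" if "finite A" "A \<subseteq> {..<n}" for A
      using that
    proof (induction A)
      case empty
      then show ?case by (simp add: mm_closed)
    next
      case (insert a A)
      have "(\<Oplus>\<^bsub>ring_module R\<^esub>j\<in>insert a A. w j \<otimes> f (unitv R n j) i)
          = w a \<otimes> f (unitv R n a) i \<oplus> (\<Oplus>\<^bsub>ring_module R\<^esub>j\<in>A. w j \<otimes> f (unitv R n j) i)"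
        using insert w(1) c by (subst I.finsum_insert) auto
      then show ?case using insert w(2) c by (auto intro!: mm_closed(3) mm_mult_right)
    qed
    then show ?thesis by (simp add: lin_def)
  qed
  finally show ?thesis .
qed

text \<open>A surjection from a free module of least possible rank: a kernel element with a unit
  coordinate would express one generator by the others.\<close>

lemma minimal_surjection:
  fixes X :: "('a, 'm) module"
  assumes "fg_module R X"
  obtains n f where "f \<in> module_hom R (free_module R n) X" "f ` carrier (free_module R n) = carrier X"
    "\<forall>x\<in>carrier (free_module R n). f x = \<zero>\<^bsub>X\<^esub> \<longrightarrow> (\<forall>j<n. x j \<in> mm)"
proof -
  have X: "module R X" using assms by (simp add: fg_module_def)
  interpret X: Module.module R X by fact
  let ?F = "\<lambda>n. free_module R n"
  let ?P = "\<lambda>n. \<exists>f\<in>module_hom R (?F n) X. f ` carrier (?F n) = carrier X"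
  define n where "n = (LEAST n. ?P n)"
  have "\<exists>n. ?P n" using fg_moduleE[OF assms] by metis
  then have "?P n" unfolding n_def by (rule LeastI_ex)
  then obtain f where f: "f \<in> module_hom R (?F n) X" "f ` carrier (?F n) = carrier X" by blast
  have "x j \<in> mm" if x: "x \<in> {..<n} \<rightarrow>\<^sub>E carrier R" "f x = \<zero>\<^bsub>X\<^esub>" and j: "j < n" for x j
  proof (rule ccontr)
    assume nm: "x j \<notin> mm"
    have xj: "x j \<in> carrier R" using x(1) j by auto
    obtain r where r: "r \<in> carrier R" "r \<otimes> x j = \<one>" using unit_outside_mm[OF xj nm] .
    define e where "e i = f (unitv R n i)" for i
    have e: "e i \<in> carrier X" for i unfolding e_def using hom_closed[OF f(1)] by simp
    define y where "y i = e (if i < j then i else Suc i)" for i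
    define g where "g = lin X (n - 1) y"
    have g: "g \<in> module_hom R (?F (n - 1)) X" unfolding g_def y_def by (intro lin_hom X e)
    have gu: "g (unitv R (n - 1) i) = y i" if "i < n - 1" for i
      unfolding g_def y_def by (intro lin_unitv X e that)
    let ?W = "g ` carrier (?F (n - 1))"
    have W: "submod R ?W X" by (rule submod_image[OF free_module_module X g])
    have yW: "y i \<in> ?W" if "i < n - 1" for i using gu[OF that] by (metis free_simps(1) image_eqI unitv_closed)
    have eW: "e i \<in> ?W" if "i < n" "i \<noteq> j" for i
    proof (cases "i < j")
      case True
      then show ?thesis using yW[of i] j by (simp add: y_def)
    next
      case False
      then have "j < i" "i - 1 < n - 1" "\<not> i - 1 < j" "Suc (i - 1) = i" using that by auto
      then show ?thesis using yW[of "i - 1"] unfolding y_def by (simp only: if_False)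
    qed
    \<comment> \<open>The j-th term is split off: f x = f' x + x_j e_j, where f' x involves only the
      other generators. As f x = 0 and x_j is invertible, e_j is a combination of those.\<close>
    define f' where "f' = lin X n (\<lambda>i. if i = j then \<zero>\<^bsub>X\<^esub> else e i)"
    have c': "(if i = j then \<zero>\<^bsub>X\<^esub> else e i) \<in> carrier X" for i using e by simp
    have f': "f' \<in> module_hom R (?F n) X" unfolding f'_def by (intro lin_hom X c')
    have f'u: "f' (unitv R n i) = (if i = j then \<zero>\<^bsub>X\<^esub> else e i)" if "i < n" for i
      unfolding f'_def by (intro lin_unitv X c' that)
    have f'W: "f' x \<in> ?W"
      by (rule free_image_subset[OF W f' _ x(1)]) (use f'u eW submodD(3)[OF W] in auto)
    have "(\<lambda>x. x j \<odot>\<^bsub>X\<^esub> e j) \<in> module_hom R (?F n) X"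
      using free_coord[OF _ j] by (intro homI) (simp_all add: e j X.smult_l_distr X.smult_assoc1)
    then have h: "(\<lambda>x. f' x \<oplus>\<^bsub>X\<^esub> x j \<odot>\<^bsub>X\<^esub> e j) \<in> module_hom R (?F n) X" by (rule hom_plus[OF X f'])
    have "f x = f' x \<oplus>\<^bsub>X\<^esub> x j \<odot>\<^bsub>X\<^esub> e j"
      by (rule hom_free_eq[OF X f(1) h _ x(1)]) (use j f'u e in \<open>auto simp: unitv_apply e_def[symmetric]\<close>)
    then have "x j \<odot>\<^bsub>X\<^esub> e j = \<ominus>\<^bsub>X\<^esub> f' x"
      using x(2) xj e hom_closed[OF f', of x] x(1)
      by (intro X.minus_equality[symmetric]) (auto simp: X.a_comm)
    then have "x j \<odot>\<^bsub>X\<^esub> e j \<in> ?W" using submod_neg[OF W f'W] by simp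
    then have "r \<odot>\<^bsub>X\<^esub> (x j \<odot>\<^bsub>X\<^esub> e j) \<in> ?W" by (rule submodD(5)[OF W r(1)])
    then have ej: "e j \<in> ?W" using r xj e by (simp flip: X.smult_assoc1)
    have "f z \<in> ?W" if "z \<in> {..<n} \<rightarrow>\<^sub>E carrier R" for z
      by (rule free_image_subset[OF W f(1) _ that]) (use ej eW in \<open>auto simp: e_def\<close>)
    then have "carrier X \<subseteq> ?W" unfolding f(2)[symmetric] by auto
    then have "?P (n - 1)" using g submodD(2)[OF W] by blast
    then have "n \<le> n - 1" unfolding n_def by (rule Least_le)
    then show False using j by simp
  qed
  then show ?thesis using that[OF f] by simp
qed

text \<open>The hypothesis encodes N = mm N without forming that submodule: every element is the
  value of a linear map at a vector over \<open>mm\<close>. If a minimal surjection \<open>f\<close>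
  had positive rank, such a map for the image of a basis vector e would lift through
  \<open>f\<close> to some l with e - l w in the kernel. Then e - l w and l w both have coordinates
  in \<open>mm\<close>, and so would e.\<close>

lemma nakayama:
  fixes N :: "('a, 'm) module"
  assumes N: "fg_module R N"
    and mN: "\<And>y. y \<in> carrier N \<Longrightarrow> \<exists>k g w. g \<in> module_hom R (free_module R k) N \<and>
        w \<in> {..<k} \<rightarrow>\<^sub>E carrier R \<and> (\<forall>j<k. w j \<in> mm) \<and> y = g w"
  shows "zero_module N"
proof -
  have NM: "module R N" using N by (simp add: fg_module_def)
  interpret N: Module.module R N by fact
  obtain n f where f: "f \<in> module_hom R (free_module R n) N" "f ` carrier (free_module R n) = carrier N"
    "\<forall>x\<in>carrier (free_module R n). f x = \<zero>\<^bsub>N\<^esub> \<longrightarrow> (\<forall>j<n. x j \<in> mm)"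
    using minimal_surjection[OF N] by metis
  have "n = 0"
  proof (rule ccontr)
    assume "n \<noteq> 0"
    then have n: "0 < n" by simp
    interpret F: Module.module R "free_module R n" by (rule free_module_module)
    let ?e = "unitv R n 0"
    have "f ?e \<in> carrier N" using hom_closed[OF f(1)] by simp
    then obtain k g w where g: "g \<in> module_hom R (free_module R k) N" "w \<in> {..<k} \<rightarrow>\<^sub>E carrier R"
      "\<forall>j<k. w j \<in> mm" "f ?e = g w" using mN by metis
    obtain l where l: "l \<in> module_hom R (free_module R k) (free_module R n)"
      "\<And>x. x \<in> {..<k} \<rightarrow>\<^sub>E carrier R \<Longrightarrow> f (l x) = g x"
      by (rule hom_lift[OF free_module_module NM f(1) g(1)]) (use hom_closed[OF g(1)] f(2) in auto)
    have lw: "l w \<in> {..<n} \<rightarrow>\<^sub>E carrier R" using hom_closed[OF l(1)] g(2) by simp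
    have "f (?e \<ominus>\<^bsub>free_module R n\<^esub> l w) = f ?e \<ominus>\<^bsub>N\<^esub> f (l w)"
      using lw by (intro hom_minus[OF free_module_module NM f(1)]) auto
    also have "\<dots> = \<zero>\<^bsub>N\<^esub>" using l(2)[OF g(2)] g(4) hom_closed[OF g(1)] g(2) N.r_neg by (simp add: N.minus_eq)
    finally have "f (?e \<ominus>\<^bsub>free_module R n\<^esub> l w) = \<zero>\<^bsub>N\<^esub>" .
    moreover have "?e \<ominus>\<^bsub>free_module R n\<^esub> l w \<in> carrier (free_module R n)"
      by (rule F.minus_closed) (use lw in simp_all)
    ultimately have "\<forall>j<n. (?e \<ominus>\<^bsub>free_module R n\<^esub> l w) j \<in> mm" using f(3) by blast
    then have "(?e \<ominus>\<^bsub>free_module R n\<^esub> l w) 0 \<in> mm" using n by blast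
    then have "\<one> \<ominus> l w 0 \<in> mm" using n lw by (simp add: unitv_apply)
    moreover have lw0: "l w 0 \<in> mm" by (rule free_hom_mm[OF l(1) g(2)]) (use g(3) n in auto)
    ultimately have "(\<one> \<ominus> l w 0) \<oplus> l w 0 \<in> mm" by (rule mm_closed(3))
    moreover have "(\<one> \<ominus> l w 0) \<oplus> l w 0 = \<one>" using lw0 by (simp add: minus_eq a_assoc l_neg)
    ultimately show False using one_notin_mm by simp
  qed
  then have "y = \<zero>\<^bsub>N\<^esub>" if "y \<in> carrier N" for y
  proof -
    have "y \<in> f ` carrier (free_module R n)" unfolding f(2) by (rule that)
    then obtain x where x: "x \<in> carrier (free_module R n)" "y = f x" by (rule imageE)
    have "x = \<zero>\<^bsub>free_module R n\<^esub>" using x(1) \<open>n = 0\<close> by (intro free_eqI[of _ 0]) auto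
    then show ?thesis using x(2) hom_zero[OF free_module_module NM f(1)] by simp
  qed
  then show ?thesis by (simp add: zero_module_iff[OF NM])
qed

section \<open>Minimal covers and minimal free resolutions\<close>

lemma minimal_cover_submod:
  fixes M :: "('a, 'm) module"
  assumes "fg_module R M" "submod R U M"
  obtains n f where "f \<in> module_hom R (free_module R n) M" "f ` carrier (free_module R n) = U"
    "\<forall>x\<in>carrier (free_module R n). f x = \<zero>\<^bsub>M\<^esub> \<longrightarrow> (\<forall>j<n. x j \<in> mm)"
proof -
  obtain n f where f: "f \<in> module_hom R (free_module R n) (M\<lparr>carrier := U\<rparr>)"
    "f ` carrier (free_module R n) = carrier (M\<lparr>carrier := U\<rparr>)"
    "\<forall>x\<in>carrier (free_module R n). f x = \<zero>\<^bsub>M\<lparr>carrier := U\<rparr>\<^esub> \<longrightarrow> (\<forall>j<n. x j \<in> mm)"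
    by (rule minimal_surjection[OF fg_submod_module[OF assms]])
  show ?thesis
    by (rule that[OF hom_comp[OF f(1) hom_from_submod[OF assms(2)]]]) (use f(2,3) in simp_all)
qed

text \<open>Kernels are covered by minimal surjections again and again. The next differential is
  minimal because its image is the kernel of the previous cover, whose elements have all coordinates
  in \<open>mm\<close>.\<close>

lemma minimal_free_resolution_exists:
  fixes X :: "('a, 'm) module"
  assumes X: "fg_module R X"
  shows "\<exists>b d \<epsilon>. minimal_free_resolution R b d \<epsilon> X"
proof -
  let ?F = "\<lambda>n. free_module R n"
  have XM: "module R X" using X by (simp add: fg_module_def)
  obtain n0 \<epsilon> where \<epsilon>: "\<epsilon> \<in> module_hom R (?F n0) X" "\<epsilon> ` carrier (?F n0) = carrier X"
    "\<forall>x\<in>carrier (?F n0). \<epsilon> x = \<zero>\<^bsub>X\<^esub> \<longrightarrow> (\<forall>j<n0. x j \<in> mm)"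
    using minimal_surjection[OF X] by metis
  \<comment> \<open>A state (n, k, d) stands for a map d from R^k to R^n. Besides minimality of d,
    \<open>P\<close> records that its kernel has coordinates in \<open>mm\<close>, which makes the
    next differential minimal; the clause for i = 0 ties the sequence to the augmentation.
    \<open>Q\<close> is exactness between consecutive states.\<close>
  define P :: "nat \<Rightarrow> nat \<times> nat \<times> ((nat \<Rightarrow> 'a) \<Rightarrow> (nat \<Rightarrow> 'a)) \<Rightarrow> bool" where
    "P i s \<longleftrightarrow> (case s of (n, k, d) \<Rightarrow> d \<in> module_hom R (?F k) (?F n) \<and>
      (\<forall>x\<in>carrier (?F k). d x = \<zero>\<^bsub>?F n\<^esub> \<longrightarrow> (\<forall>j<k. x j \<in> mm)) \<and>
      (\<forall>x\<in>carrier (?F k). \<forall>j<n. d x j \<in> mm) \<and>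
      (i = 0 \<longrightarrow> n = n0 \<and> d ` carrier (?F k) = {x \<in> carrier (?F n0). \<epsilon> x = \<zero>\<^bsub>X\<^esub>}))" for i s
  define Q :: "nat \<Rightarrow> nat \<times> nat \<times> ((nat \<Rightarrow> 'a) \<Rightarrow> (nat \<Rightarrow> 'a)) \<Rightarrow>
      nat \<times> nat \<times> ((nat \<Rightarrow> 'a) \<Rightarrow> (nat \<Rightarrow> 'a)) \<Rightarrow> bool" where
    "Q i s t \<longleftrightarrow> fst t = fst (snd s) \<and> snd (snd t) ` carrier (?F (fst (snd t))) =
      {x \<in> carrier (?F (fst (snd s))). snd (snd s) x = \<zero>\<^bsub>?F (fst s)\<^esub>}" for i s t
  have "\<exists>S. \<forall>i. P i (S i) \<and> Q i (S i) (S (Suc i))"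
  proof (rule dependent_nat_choice)
    obtain k f where f: "f \<in> module_hom R (?F k) (?F n0)"
      "f ` carrier (?F k) = {x \<in> carrier (?F n0). \<epsilon> x = \<zero>\<^bsub>X\<^esub>}"
      "\<forall>x\<in>carrier (?F k). f x = \<zero>\<^bsub>?F n0\<^esub> \<longrightarrow> (\<forall>j<k. x j \<in> mm)"
      by (rule minimal_cover_submod[OF fg_free submod_kernel[OF free_module_module XM \<epsilon>(1)]])
    have "f x j \<in> mm" if "x \<in> carrier (?F k)" "j < n0" for x j
    proof -
      have "f x \<in> {x \<in> carrier (?F n0). \<epsilon> x = \<zero>\<^bsub>X\<^esub>}" using f(2) that(1) by blast
      then show ?thesis using \<epsilon>(3) that(2) by simp
    qed
    then have "P 0 (n0, k, f)" using f unfolding P_def by auto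
    then show "\<exists>s. P 0 s" by blast
  next
    fix s i assume s: "P i s"
    obtain n k d where sd: "s = (n, k, d)" by (metis prod_cases3)
    have d: "d \<in> module_hom R (?F k) (?F n)"
      "\<And>x j. x \<in> carrier (?F k) \<Longrightarrow> d x = \<zero>\<^bsub>?F n\<^esub> \<Longrightarrow> j < k \<Longrightarrow> x j \<in> mm"
      using s unfolding P_def sd by auto
    obtain k' f where f: "f \<in> module_hom R (?F k') (?F k)"
      "f ` carrier (?F k') = {x \<in> carrier (?F k). d x = \<zero>\<^bsub>?F n\<^esub>}"
      "\<forall>x\<in>carrier (?F k'). f x = \<zero>\<^bsub>?F k\<^esub> \<longrightarrow> (\<forall>j<k'. x j \<in> mm)"
      by (rule minimal_cover_submod[OF fg_free submod_kernel[OF free_module_module free_module_module d(1)]])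
    have "f x j \<in> mm" if "x \<in> carrier (?F k')" "j < k" for x j
    proof -
      have "f x \<in> {x \<in> carrier (?F k). d x = \<zero>\<^bsub>?F n\<^esub>}" using f(2) that(1) by blast
      then show ?thesis using d(2) that(2) by blast
    qed
    then have "P (Suc i) (k, k', f) \<and> Q i s (k, k', f)" using f unfolding P_def Q_def sd by simp
    then show "\<exists>t. P (Suc i) t \<and> Q i s t" by blast
  qed
  then obtain S where S: "\<And>i. P i (S i)" "\<And>i. Q i (S i) (S (Suc i))" by blast
  define b where "b i = fst (S i)" for i
  define d where "d i = snd (snd (S i))" for i
  have b: "fst (snd (S i)) = b (Suc i)" for i using S(2)[of i] by (simp add: Q_def b_def)
  have Sd: "S i = (b i, b (Suc i), d i)" for i using b[of i] by (simp add: b_def d_def prod_eq_iff)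
  have b0: "b 0 = n0" and d0: "d 0 ` carrier (?F (b 1)) = {x \<in> carrier (?F n0). \<epsilon> x = \<zero>\<^bsub>X\<^esub>}"
    using S(1)[of 0] unfolding P_def Sd by simp_all
  have "minimal_free_resolution R b d \<epsilon> X"
    unfolding minimal_free_resolution_def resolution_def
  proof (intro conjI allI ballI impI)
    fix i
    show "module R (?F (b i))" by (rule free_module_module)
    show "d i \<in> module_hom R (?F (b (Suc i))) (?F (b i))" using S(1)[of i] unfolding P_def Sd by simp
    show "d (Suc i) ` carrier (?F (b (Suc (Suc i)))) = {x \<in> carrier (?F (b (Suc i))). d i x = \<zero>\<^bsub>?F (b i)\<^esub>}"
      using S(2)[of i] unfolding Q_def Sd by simp
    fix x j assume "x \<in> carrier (?F (b (Suc i)))" "j < b i"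
    then show "d i x j \<in> mm" using S(1)[of i] unfolding P_def Sd by simp
  qed (use b0 d0 \<epsilon> in simp_all)
  then show ?thesis by blast
qed

lemma min_res_props:
  fixes X :: "('a, 'm) module"
  assumes "fg_module R X"
  obtains \<epsilon> where "minimal_free_resolution R (fst (min_res R X)) (snd (min_res R X)) \<epsilon> X"
proof -
  have "\<exists>p. case p of (b, d) \<Rightarrow> \<exists>\<epsilon>. minimal_free_resolution R b d \<epsilon> X"
    using minimal_free_resolution_exists[OF assms] by auto
  from someI_ex[OF this] show ?thesis
    using that unfolding min_res_def[symmetric] by (auto simp: case_prod_unfold)
qed

end

section \<open>Free resolutions and vanishing of cohomology\<close>

abbreviation free_resolution where
  "free_resolution R b d \<epsilon> X \<equiv> resolution R (\<lambda>i. free_module R (b i)) d \<epsilon> X"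

text \<open>Cochains are functions of which only the values on the free module matter; the
  extensional representatives demanded by \<open>hom_module\<close> enter only in the comparison
  with \<open>Ext\<close>. Nothing precedes degree 0, so only zero is a coboundary there.\<close>

definition cobdry ::
  "('a, 'r) ring_scheme \<Rightarrow> (nat \<Rightarrow> nat) \<Rightarrow> (nat \<Rightarrow> (nat \<Rightarrow> 'a) \<Rightarrow> (nat \<Rightarrow> 'a)) \<Rightarrow> ('a, 'c) module \<Rightarrow> nat
    \<Rightarrow> ((nat \<Rightarrow> 'a) \<Rightarrow> 'c) \<Rightarrow> bool" where
  "cobdry R b d N n f \<longleftrightarrow> (case n of
      0 \<Rightarrow> \<forall>x\<in>carrier (free_module R (b 0)). f x = \<zero>\<^bsub>N\<^esub>
    | Suc m \<Rightarrow> \<exists>g\<in>module_hom R (free_module R (b m)) N.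
        \<forall>x\<in>carrier (free_module R (b (Suc m))). f x = g (d m x))"

definition cocycle ::
  "('a, 'r) ring_scheme \<Rightarrow> (nat \<Rightarrow> nat) \<Rightarrow> (nat \<Rightarrow> (nat \<Rightarrow> 'a) \<Rightarrow> (nat \<Rightarrow> 'a)) \<Rightarrow> ('a, 'c) module \<Rightarrow> nat
    \<Rightarrow> ((nat \<Rightarrow> 'a) \<Rightarrow> 'c) \<Rightarrow> bool" where
  "cocycle R b d N n f \<longleftrightarrow> f \<in> module_hom R (free_module R (b n)) N \<and>
    (\<forall>x\<in>carrier (free_module R (b (Suc n))). f (d n x) = \<zero>\<^bsub>N\<^esub>)"

definition acyclic_at ::
  "('a, 'r) ring_scheme \<Rightarrow> (nat \<Rightarrow> nat) \<Rightarrow> (nat \<Rightarrow> (nat \<Rightarrow> 'a) \<Rightarrow> (nat \<Rightarrow> 'a)) \<Rightarrow> ('a, 'c) module \<Rightarrow> nat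
    \<Rightarrow> bool" where
  "acyclic_at R b d N n \<longleftrightarrow> (\<forall>f. cocycle R b d N n f \<longrightarrow> cobdry R b d N n f)"

lemma cobdry_0: "cobdry R b d N 0 f \<longleftrightarrow> (\<forall>x\<in>carrier (free_module R (b 0)). f x = \<zero>\<^bsub>N\<^esub>)"
  by (simp add: cobdry_def)

lemma cobdry_Suc: "cobdry R b d N (Suc m) f \<longleftrightarrow>
    (\<exists>g\<in>module_hom R (free_module R (b m)) N.
        \<forall>x\<in>carrier (free_module R (b (Suc m))). f x = g (d m x))"
  by (simp add: cobdry_def)

lemma cobdry_cong:
  "cobdry R b d N n f \<Longrightarrow> (\<And>x. x \<in> carrier (free_module R (b n)) \<Longrightarrow> g x = f x) \<Longrightarrow> cobdry R b d N n g"
  by (cases n) (auto simp: cobdry_0 cobdry_Suc)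

lemma cobdry_comp:
  assumes "module R N" "module R N'" "h \<in> module_hom R N N'" "cobdry R b d N n f"
  shows "cobdry R b d N' n (\<lambda>x. h (f x))"
proof (cases n)
  case 0
  then show ?thesis using assms(4) hom_zero[OF assms(1-3)] by (simp add: cobdry_0)
next
  case (Suc m)
  then obtain g where "g \<in> module_hom R (free_module R (b m)) N"
    "\<forall>x\<in>carrier (free_module R (b (Suc m))). f x = g (d m x)" using assms(4) by (auto simp: cobdry_Suc)
  then show ?thesis unfolding Suc cobdry_Suc by (intro bexI[OF _ hom_comp[OF _ assms(3)]]) auto
qed

lemma cobdry_plus:
  assumes N: "module R N" and "cobdry R b d N n f" "cobdry R b d N n f'"
  shows "cobdry R b d N n (\<lambda>x. f x \<oplus>\<^bsub>N\<^esub> f' x)"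
proof (cases n)
  case 0
  interpret N: Module.module R N by fact
  show ?thesis using 0 assms(2,3) by (simp add: cobdry_0)
next
  case (Suc m)
  then obtain g g' where g: "g \<in> module_hom R (free_module R (b m)) N"
    "\<forall>x\<in>carrier (free_module R (b (Suc m))). f x = g (d m x)"
    "g' \<in> module_hom R (free_module R (b m)) N"
    "\<forall>x\<in>carrier (free_module R (b (Suc m))). f' x = g' (d m x)" using assms(2,3) by (auto simp: cobdry_Suc)
  then show ?thesis unfolding Suc cobdry_Suc by (intro bexI[OF _ hom_plus[OF N g(1) g(3)]]) simp
qed

lemma resolutionD:
  assumes "resolution R P d \<epsilon> X"
  shows "module R (P i)" "d i \<in> module_hom R (P (Suc i)) (P i)" "\<epsilon> \<in> module_hom R (P 0) X"
    "\<epsilon> ` carrier (P 0) = carrier X"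
    "x \<in> carrier (P (Suc 0)) \<Longrightarrow> \<epsilon> (d 0 x) = \<zero>\<^bsub>X\<^esub>"
    "x \<in> carrier (P (Suc (Suc i))) \<Longrightarrow> d i (d (Suc i) x) = \<zero>\<^bsub>P i\<^esub>"
    "x \<in> carrier (P 0) \<Longrightarrow> \<epsilon> x = \<zero>\<^bsub>X\<^esub> \<Longrightarrow> x \<in> d 0 ` carrier (P (Suc 0))"
    "x \<in> carrier (P (Suc i)) \<Longrightarrow> d i x = \<zero>\<^bsub>P i\<^esub> \<Longrightarrow> x \<in> d (Suc i) ` carrier (P (Suc (Suc i)))"
proof -
  note r = assms[unfolded resolution_def]
  show "module R (P i)" "d i \<in> module_hom R (P (Suc i)) (P i)" using r by simp_all
  show "\<epsilon> \<in> module_hom R (P 0) X" "\<epsilon> ` carrier (P 0) = carrier X" using r by simp_all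
  have 1: "d 0 ` carrier (P (Suc 0)) = {x \<in> carrier (P 0). \<epsilon> x = \<zero>\<^bsub>X\<^esub>}" using r by simp
  have 2: "d (Suc i) ` carrier (P (Suc (Suc i))) = {x \<in> carrier (P (Suc i)). d i x = \<zero>\<^bsub>P i\<^esub>}"
    using r by simp
  show "x \<in> carrier (P (Suc 0)) \<Longrightarrow> \<epsilon> (d 0 x) = \<zero>\<^bsub>X\<^esub>" using 1 by blast
  show "x \<in> carrier (P (Suc (Suc i))) \<Longrightarrow> d i (d (Suc i) x) = \<zero>\<^bsub>P i\<^esub>" using 2 by blast
  show "x \<in> carrier (P 0) \<Longrightarrow> \<epsilon> x = \<zero>\<^bsub>X\<^esub> \<Longrightarrow> x \<in> d 0 ` carrier (P (Suc 0))" using 1 by blast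
  show "x \<in> carrier (P (Suc i)) \<Longrightarrow> d i x = \<zero>\<^bsub>P i\<^esub> \<Longrightarrow> x \<in> d (Suc i) ` carrier (P (Suc (Suc i)))"
    using 2 by blast
qed

section \<open>Comparison of free resolutions: chain maps and homotopies\<close>

definition chain_map ::
  "('a, 'r) ring_scheme \<Rightarrow> (nat \<Rightarrow> nat) \<Rightarrow> (nat \<Rightarrow> (nat \<Rightarrow> 'a) \<Rightarrow> (nat \<Rightarrow> 'a)) \<Rightarrow>
     (nat \<Rightarrow> nat) \<Rightarrow> (nat \<Rightarrow> (nat \<Rightarrow> 'a) \<Rightarrow> (nat \<Rightarrow> 'a)) \<Rightarrow>
     (nat \<Rightarrow> (nat \<Rightarrow> 'a) \<Rightarrow> (nat \<Rightarrow> 'a)) \<Rightarrow> bool" where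
  "chain_map R b d b' d' \<phi> \<longleftrightarrow>
     (\<forall>i. \<phi> i \<in> module_hom R (free_module R (b i)) (free_module R (b' i))) \<and>
     (\<forall>i. \<forall>x\<in>carrier (free_module R (b (Suc i))). d' i (\<phi> (Suc i) x) = \<phi> i (d i x))"

lemma chain_mapD:
  assumes "chain_map R b d b' d' \<phi>"
  shows "\<phi> i \<in> module_hom R (free_module R (b i)) (free_module R (b' i))"
    "x \<in> carrier (free_module R (b (Suc i))) \<Longrightarrow> d' i (\<phi> (Suc i) x) = \<phi> i (d i x)"
  using assms by (auto simp: chain_map_def)

lemma cobdry_chain_map:
  assumes \<phi>: "chain_map R b d b' d' \<phi>" and f: "cobdry R b' d' N n f"
  shows "cobdry R b d N n (\<lambda>x. f (\<phi> n x))"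
proof (cases n)
  case 0
  then show ?thesis using f hom_closed[OF chain_mapD(1)[OF \<phi>]] by (simp add: cobdry_0)
next
  case (Suc m)
  then obtain g where g: "g \<in> module_hom R (free_module R (b' m)) N"
    "\<forall>x\<in>carrier (free_module R (b' (Suc m))). f x = g (d' m x)" using f by (auto simp: cobdry_Suc)
  then have "f (\<phi> (Suc m) x) = g (\<phi> m (d m x))" if "x \<in> carrier (free_module R (b (Suc m)))" for x
    using hom_closed[OF chain_mapD(1)[OF \<phi>] that] chain_mapD(2)[OF \<phi> that] by simp
  then show ?thesis
    unfolding Suc cobdry_Suc by (intro bexI[OF _ hom_comp[OF chain_mapD(1)[OF \<phi>] g(1)]]) simp
qed

lemma cocycle_chain_map:
  assumes \<phi>: "chain_map R b d b' d' \<phi>" and f: "cocycle R b' d' N n f"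
  shows "cocycle R b d N n (\<lambda>x. f (\<phi> n x))"
proof -
  have "f (\<phi> n (d n x)) = \<zero>\<^bsub>N\<^esub>" if "x \<in> carrier (free_module R (b (Suc n)))" for x
    using f hom_closed[OF chain_mapD(1)[OF \<phi>] that] chain_mapD(2)[OF \<phi> that, symmetric]
    by (simp add: cocycle_def)
  then show ?thesis using f hom_comp[OF chain_mapD(1)[OF \<phi>]] by (auto simp: cocycle_def)
qed

context cring
begin

declare free_simps [simp del]

lemma hom_lift_free:
  fixes B :: "('a, 'm) module"
  assumes B: "module R B" and C: "module R C" and g: "g \<in> module_hom R B C"
    and h: "h \<in> module_hom R (free_module R n) C"
    and im: "\<And>x. x \<in> carrier (free_module R n) \<Longrightarrow> h x \<in> g ` carrier B"
  shows "\<exists>l\<in>module_hom R (free_module R n) B. \<forall>x\<in>carrier (free_module R n). g (l x) = h x"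
proof -
  obtain l where "l \<in> module_hom R (free_module R n) B"
    "\<And>x. x \<in> {..<n} \<rightarrow>\<^sub>E carrier R \<Longrightarrow> g (l x) = h x"
    by (rule hom_lift[OF B C g h]) (use im in \<open>auto simp: free_simps\<close>)
  then show ?thesis by (intro bexI) (auto simp: free_simps)
qed

text \<open>The comparison theorem, built degree by degree. The invariant \<open>A\<close> carries
  along that \<psi> after d takes values in the image of d', which is what the next lift
  requires.\<close>

lemma chain_lift:
  fixes X :: "('a, 'm) module" and Y :: "('a, 'n) module"
  assumes X: "module R X" and Y: "module R Y"
    and P: "free_resolution R b d \<epsilon> X" and Q: "free_resolution R b' d' \<epsilon>' Y"
    and h: "h \<in> module_hom R X Y"
  obtains \<phi> where "chain_map R b d b' d' \<phi>"
    "\<forall>x\<in>carrier (free_module R (b 0)). \<epsilon>' (\<phi> 0 x) = h (\<epsilon> x)"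
proof -
  let ?P = "\<lambda>i. free_module R (b i)" and ?Q = "\<lambda>i. free_module R (b' i)"
  note FM = free_module_module
  note P' = resolutionD[OF P] and Q' = resolutionD[OF Q]
  have he: "(\<lambda>x. h (\<epsilon> x)) \<in> module_hom R (?P 0) Y" by (rule hom_comp[OF P'(3) h])
  have "\<exists>l\<in>module_hom R (?P 0) (?Q 0). \<forall>x\<in>carrier (?P 0). \<epsilon>' (l x) = h (\<epsilon> x)"
    by (rule hom_lift_free[OF FM Y Q'(3) he]) (use hom_closed[OF he] Q'(4) in simp)
  then obtain \<phi>0 where \<phi>0: "\<phi>0 \<in> module_hom R (?P 0) (?Q 0)"
    "\<And>x. x \<in> carrier (?P 0) \<Longrightarrow> \<epsilon>' (\<phi>0 x) = h (\<epsilon> x)" by blast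
  define A where "A n \<psi> \<longleftrightarrow> \<psi> \<in> module_hom R (?P n) (?Q n) \<and> (n = 0 \<longrightarrow> \<psi> = \<phi>0) \<and>
      (\<forall>x\<in>carrier (?P (Suc n)). \<psi> (d n x) \<in> d' n ` carrier (?Q (Suc n)))" for n \<psi>
  define S where "S n \<psi> \<psi>' \<longleftrightarrow> (\<forall>x\<in>carrier (?P (Suc n)). d' n (\<psi>' x) = \<psi> (d n x))" for n \<psi> \<psi>'
  have "\<exists>\<phi>. \<forall>n. A n (\<phi> n) \<and> S n (\<phi> n) (\<phi> (Suc n))"
  proof (rule dependent_nat_choice)
    have "\<phi>0 (d 0 x) \<in> d' 0 ` carrier (?Q (Suc 0))" if x: "x \<in> carrier (?P (Suc 0))" for x
    proof (rule Q'(7))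
      note dx = hom_closed[OF P'(2) x]
      show "\<phi>0 (d 0 x) \<in> carrier (?Q 0)" by (rule hom_closed[OF \<phi>0(1) dx])
      show "\<epsilon>' (\<phi>0 (d 0 x)) = \<zero>\<^bsub>Y\<^esub>" using \<phi>0(2)[OF dx] P'(5)[OF x] hom_zero[OF X Y h] by simp
    qed
    then show "\<exists>\<psi>. A 0 \<psi>" using \<phi>0(1) unfolding A_def by blast
  next
    fix \<psi> n assume A: "A n \<psi>"
    then have \<psi>: "\<psi> \<in> module_hom R (?P n) (?Q n)" by (simp add: A_def)
    have "\<exists>l\<in>module_hom R (?P (Suc n)) (?Q (Suc n)). \<forall>x\<in>carrier (?P (Suc n)). d' n (l x) = \<psi> (d n x)"
      by (rule hom_lift_free[OF FM FM Q'(2) hom_comp[OF P'(2) \<psi>]]) (use A in \<open>simp add: A_def\<close>)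
    then obtain \<psi>' where \<psi>': "\<psi>' \<in> module_hom R (?P (Suc n)) (?Q (Suc n))"
      "\<And>x. x \<in> carrier (?P (Suc n)) \<Longrightarrow> d' n (\<psi>' x) = \<psi> (d n x)" by blast
    have "\<psi>' (d (Suc n) x) \<in> d' (Suc n) ` carrier (?Q (Suc (Suc n)))"
      if x: "x \<in> carrier (?P (Suc (Suc n)))" for x
    proof (rule Q'(8))
      note dx = hom_closed[OF P'(2) x]
      show "\<psi>' (d (Suc n) x) \<in> carrier (?Q (Suc n))" by (rule hom_closed[OF \<psi>'(1) dx])
      show "d' n (\<psi>' (d (Suc n) x)) = \<zero>\<^bsub>?Q n\<^esub>"
        using \<psi>'(2)[OF dx] P'(6)[OF x] hom_zero[OF FM FM \<psi>] by simp
    qed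
    then have "A (Suc n) \<psi>' \<and> S n \<psi> \<psi>'" using \<psi>' by (simp add: A_def S_def)
    then show "\<exists>\<psi>'. A (Suc n) \<psi>' \<and> S n \<psi> \<psi>'" by blast
  qed
  then obtain \<phi> where \<phi>: "\<And>n. A n (\<phi> n)" "\<And>n. S n (\<phi> n) (\<phi> (Suc n))" by blast
  have "\<phi> 0 = \<phi>0" using \<phi>(1)[of 0] by (simp add: A_def)
  moreover have "chain_map R b d b' d' \<phi>" using \<phi> by (simp add: chain_map_def A_def S_def)
  ultimately show ?thesis by (intro that[of \<phi>]) (simp_all add: \<phi>0(2))
qed

text \<open>The homotopy is built recursively: the difference of \<phi> and s d is a cycle, hence a
  boundary, and can be lifted. For this it suffices to remember that d' s d = \<phi> d, the last
  clause of \<open>A\<close>.\<close>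

lemma null_homotopic:
  fixes X :: "('a, 'm) module" and Y :: "('a, 'n) module"
  assumes P: "free_resolution R b d \<epsilon> X" and Q: "free_resolution R b' d' \<epsilon>' Y"
    and \<phi>: "chain_map R b d b' d' \<phi>"
    and 0: "\<And>x. x \<in> carrier (free_module R (b 0)) \<Longrightarrow> \<epsilon>' (\<phi> 0 x) = \<zero>\<^bsub>Y\<^esub>"
  obtains s where "\<forall>i. s i \<in> module_hom R (free_module R (b i)) (free_module R (b' (Suc i)))"
    "\<forall>x\<in>carrier (free_module R (b 0)). \<phi> 0 x = d' 0 (s 0 x)"
    "\<forall>i. \<forall>x\<in>carrier (free_module R (b (Suc i))).
        \<phi> (Suc i) x = d' (Suc i) (s (Suc i) x) \<oplus>\<^bsub>free_module R (b' (Suc i))\<^esub> s i (d i x)"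
proof -
  let ?P = "\<lambda>i. free_module R (b i)" and ?Q = "\<lambda>i. free_module R (b' i)"
  note FM = free_module_module
  note P' = resolutionD[OF P] and Q' = resolutionD[OF Q]
  note \<phi>1 = chain_mapD(1)[OF \<phi>] and \<phi>2 = chain_mapD(2)[OF \<phi>]
  have "\<exists>l\<in>module_hom R (?P 0) (?Q (Suc 0)). \<forall>x\<in>carrier (?P 0). d' 0 (l x) = \<phi> 0 x"
    by (rule hom_lift_free[OF FM FM Q'(2) \<phi>1]) (use Q'(7) hom_closed[OF \<phi>1] 0 in blast)
  then obtain s0 where s0: "s0 \<in> module_hom R (?P 0) (?Q (Suc 0))"
    "\<And>x. x \<in> carrier (?P 0) \<Longrightarrow> d' 0 (s0 x) = \<phi> 0 x" by blast
  define A where "A n s \<longleftrightarrow> s \<in> module_hom R (?P n) (?Q (Suc n)) \<and> (n = 0 \<longrightarrow> s = s0) \<and>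
      (\<forall>x\<in>carrier (?P (Suc n)). d' n (s (d n x)) = \<phi> n (d n x))" for n s
  define S where "S n s s' \<longleftrightarrow> (\<forall>x\<in>carrier (?P (Suc n)).
      \<phi> (Suc n) x = d' (Suc n) (s' x) \<oplus>\<^bsub>?Q (Suc n)\<^esub> s (d n x))" for n s s'
  have "\<exists>s. \<forall>n. A n (s n) \<and> S n (s n) (s (Suc n))"
  proof (rule dependent_nat_choice)
    show "\<exists>s. A 0 s" using s0 hom_closed[OF P'(2)] unfolding A_def by blast
  next
    fix s n assume A: "A n s"
    then have s: "s \<in> module_hom R (?P n) (?Q (Suc n))" by (simp add: A_def)
    interpret Q: Module.module R "?Q (Suc n)" by (rule FM)
    interpret Q0: Module.module R "?Q n" by (rule FM)
    let ?h = "\<lambda>x. \<phi> (Suc n) x \<ominus>\<^bsub>?Q (Suc n)\<^esub> s (d n x)"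
    have h: "?h \<in> module_hom R (?P (Suc n)) (?Q (Suc n))"
      by (rule hom_diff[OF FM \<phi>1 hom_comp[OF P'(2) s]])
    have "\<exists>l\<in>module_hom R (?P (Suc n)) (?Q (Suc (Suc n))). \<forall>x\<in>carrier (?P (Suc n)). d' (Suc n) (l x) = ?h x"
    proof (rule hom_lift_free[OF FM FM Q'(2) h], rule Q'(8))
      fix x assume x: "x \<in> carrier (?P (Suc n))"
      show "?h x \<in> carrier (?Q (Suc n))" by (rule hom_closed[OF h x])
      have "d' n (?h x) = d' n (\<phi> (Suc n) x) \<ominus>\<^bsub>?Q n\<^esub> d' n (s (d n x))"
        by (intro hom_minus[OF FM FM Q'(2)] hom_closed[OF \<phi>1] hom_closed[OF s] hom_closed[OF P'(2)] x)
      also have "\<dots> = \<phi> n (d n x) \<ominus>\<^bsub>?Q n\<^esub> \<phi> n (d n x)" using \<phi>2[OF x] A x by (simp add: A_def)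
      also have "\<dots> = \<zero>\<^bsub>?Q n\<^esub>"
        using hom_closed[OF \<phi>1 hom_closed[OF P'(2) x]] by (simp add: Q0.minus_eq_zero_iff)
      finally show "d' n (?h x) = \<zero>\<^bsub>?Q n\<^esub>" .
    qed
    then obtain s' where s': "s' \<in> module_hom R (?P (Suc n)) (?Q (Suc (Suc n)))"
      "\<And>x. x \<in> carrier (?P (Suc n)) \<Longrightarrow> d' (Suc n) (s' x) = ?h x" by blast
    have S: "S n s s'"
      unfolding S_def
    proof
      fix x assume x: "x \<in> carrier (?P (Suc n))"
      show "\<phi> (Suc n) x = d' (Suc n) (s' x) \<oplus>\<^bsub>?Q (Suc n)\<^esub> s (d n x)"
        unfolding s'(2)[OF x]
        by (rule Q.minus_plus_cancel[symmetric]) (intro hom_closed[OF \<phi>1] hom_closed[OF s] hom_closed[OF P'(2)] x)+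
    qed
    have "d' (Suc n) (s' (d (Suc n) x)) = \<phi> (Suc n) (d (Suc n) x)"
      if x: "x \<in> carrier (?P (Suc (Suc n)))" for x
    proof -
      note dx = hom_closed[OF P'(2) x]
      have "s (d n (d (Suc n) x)) = \<zero>\<^bsub>?Q (Suc n)\<^esub>" using P'(6)[OF x] hom_zero[OF FM FM s] by simp
      then show ?thesis using s'(2)[OF dx] hom_closed[OF \<phi>1 dx]
        by (simp add: Q.minus_eq Q.add.inv_one[folded a_inv_def, simplified])
    qed
    then have "A (Suc n) s'" using s' by (simp add: A_def)
    then show "\<exists>s'. A (Suc n) s' \<and> S n s s'" using S by blast
  qed
  then obtain s where s: "\<And>n. A n (s n)" "\<And>n. S n (s n) (s (Suc n))" by blast
  have "s 0 = s0" using s(1)[of 0] by (simp add: A_def)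
  then show ?thesis using s by (intro that[of s]) (simp_all add: A_def S_def s0(2))
qed

text \<open>Applying f to the homotopy formula kills the term with d' in front, since f is a
  cocycle, and leaves f s d.\<close>

lemma cobdry_null_homotopic:
  fixes X :: "('a, 'm) module" and Y :: "('a, 'n) module" and N :: "('a, 'k) module"
  assumes N: "module R N"
    and P: "free_resolution R b d \<epsilon> X" and Q: "free_resolution R b' d' \<epsilon>' Y"
    and \<phi>: "chain_map R b d b' d' \<phi>"
    and 0: "\<And>x. x \<in> carrier (free_module R (b 0)) \<Longrightarrow> \<epsilon>' (\<phi> 0 x) = \<zero>\<^bsub>Y\<^esub>"
    and f: "cocycle R b' d' N n f"
  shows "cobdry R b d N n (\<lambda>x. f (\<phi> n x))"
proof -
  interpret N: Module.module R N by fact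
  obtain s where s0: "\<forall>i. s i \<in> module_hom R (free_module R (b i)) (free_module R (b' (Suc i)))"
    "\<forall>x\<in>carrier (free_module R (b 0)). \<phi> 0 x = d' 0 (s 0 x)"
    "\<forall>i. \<forall>x\<in>carrier (free_module R (b (Suc i))).
        \<phi> (Suc i) x = d' (Suc i) (s (Suc i) x) \<oplus>\<^bsub>free_module R (b' (Suc i))\<^esub> s i (d i x)"
    by (rule null_homotopic[OF P Q \<phi> 0])
  note s = s0[rule_format]
  have f1: "f \<in> module_hom R (free_module R (b' n)) N"
    and f2: "\<And>x. x \<in> carrier (free_module R (b' (Suc n))) \<Longrightarrow> f (d' n x) = \<zero>\<^bsub>N\<^esub>"
    using f by (auto simp: cocycle_def)
  show ?thesis
  proof (cases n)
    case 0
    then show ?thesis using s(2) f2 hom_closed[OF s(1)] by (simp add: cobdry_0)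
  next
    case (Suc m)
    have g: "(\<lambda>x. f (s m x)) \<in> module_hom R (free_module R (b m)) N"
      using hom_comp[OF s(1)[of m]] f1 Suc by simp
    have "f (\<phi> n x) = f (s m (d m x))" if x: "x \<in> carrier (free_module R (b (Suc m)))" for x
    proof -
      note sx = hom_closed[OF s(1) x] and sdx = hom_closed[OF s(1) hom_closed[OF resolutionD(2)[OF P] x]]
      have "f (\<phi> n x) = f (d' (Suc m) (s (Suc m) x)) \<oplus>\<^bsub>N\<^esub> f (s m (d m x))"
        unfolding Suc s(3)[OF x] using hom_add[OF f1] hom_closed[OF resolutionD(2)[OF Q] sx] sdx Suc by simp
      also have "\<dots> = f (s m (d m x))" using f2 sx hom_closed[OF f1] sdx Suc by simp
      finally show ?thesis .
    qed
    then show ?thesis unfolding Suc cobdry_Suc by (intro bexI[OF _ g]) simp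
  qed
qed

lemma chain_map_comp:
  assumes "chain_map R b d b' d' \<phi>" "chain_map R b' d' b'' d'' \<psi>"
  shows "chain_map R b d b'' d'' (\<lambda>i x. \<psi> i (\<phi> i x))"
  unfolding chain_map_def
proof (intro conjI allI ballI)
  show "(\<lambda>x. \<psi> i (\<phi> i x)) \<in> module_hom R (free_module R (b i)) (free_module R (b'' i))" for i
    by (rule hom_comp[OF chain_mapD(1)[OF assms(1)] chain_mapD(1)[OF assms(2)]])
  show "d'' i (\<psi> (Suc i) (\<phi> (Suc i) x)) = \<psi> i (\<phi> i (d i x))"
    if "x \<in> carrier (free_module R (b (Suc i)))" for i x
    using chain_mapD(2)[OF assms(2) hom_closed[OF chain_mapD(1)[OF assms(1)] that]]
      chain_mapD(2)[OF assms(1) that] by simp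
qed

text \<open>If \<alpha> and \<beta> lift u and v, then 1 - \<alpha> \<beta> lifts 1 - u v = 0 and is
  null-homotopic. So f equals f \<alpha> \<beta> up to a coboundary, and f \<alpha> is a coboundary
  by hypothesis. With u and v the identity this is independence of the resolution.\<close>

lemma acyclic_at_indep:
  fixes X :: "('a, 'm) module" and Y :: "('a, 'n) module" and N :: "('a, 'k) module"
  assumes X: "module R X" and Y: "module R Y" and N: "module R N"
    and P: "free_resolution R b d \<epsilon> X" and Q: "free_resolution R b' d' \<epsilon>' Y"
    and u: "u \<in> module_hom R X Y" and v: "v \<in> module_hom R Y X"
    and uv: "\<And>y. y \<in> carrier Y \<Longrightarrow> u (v y) = y"
    and P0: "acyclic_at R b d N n"
  shows "acyclic_at R b' d' N n"
  unfolding acyclic_at_def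
proof (intro allI impI)
  fix f assume f: "cocycle R b' d' N n f"
  interpret N: Module.module R N by fact
  interpret Y: Module.module R Y by fact
  note FM = free_module_module
  note Q' = resolutionD[OF Q]
  obtain \<alpha> where \<alpha>: "chain_map R b d b' d' \<alpha>"
    "\<forall>x\<in>carrier (free_module R (b 0)). \<epsilon>' (\<alpha> 0 x) = u (\<epsilon> x)"
    by (rule chain_lift[OF X Y P Q u])
  obtain \<beta> where \<beta>: "chain_map R b' d' b d \<beta>"
    "\<forall>x\<in>carrier (free_module R (b' 0)). \<epsilon> (\<beta> 0 x) = v (\<epsilon>' x)"
    by (rule chain_lift[OF Y X Q P v])
  let ?F = "\<lambda>i. free_module R (b' i)"
  let ?\<gamma> = "\<lambda>i x. \<alpha> i (\<beta> i x)"
  have \<gamma>: "chain_map R b' d' b' d' ?\<gamma>" by (rule chain_map_comp[OF \<beta>(1) \<alpha>(1)])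
  note \<gamma>1 = chain_mapD(1)[OF \<gamma>]
  let ?\<psi> = "\<lambda>i x. x \<ominus>\<^bsub>?F i\<^esub> ?\<gamma> i x"
  have \<psi>: "chain_map R b' d' b' d' ?\<psi>"
    unfolding chain_map_def
  proof (intro conjI allI ballI)
    show "?\<psi> i \<in> module_hom R (?F i) (?F i)" for i by (rule hom_diff[OF FM hom_id \<gamma>1])
    show "d' i (?\<psi> (Suc i) x) = ?\<psi> i (d' i x)" if x: "x \<in> carrier (?F (Suc i))" for i x
      using hom_minus[OF FM FM Q'(2) x hom_closed[OF \<gamma>1 x]] chain_mapD(2)[OF \<gamma> x] by simp
  qed
  have \<psi>0: "\<epsilon>' (?\<psi> 0 x) = \<zero>\<^bsub>Y\<^esub>" if x: "x \<in> carrier (?F 0)" for x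
  proof -
    have "\<epsilon>' (?\<psi> 0 x) = \<epsilon>' x \<ominus>\<^bsub>Y\<^esub> \<epsilon>' (?\<gamma> 0 x)"
      by (rule hom_minus[OF FM Y Q'(3) x hom_closed[OF \<gamma>1 x]])
    also have "\<epsilon>' (?\<gamma> 0 x) = u (v (\<epsilon>' x))"
      using bspec[OF \<alpha>(2) hom_closed[OF chain_mapD(1)[OF \<beta>(1)] x]] bspec[OF \<beta>(2) x] by simp
    also have "\<dots> = \<epsilon>' x" by (rule uv[OF hom_closed[OF Q'(3) x]])
    finally show ?thesis using hom_closed[OF Q'(3) x] Y.minus_eq_zero_iff by simp
  qed
  have 1: "cobdry R b' d' N n (\<lambda>x. f (?\<psi> n x))" by (rule cobdry_null_homotopic[OF N Q Q \<psi> \<psi>0 f])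
  have "cobdry R b d N n (\<lambda>x. f (\<alpha> n x))"
    using P0 cocycle_chain_map[OF \<alpha>(1) f] by (simp add: acyclic_at_def)
  then have 2: "cobdry R b' d' N n (\<lambda>x. f (?\<gamma> n x))" by (rule cobdry_chain_map[OF \<beta>(1)])
  have f1: "f \<in> module_hom R (?F n) N" using f by (simp add: cocycle_def)
  show "cobdry R b' d' N n f"
  proof (rule cobdry_cong[OF cobdry_plus[OF N 1 2]])
    fix x assume x: "x \<in> carrier (?F n)"
    note gx = hom_closed[OF \<gamma>1 x]
    show "f x = f (?\<psi> n x) \<oplus>\<^bsub>N\<^esub> f (?\<gamma> n x)"
      unfolding hom_minus[OF FM N f1 x gx]
      by (rule N.minus_plus_cancel[symmetric]) (intro hom_closed[OF f1] x gx)+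
  qed
qed

text \<open>Multiplication by r on the resolution lifts multiplication by r on X, which is zero, and
  is therefore null-homotopic: whatever kills X kills Ext(X, N).\<close>

lemma cobdry_annihilated:
  fixes X :: "('a, 'm) module" and N :: "('a, 'k) module"
  assumes X: "module R X" and N: "module R N" and P: "free_resolution R b d \<epsilon> X"
    and r: "r \<in> carrier R" "\<And>x. x \<in> carrier X \<Longrightarrow> r \<odot>\<^bsub>X\<^esub> x = \<zero>\<^bsub>X\<^esub>"
    and f: "cocycle R b d N n f"
  shows "cobdry R b d N n (\<lambda>x. r \<odot>\<^bsub>N\<^esub> f x)"
proof -
  let ?F = "\<lambda>i. free_module R (b i)"
  note FM = free_module_module
  note P' = resolutionD[OF P]
  let ?\<psi> = "\<lambda>i x. r \<odot>\<^bsub>?F i\<^esub> x"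
  have \<psi>: "chain_map R b d b d ?\<psi>"
    unfolding chain_map_def using hom_scale[OF FM hom_id r(1)] hom_smult[OF P'(2) r(1)] by auto
  have "\<epsilon> (?\<psi> 0 x) = \<zero>\<^bsub>X\<^esub>" if "x \<in> carrier (?F 0)" for x
    using hom_smult[OF P'(3) r(1) that] r(2)[OF hom_closed[OF P'(3) that]] by simp
  from cobdry_null_homotopic[OF N P P \<psi> this f] show ?thesis
  proof (rule cobdry_cong)
    fix x assume "x \<in> carrier (?F n)"
    moreover have "f \<in> module_hom R (?F n) N" using f by (simp add: cocycle_def)
    ultimately show "r \<odot>\<^bsub>N\<^esub> f x = f (?\<psi> n x)" using hom_smult[OF _ r(1)] by metis
  qed
qed

section \<open>Short exact sequences in the second argument\<close>

context
  fixes X :: "('a, 'm) module" and b d \<epsilon>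
    and Z :: "('a, 'k) module" and F :: "('a, 'l) module" and Y :: "('a, 'n) module" and i p
  assumes P: "free_resolution R b d \<epsilon> X"
    and Z: "module R Z" and F: "module R F" and Y: "module R Y"
    and i: "i \<in> module_hom R Z F" and i_inj: "\<And>z. z \<in> carrier Z \<Longrightarrow> i z = \<zero>\<^bsub>F\<^esub> \<Longrightarrow> z = \<zero>\<^bsub>Z\<^esub>"
    and p: "p \<in> module_hom R F Y" and p_surj: "p ` carrier F = carrier Y"
    and exact: "\<And>x. x \<in> carrier F \<Longrightarrow> p x = \<zero>\<^bsub>Y\<^esub> \<longleftrightarrow> x \<in> i ` carrier Z"
begin

private abbreviation "Fr n \<equiv> free_module R (b n)"

private lemma i_eqI: "z \<in> carrier Z \<Longrightarrow> z' \<in> carrier Z \<Longrightarrow> i z = i z' \<Longrightarrow> z = z'"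
proof -
  interpret Z: Module.module R Z by (rule Z)
  interpret F: Module.module R F by (rule F)
  assume z: "z \<in> carrier Z" "z' \<in> carrier Z" "i z = i z'"
  then have "i (z \<ominus>\<^bsub>Z\<^esub> z') = \<zero>\<^bsub>F\<^esub>"
    using hom_minus[OF Z F i] F.minus_eq_zero_iff hom_closed[OF i] by simp
  then show "z = z'" using i_inj[of "z \<ominus>\<^bsub>Z\<^esub> z'"] z Z.minus_eq_zero_iff by simp
qed

text \<open>The chase in H^n(F) -> H^n(Y) -> H^(n+1)(Z): v is lifted to v' with values in F, the
  defect v' d comes from Z, where it is a coboundary w' d, and subtracting w' turns the lift into a
  cocycle.\<close>

lemma acyclic_at_quotient:
  assumes VF: "acyclic_at R b d F n" and VZ: "acyclic_at R b d Z (Suc n)"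
  shows "acyclic_at R b d Y n"
  unfolding acyclic_at_def
proof (intro allI impI)
  interpret F: Module.module R F by (rule F)
  interpret Y: Module.module R Y by (rule Y)
  interpret Z: Module.module R Z by (rule Z)
  note FM = free_module_module and P' = resolutionD[OF P]
  fix v assume "cocycle R b d Y n v"
  then have v: "v \<in> module_hom R (Fr n) Y"
    "\<And>x. x \<in> carrier (Fr (Suc n)) \<Longrightarrow> v (d n x) = \<zero>\<^bsub>Y\<^esub>" by (auto simp: cocycle_def)
  obtain v' where v': "v' \<in> module_hom R (Fr n) F" "\<And>x. x \<in> carrier (Fr n) \<Longrightarrow> p (v' x) = v x"
    using hom_lift_free[OF F Y p v(1)] hom_closed[OF v(1)] p_surj by blast
  have vd: "v' (d n x) \<in> i ` carrier Z" if "x \<in> carrier (Fr (Suc n))" for x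
    using exact hom_closed[OF v'(1)] hom_closed[OF P'(2) that] v'(2) v(2)[OF that] by metis
  obtain w where w: "w \<in> module_hom R (Fr (Suc n)) Z" "\<And>x. x \<in> carrier (Fr (Suc n)) \<Longrightarrow> i (w x) = v' (d n x)"
    using hom_lift_free[OF Z F i hom_comp[OF P'(2) v'(1)] vd] by blast
  have "w (d (Suc n) x) = \<zero>\<^bsub>Z\<^esub>" if x: "x \<in> carrier (Fr (Suc (Suc n)))" for x
  proof (rule i_inj[OF hom_closed[OF w(1) hom_closed[OF P'(2) x]]])
    show "i (w (d (Suc n) x)) = \<zero>\<^bsub>F\<^esub>"
      using w(2)[OF hom_closed[OF P'(2) x]] P'(6)[OF x] hom_zero[OF FM F v'(1)] by simp
  qed
  then have "cobdry R b d Z (Suc n) w" using VZ w(1) by (simp add: acyclic_at_def cocycle_def)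
  then obtain w' where w': "w' \<in> module_hom R (Fr n) Z"
    "\<And>x. x \<in> carrier (Fr (Suc n)) \<Longrightarrow> w x = w' (d n x)" by (auto simp: cobdry_Suc)
  let ?t = "\<lambda>x. v' x \<ominus>\<^bsub>F\<^esub> i (w' x)"
  have "cocycle R b d F n ?t"
    unfolding cocycle_def
  proof (intro conjI ballI)
    show "?t \<in> module_hom R (Fr n) F" by (rule hom_diff[OF F v'(1) hom_comp[OF w'(1) i]])
    fix x assume x: "x \<in> carrier (Fr (Suc n))"
    note c = hom_closed[OF v'(1) hom_closed[OF P'(2) x]]
    show "?t (d n x) = \<zero>\<^bsub>F\<^esub>" using w(2)[OF x] w'(2)[OF x] c F.minus_eq_zero_iff[OF c c] by simp
  qed
  then have t: "cobdry R b d F n ?t" using VF by (simp add: acyclic_at_def)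
  show "cobdry R b d Y n v"
  proof (rule cobdry_cong[OF cobdry_comp[OF F Y p t]])
    fix x assume x: "x \<in> carrier (Fr n)"
    have "p (?t x) = p (v' x) \<ominus>\<^bsub>Y\<^esub> p (i (w' x))"
      by (rule hom_minus[OF F Y p hom_closed[OF v'(1) x] hom_closed[OF i hom_closed[OF w'(1) x]]])
    also have "p (i (w' x)) = \<zero>\<^bsub>Y\<^esub>"
      using exact[of "i (w' x)"] hom_closed[OF i] hom_closed[OF w'(1) x] by blast
    also have "p (v' x) \<ominus>\<^bsub>Y\<^esub> \<zero>\<^bsub>Y\<^esub> = v x"
      using v'(2)[OF x] hom_closed[OF v(1) x] by (simp add: Y.minus_eq Y.add.inv_one[folded a_inv_def, simplified])
    finally show "v x = p (?t x)" by simp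
  qed
qed

text \<open>A class of H^(n+1)(Z) that dies in F comes from H^n(Y), which is zero. Only a single
  \<open>v\<close> is considered because H^(n+1)(F) need not vanish.\<close>

lemma cobdry_sub:
  assumes VY: "acyclic_at R b d Y n" and v: "v \<in> module_hom R (Fr (Suc n)) Z"
    and iv: "cobdry R b d F (Suc n) (\<lambda>x. i (v x))"
  shows "cobdry R b d Z (Suc n) v"
proof -
  interpret F: Module.module R F by (rule F)
  interpret Y: Module.module R Y by (rule Y)
  interpret Z: Module.module R Z by (rule Z)
  note FM = free_module_module and P' = resolutionD[OF P]
  obtain w where w: "w \<in> module_hom R (Fr n) F" "\<And>x. x \<in> carrier (Fr (Suc n)) \<Longrightarrow> i (v x) = w (d n x)"
    using iv by (auto simp: cobdry_Suc)
  have "p (w (d n x)) = \<zero>\<^bsub>Y\<^esub>" if x: "x \<in> carrier (Fr (Suc n))" for x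
    using exact[of "i (v x)"] hom_closed[OF i] hom_closed[OF v x] w(2)[OF x] by force
  then have "cocycle R b d Y n (\<lambda>x. p (w x))" using hom_comp[OF w(1) p] by (simp add: cocycle_def)
  then have pw: "cobdry R b d Y n (\<lambda>x. p (w x))" using VY by (simp add: acyclic_at_def)
  have "\<exists>w'\<in>module_hom R (Fr n) F. (\<forall>x\<in>carrier (Fr n). p (w' x) = \<zero>\<^bsub>Y\<^esub>) \<and>
      (\<forall>x\<in>carrier (Fr (Suc n)). w' (d n x) = w (d n x))"
  proof (cases n)
    case 0
    then show ?thesis using w(1) pw by (auto simp: cobdry_0)
  next
    case (Suc m)
    obtain y where y: "y \<in> module_hom R (Fr m) Y" "\<And>x. x \<in> carrier (Fr n) \<Longrightarrow> p (w x) = y (d m x)"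
      using pw unfolding Suc by (auto simp: cobdry_Suc)
    obtain y' where y': "y' \<in> module_hom R (Fr m) F" "\<And>x. x \<in> carrier (Fr m) \<Longrightarrow> p (y' x) = y x"
      using hom_lift_free[OF F Y p y(1)] hom_closed[OF y(1)] p_surj by blast
    have dm: "d m \<in> module_hom R (Fr n) (Fr m)" using P'(2)[of m] Suc by simp
    let ?w = "\<lambda>x. w x \<ominus>\<^bsub>F\<^esub> y' (d m x)"
    show ?thesis
    proof (intro bexI[of _ ?w] conjI ballI)
      show "?w \<in> module_hom R (Fr n) F" by (rule hom_diff[OF F w(1) hom_comp[OF dm y'(1)]])
      fix x assume x: "x \<in> carrier (Fr n)"
      note dx = hom_closed[OF dm x]
      have "p (?w x) = p (w x) \<ominus>\<^bsub>Y\<^esub> p (y' (d m x))"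
        by (rule hom_minus[OF F Y p hom_closed[OF w(1) x] hom_closed[OF y'(1) dx]])
      then show "p (?w x) = \<zero>\<^bsub>Y\<^esub>"
        using y(2)[OF x] y'(2)[OF dx] hom_closed[OF y(1) dx] Y.minus_eq_zero_iff by simp
    next
      fix x assume x: "x \<in> carrier (Fr (Suc n))"
      have "d m (d n x) = \<zero>\<^bsub>Fr m\<^esub>" using P'(6)[of x m] x Suc by simp
      then have "y' (d m (d n x)) = \<zero>\<^bsub>F\<^esub>" using hom_zero[OF FM F y'(1)] by simp
      then show "?w (d n x) = w (d n x)"
        using hom_closed[OF w(1) hom_closed[OF P'(2) x]] by (simp add: F.minus_eq F.add.inv_one[folded a_inv_def, simplified])
    qed
  qed
  then obtain w' where w': "w' \<in> module_hom R (Fr n) F" "\<And>x. x \<in> carrier (Fr n) \<Longrightarrow> p (w' x) = \<zero>\<^bsub>Y\<^esub>"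
    "\<And>x. x \<in> carrier (Fr (Suc n)) \<Longrightarrow> w' (d n x) = w (d n x)" by blast
  have im: "w' x \<in> i ` carrier Z" if "x \<in> carrier (Fr n)" for x
    using exact[OF hom_closed[OF w'(1) that]] w'(2)[OF that] by simp
  obtain z where z: "z \<in> module_hom R (Fr n) Z" "\<And>x. x \<in> carrier (Fr n) \<Longrightarrow> i (z x) = w' x"
    using hom_lift_free[OF Z F i w'(1) im] by blast
  have "v x = z (d n x)" if x: "x \<in> carrier (Fr (Suc n))" for x
  proof (rule i_eqI[OF hom_closed[OF v x] hom_closed[OF z(1) hom_closed[OF P'(2) x]]])
    show "i (v x) = i (z (d n x))" using w(2)[OF x] w'(3)[OF x] z(2)[OF hom_closed[OF P'(2) x]] by simp
  qed
  then show ?thesis using z(1) unfolding cobdry_Suc by blast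
qed

end

lemma acyclic_at_iso:
  fixes N :: "('a, 'k) module" and N' :: "('a, 'l) module"
  assumes N: "module R N" and N': "module R N'"
    and u: "u \<in> module_hom R N N'" and v: "v \<in> module_hom R N' N"
    and uv: "\<And>y. y \<in> carrier N' \<Longrightarrow> u (v y) = y"
    and V: "acyclic_at R b d N n"
  shows "acyclic_at R b d N' n"
  unfolding acyclic_at_def
proof (intro allI impI)
  fix f assume f: "cocycle R b d N' n f"
  then have f1: "f \<in> module_hom R (free_module R (b n)) N'" by (simp add: cocycle_def)
  have "cocycle R b d N n (\<lambda>x. v (f x))"
    using f hom_comp[OF f1 v] hom_zero[OF N' N v] by (simp add: cocycle_def)
  then have "cobdry R b d N n (\<lambda>x. v (f x))" using V by (simp add: acyclic_at_def)
  from cobdry_comp[OF N N' u this] show "cobdry R b d N' n f"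
    by (rule cobdry_cong) (simp add: uv hom_closed[OF f1])
qed

end

lemma bij_hom_inverse:
  assumes N: "module R N" and f: "f \<in> module_hom R N N'" and bij: "bij_betw f (carrier N) (carrier N')"
  obtains g where "g \<in> module_hom R N' N" "\<And>x. x \<in> carrier N \<Longrightarrow> g (f x) = x"
    "\<And>y. y \<in> carrier N' \<Longrightarrow> f (g y) = y"
proof -
  interpret N: Module.module R N by fact
  let ?g = "inv_into (carrier N) f"
  have gf: "?g (f x) = x" if "x \<in> carrier N" for x
    using bij_betw_inv_into_left[OF bij that] .
  have fg: "f (?g y) = y" "?g y \<in> carrier N" if "y \<in> carrier N'" for y
    using bij_betw_inv_into_right[OF bij that] bij_betwE[OF bij_betw_inv_into[OF bij]] that by auto
  have "?g \<in> module_hom R N' N"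
  proof (rule homI)
    show "?g y \<in> carrier N" if "y \<in> carrier N'" for y by (rule fg(2)[OF that])
    show "?g (x \<oplus>\<^bsub>N'\<^esub> y) = ?g x \<oplus>\<^bsub>N\<^esub> ?g y" if "x \<in> carrier N'" "y \<in> carrier N'" for x y
      using gf[of "?g x \<oplus>\<^bsub>N\<^esub> ?g y"] hom_add[OF f fg(2)[OF that(1)] fg(2)[OF that(2)]] fg that by simp
    show "?g (r \<odot>\<^bsub>N'\<^esub> y) = r \<odot>\<^bsub>N\<^esub> ?g y" if "r \<in> carrier R" "y \<in> carrier N'" for r y
      using gf[of "r \<odot>\<^bsub>N\<^esub> ?g y"] hom_smult[OF f that(1) fg(2)[OF that(2)]] fg that by simp
  qed
  then show ?thesis using that gf fg(1) by blast
qed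

lemma (in abelian_group) neg_zero: "\<ominus> \<zero> = \<zero>"
  by (rule minus_equality) simp_all

section \<open>Mapping cones\<close>

text \<open>For a chain map \<open>\<phi>\<close> from the complex \<open>(a, dA)\<close> to \<open>(b, dB)\<close> the degree \<open>n\<close> part of the cone is
  \<open>R\<^sup>b\<^sup>(\<^sup>n\<^sup>) \<oplus> R\<^sup>a\<^sup>(\<^sup>n\<^sup>-\<^sup>1\<^sup>)\<close>; the shifted complex is extended by \<open>R\<^sup>0\<close> in degree \<open>0\<close>.\<close>

definition shift_rank :: "(nat \<Rightarrow> nat) \<Rightarrow> nat \<Rightarrow> nat" where
  "shift_rank a n = (case n of 0 \<Rightarrow> 0 | Suc m \<Rightarrow> a m)"

definition shift_diff ::
  "('a, 'r) ring_scheme \<Rightarrow> (nat \<Rightarrow> (nat \<Rightarrow> 'a) \<Rightarrow> (nat \<Rightarrow> 'a)) \<Rightarrow> nat \<Rightarrow> (nat \<Rightarrow> 'a) \<Rightarrow> (nat \<Rightarrow> 'a)" where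
  "shift_diff R d n = (case n of 0 \<Rightarrow> (\<lambda>x. \<zero>\<^bsub>free_module R 0\<^esub>) | Suc m \<Rightarrow> d m)"

definition cone_rank :: "(nat \<Rightarrow> nat) \<Rightarrow> (nat \<Rightarrow> nat) \<Rightarrow> nat \<Rightarrow> nat" where
  "cone_rank a b n = b n + shift_rank a n"

text \<open>The usual matrix: (y, z) goes to (dB y + \<phi> z, - dA z). The sign makes the
  contributions dB \<phi> and \<phi> dA cancel in the square.\<close>

definition cone_diff ::
  "('a, 'r) ring_scheme \<Rightarrow> (nat \<Rightarrow> nat) \<Rightarrow> (nat \<Rightarrow> (nat \<Rightarrow> 'a) \<Rightarrow> (nat \<Rightarrow> 'a)) \<Rightarrow>
     (nat \<Rightarrow> nat) \<Rightarrow> (nat \<Rightarrow> (nat \<Rightarrow> 'a) \<Rightarrow> (nat \<Rightarrow> 'a)) \<Rightarrow> (nat \<Rightarrow> (nat \<Rightarrow> 'a) \<Rightarrow> (nat \<Rightarrow> 'a)) \<Rightarrow>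
     nat \<Rightarrow> (nat \<Rightarrow> 'a) \<Rightarrow> (nat \<Rightarrow> 'a)" where
  "cone_diff R a dA b dB \<phi> n x =
     pairp (b n) (shift_rank a n)
       (dB n (fstp (b (Suc n)) x) \<oplus>\<^bsub>free_module R (b n)\<^esub> \<phi> n (sndp (b (Suc n)) (a n) x))
       (\<ominus>\<^bsub>free_module R (shift_rank a n)\<^esub> shift_diff R dA n (sndp (b (Suc n)) (a n) x))"

lemma shift_simps [simp]:
  "shift_rank a 0 = 0" "shift_rank a (Suc m) = a m"
  "shift_diff R d 0 x = \<zero>\<^bsub>free_module R 0\<^esub>" "shift_diff R d (Suc m) = d m"
  by (simp_all add: shift_rank_def shift_diff_def)

context cring
begin

lemma fst_closed: "x \<in> carrier (free_module R (m + k)) \<Longrightarrow> fstp m x \<in> carrier (free_module R m)"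
  by (rule hom_closed[OF fstp_hom])

lemma snd_closed: "x \<in> carrier (free_module R (m + k)) \<Longrightarrow> sndp m k x \<in> carrier (free_module R k)"
  by (rule hom_closed[OF sndp_hom])

lemma pair_closed:
  "x \<in> carrier (free_module R m) \<Longrightarrow> y \<in> carrier (free_module R k) \<Longrightarrow>
    pairp m k x y \<in> carrier (free_module R (m + k))"
  by (simp add: free_simps pairp_closed)

lemma fst_pair: "x \<in> carrier (free_module R m) \<Longrightarrow> fstp m (pairp m k x y) = x"
  by (simp add: free_simps fstp_pairp)

lemma snd_pair: "y \<in> carrier (free_module R k) \<Longrightarrow> sndp m k (pairp m k x y) = y"
  by (simp add: free_simps sndp_pairp)

lemma pair_eta: "x \<in> carrier (free_module R (m + k)) \<Longrightarrow> pairp m k (fstp m x) (sndp m k x) = x"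
  by (simp add: free_simps pairp_fstp_sndp)

lemma pair_eqI:
  assumes "x \<in> carrier (free_module R (m + k))" "y \<in> carrier (free_module R (m + k))"
    "fstp m x = fstp m y" "sndp m k x = sndp m k y"
  shows "x = y"
  using pair_eta[OF assms(1), unfolded assms(3,4)] unfolding pair_eta[OF assms(2)] by (rule sym)

lemma free_zero_closed: "\<zero>\<^bsub>free_module R k\<^esub> \<in> carrier (free_module R k)"
  using restrict_PiE_iff[of "\<lambda>i. \<zero>" "{..<k}" "\<lambda>i. carrier R"] by (simp add: free_simps del: restrict_PiE_iff)

lemma free_0: "x \<in> carrier (free_module R 0) \<Longrightarrow> x = \<zero>\<^bsub>free_module R 0\<^esub>"
  by (auto simp: free_simps)

context
  fixes a :: "nat \<Rightarrow> nat" and dA :: "nat \<Rightarrow> (nat \<Rightarrow> 'a) \<Rightarrow> (nat \<Rightarrow> 'a)" and \<epsilon>A and A :: "('a, 'm) module"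
    and b :: "nat \<Rightarrow> nat" and dB :: "nat \<Rightarrow> (nat \<Rightarrow> 'a) \<Rightarrow> (nat \<Rightarrow> 'a)" and \<epsilon>B and B :: "('a, 'n) module"
    and \<phi> :: "nat \<Rightarrow> (nat \<Rightarrow> 'a) \<Rightarrow> (nat \<Rightarrow> 'a)"
  assumes resA: "free_resolution R a dA \<epsilon>A A" and resB: "free_resolution R b dB \<epsilon>B B"
    and \<phi>: "chain_map R a dA b dB \<phi>"
begin

private abbreviation "P n \<equiv> free_module R (a n)"
private abbreviation "P' n \<equiv> free_module R (shift_rank a n)"
private abbreviation "Q n \<equiv> free_module R (b n)"
private abbreviation "K n \<equiv> free_module R (cone_rank a b n)"
private abbreviation "D \<equiv> cone_diff R a dA b dB \<phi>"
private abbreviation "d' \<equiv> shift_diff R dA"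

private lemmas rA = resolutionD[OF resA]
private lemmas rB = resolutionD[OF resB]
private lemmas \<phi>1 = chain_mapD(1)[OF \<phi>]
private lemmas \<phi>2 = chain_mapD(2)[OF \<phi>]
private lemmas FM = free_module_module

private lemma d'_hom: "d' n \<in> module_hom R (P n) (P' n)"
proof (cases n)
  case 0
  show ?thesis unfolding 0 shift_simps(1) shift_diff_def nat.case
    by (rule hom_const_zero[OF FM])
next
  case (Suc m)
  then show ?thesis using rA(2) by simp
qed

private lemma d'_d: "x \<in> carrier (P (Suc n)) \<Longrightarrow> d' n (dA n x) = \<zero>\<^bsub>P' n\<^esub>"
  using rA(6) by (cases n) auto

private lemma K_Suc: "cone_rank a b (Suc n) = b (Suc n) + a n"
  by (simp add: cone_rank_def)

private lemma fstK: "x \<in> carrier (K (Suc n)) \<Longrightarrow> fstp (b (Suc n)) x \<in> carrier (Q (Suc n))"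
  unfolding K_Suc by (rule fst_closed)

private lemma sndK: "x \<in> carrier (K (Suc n)) \<Longrightarrow> sndp (b (Suc n)) (a n) x \<in> carrier (P n)"
  unfolding K_Suc by (rule snd_closed)

lemma cone_diff_hom: "D n \<in> module_hom R (K (Suc n)) (K n)"
  unfolding cone_diff_def[abs_def] cone_rank_def shift_simps(2)
  by (intro pairp_hom FM hom_plus hom_uminus hom_comp[OF fstp_hom rB(2)] hom_comp[OF sndp_hom \<phi>1]
      hom_comp[OF sndp_hom d'_hom])

private lemma D_closed: "x \<in> carrier (K (Suc n)) \<Longrightarrow> D n x \<in> carrier (K n)"
  by (rule hom_closed[OF cone_diff_hom])

private lemma D_parts:
  assumes x: "x \<in> carrier (K (Suc n))"
  shows "fstp (b n) (D n x) = dB n (fstp (b (Suc n)) x) \<oplus>\<^bsub>Q n\<^esub> \<phi> n (sndp (b (Suc n)) (a n) x)"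
    "sndp (b n) (shift_rank a n) (D n x) = \<ominus>\<^bsub>P' n\<^esub> d' n (sndp (b (Suc n)) (a n) x)"
proof -
  interpret Q: Module.module R "Q n" by (rule FM)
  interpret P': Module.module R "P' n" by (rule FM)
  have 1: "dB n (fstp (b (Suc n)) x) \<oplus>\<^bsub>Q n\<^esub> \<phi> n (sndp (b (Suc n)) (a n) x) \<in> carrier (Q n)"
    by (intro Q.a_closed hom_closed[OF rB(2)] hom_closed[OF \<phi>1] fstK sndK x)
  have 2: "\<ominus>\<^bsub>P' n\<^esub> d' n (sndp (b (Suc n)) (a n) x) \<in> carrier (P' n)"
    by (intro P'.a_inv_closed hom_closed[OF d'_hom] sndK x)
  show "fstp (b n) (D n x) = dB n (fstp (b (Suc n)) x) \<oplus>\<^bsub>Q n\<^esub> \<phi> n (sndp (b (Suc n)) (a n) x)"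
    unfolding cone_diff_def by (rule fst_pair[OF 1])
  show "sndp (b n) (shift_rank a n) (D n x) = \<ominus>\<^bsub>P' n\<^esub> d' n (sndp (b (Suc n)) (a n) x)"
    unfolding cone_diff_def by (rule snd_pair[OF 2])
qed

private lemma D_parts_Suc:
  assumes x: "x \<in> carrier (K (Suc (Suc n)))"
  shows "sndp (b (Suc n)) (a n) (D (Suc n) x) = \<ominus>\<^bsub>P n\<^esub> dA n (sndp (b (Suc (Suc n))) (a (Suc n)) x)"
  using D_parts(2)[OF x] by simp

text \<open>If x = (x_1, dA y), then w = x_1 + \<phi> y is a cycle of the target complex, so w = dB
  q, and (q, -y) is a preimage of x. Only the reason why the second component is a boundary depends
  on the degree, and it is left to the caller.\<close>

private lemma cone_exact:
  assumes x: "x \<in> carrier (K (Suc n))" and y: "y \<in> carrier (P (Suc n))" "sndp (b (Suc n)) (a n) x = dA n y"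
    and z: "dB n (fstp (b (Suc n)) x) \<oplus>\<^bsub>Q n\<^esub> \<phi> n (sndp (b (Suc n)) (a n) x) = \<zero>\<^bsub>Q n\<^esub>"
  shows "x \<in> D (Suc n) ` carrier (K (Suc (Suc n)))"
proof -
  interpret Q: Module.module R "Q n" by (rule FM)
  interpret Q1: Module.module R "Q (Suc n)" by (rule FM)
  interpret P0: Module.module R "P n" by (rule FM)
  interpret P1: Module.module R "P (Suc n)" by (rule FM)
  let ?x = "fstp (b (Suc n)) x"
  let ?w = "?x \<oplus>\<^bsub>Q (Suc n)\<^esub> \<phi> (Suc n) y"
  note fx = fstK[OF x] and py = hom_closed[OF \<phi>1 y(1)]
  have w: "?w \<in> carrier (Q (Suc n))" by (intro Q1.a_closed fx py)
  have "dB n ?w = dB n ?x \<oplus>\<^bsub>Q n\<^esub> \<phi> n (dA n y)" using hom_add[OF rB(2) fx py] \<phi>2[OF y(1)] by simp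
  then have "dB n ?w = \<zero>\<^bsub>Q n\<^esub>" using z y(2) by simp
  then obtain q where q: "q \<in> carrier (Q (Suc (Suc n)))" "?w = dB (Suc n) q" using rB(8)[OF w] by blast
  let ?u = "pairp (b (Suc (Suc n))) (a (Suc n)) q (\<ominus>\<^bsub>P (Suc n)\<^esub> y)"
  have u: "?u \<in> carrier (K (Suc (Suc n)))" unfolding K_Suc by (intro pair_closed q(1) P1.a_inv_closed y(1))
  have u1: "fstp (b (Suc (Suc n))) ?u = q" by (rule fst_pair[OF q(1)])
  have u2: "sndp (b (Suc (Suc n))) (a (Suc n)) ?u = \<ominus>\<^bsub>P (Suc n)\<^esub> y"
    by (rule snd_pair[OF P1.a_inv_closed[OF y(1)]])
  have "D (Suc n) ?u = x"
  proof (rule pair_eqI[OF D_closed[OF u, unfolded K_Suc] x[unfolded K_Suc]])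
    show "fstp (b (Suc n)) (D (Suc n) ?u) = ?x"
      unfolding D_parts(1)[OF u] u1 u2 q(2)[symmetric] hom_neg[OF FM FM \<phi>1 y(1)]
      using fx py by (simp add: Q1.a_assoc Q1.r_neg)
    show "sndp (b (Suc n)) (a n) (D (Suc n) ?u) = sndp (b (Suc n)) (a n) x"
      unfolding D_parts_Suc[OF u] u2 y(2) hom_neg[OF FM FM rA(2) y(1)]
      using hom_closed[OF rA(2) y(1)] by simp
  qed
  then show ?thesis using u by (metis image_eqI)
qed

text \<open>In degree 0 the cone is \<open>Q 0\<close> alone, which leaves the cokernel of
  \<open>f\<close> as homology. Exactness in degree 1 rests on the injectivity of \<open>f\<close>,
  and in higher degrees it is inherited from the two resolutions.\<close>

lemma cone_resolution:
  fixes C :: "('a, 'k) module"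
  assumes A: "module R A" and B: "module R B" and C: "module R C"
    and f: "f \<in> module_hom R A B" and f_inj: "\<And>z. z \<in> carrier A \<Longrightarrow> f z = \<zero>\<^bsub>B\<^esub> \<Longrightarrow> z = \<zero>\<^bsub>A\<^esub>"
    and g: "g \<in> module_hom R B C" and g_surj: "g ` carrier B = carrier C"
    and exact: "\<And>x. x \<in> carrier B \<Longrightarrow> g x = \<zero>\<^bsub>C\<^esub> \<longleftrightarrow> x \<in> f ` carrier A"
    and aug: "\<And>x. x \<in> carrier (P 0) \<Longrightarrow> \<epsilon>B (\<phi> 0 x) = f (\<epsilon>A x)"
  shows "free_resolution R (cone_rank a b) D (\<lambda>x. g (\<epsilon>B (fstp (b 0) x))) C"
  unfolding resolution_def
proof (intro conjI allI)
  interpret A: Module.module R A by (rule A)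
  interpret B: Module.module R B by (rule B)
  interpret C: Module.module R C by (rule C)
  interpret Q0: Module.module R "Q 0" by (rule FM)
  have K0: "cone_rank a b 0 = b 0 + 0" by (simp add: cone_rank_def)
  have fst0: "fstp (b 0) x \<in> carrier (Q 0)" if "x \<in> carrier (K 0)" for x
    using that unfolding K0 by (rule fst_closed)
  let ?\<epsilon> = "\<lambda>x. g (\<epsilon>B (fstp (b 0) x))"
  show "module R (K i)" for i by (rule FM)
  show "D i \<in> module_hom R (K (Suc i)) (K i)" for i by (rule cone_diff_hom)
  show "?\<epsilon> \<in> module_hom R (K 0) C"
    unfolding K0 by (intro hom_comp[OF fstp_hom] hom_comp[OF rB(3) g])
  show "?\<epsilon> ` carrier (K 0) = carrier C"
  proof (intro equalityI subsetI)
    fix c assume "c \<in> ?\<epsilon> ` carrier (K 0)"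
    then show "c \<in> carrier C" using hom_closed[OF g] hom_closed[OF rB(3)] fst0 by auto
  next
    fix c assume "c \<in> carrier C"
    then obtain y where y: "y \<in> carrier B" "c = g y" unfolding g_surj[symmetric] by blast
    from y(1) obtain x where x: "x \<in> carrier (Q 0)" "y = \<epsilon>B x" unfolding rB(4)[symmetric] by blast
    let ?p = "pairp (b 0) 0 x \<zero>\<^bsub>free_module R 0\<^esub>"
    have z: "\<zero>\<^bsub>free_module R 0\<^esub> \<in> carrier (free_module R 0)" by (rule free_zero_closed)
    have "?p \<in> carrier (K 0)" unfolding K0 by (rule pair_closed[OF x(1) z])
    moreover have "c = ?\<epsilon> ?p" using fst_pair[OF x(1)] x(2) y(2) by simp
    ultimately show "c \<in> ?\<epsilon> ` carrier (K 0)" by (intro image_eqI[of c _ ?p])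
  qed
  show "D 0 ` carrier (K 1) = {x \<in> carrier (K 0). ?\<epsilon> x = \<zero>\<^bsub>C\<^esub>}"
  proof (intro equalityI subsetI)
    fix x assume "x \<in> D 0 ` carrier (K 1)"
    then obtain u where u: "u \<in> carrier (K (Suc 0))" "x = D 0 u" by auto
    note f1 = fstK[OF u(1)] and s1 = sndK[OF u(1)]
    have "\<epsilon>B (fstp (b 0) x) = \<epsilon>B (dB 0 (fstp (b (Suc 0)) u)) \<oplus>\<^bsub>B\<^esub> \<epsilon>B (\<phi> 0 (sndp (b (Suc 0)) (a 0) u))"
      unfolding u(2) D_parts(1)[OF u(1)]
      by (rule hom_add[OF rB(3) hom_closed[OF rB(2) f1] hom_closed[OF \<phi>1 s1]])
    also have "\<dots> = f (\<epsilon>A (sndp (b (Suc 0)) (a 0) u))"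
      using rB(5)[OF f1] aug[OF s1] hom_closed[OF f hom_closed[OF rA(3) s1]] by simp
    finally have e: "\<epsilon>B (fstp (b 0) x) = f (\<epsilon>A (sndp (b (Suc 0)) (a 0) u))" .
    have "?\<epsilon> x = \<zero>\<^bsub>C\<^esub>"
      unfolding e using exact hom_closed[OF f hom_closed[OF rA(3) s1]] hom_closed[OF rA(3) s1] by blast
    then show "x \<in> {x \<in> carrier (K 0). ?\<epsilon> x = \<zero>\<^bsub>C\<^esub>}" using D_closed[OF u(1)] u(2) by simp
  next
    fix x assume "x \<in> {x \<in> carrier (K 0). ?\<epsilon> x = \<zero>\<^bsub>C\<^esub>}"
    then have x: "x \<in> carrier (K 0)" "?\<epsilon> x = \<zero>\<^bsub>C\<^esub>" by auto
    note fx = fst0[OF x(1)]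
    have "\<epsilon>B (fstp (b 0) x) \<in> f ` carrier A" using exact[OF hom_closed[OF rB(3) fx]] x(2) by simp
    then obtain y where y: "y \<in> carrier A" "\<epsilon>B (fstp (b 0) x) = f y" by blast
    from y(1) obtain z where z: "z \<in> carrier (P 0)" "y = \<epsilon>A z" unfolding rA(4)[symmetric] by blast
    note pz = hom_closed[OF \<phi>1 z(1)]
    have c: "fstp (b 0) x \<ominus>\<^bsub>Q 0\<^esub> \<phi> 0 z \<in> carrier (Q 0)" by (intro Q0.minus_closed fx pz)
    have "\<epsilon>B (fstp (b 0) x \<ominus>\<^bsub>Q 0\<^esub> \<phi> 0 z) = f y \<ominus>\<^bsub>B\<^esub> f y"
      using hom_minus[OF FM B rB(3) fx pz] aug[OF z(1)] y(2) z(2) by simp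
    also have "\<dots> = \<zero>\<^bsub>B\<^esub>" using hom_closed[OF f y(1)] B.minus_eq_zero_iff by simp
    finally obtain q where q: "q \<in> carrier (Q (Suc 0))" "fstp (b 0) x \<ominus>\<^bsub>Q 0\<^esub> \<phi> 0 z = dB 0 q"
      using rB(7)[OF c] by blast
    let ?u = "pairp (b (Suc 0)) (a 0) q z"
    have u: "?u \<in> carrier (K (Suc 0))" unfolding K_Suc by (intro pair_closed q(1) z(1))
    have "D 0 ?u = x"
    proof (rule pair_eqI[OF D_closed[OF u, unfolded K0] x(1)[unfolded K0]])
      show "fstp (b 0) (D 0 ?u) = fstp (b 0) x"
        unfolding D_parts(1)[OF u] fst_pair[OF q(1)] snd_pair[OF z(1)] q(2)[symmetric]
        by (rule Q0.minus_plus_cancel[OF fx pz])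
      have "sndp (b 0) 0 y = \<zero>\<^bsub>free_module R 0\<^esub>" if "y \<in> carrier (free_module R (b 0 + 0))" for y
        by (rule free_0[OF snd_closed[OF that]])
      then show "sndp (b 0) 0 (D 0 ?u) = sndp (b 0) 0 x"
        using D_closed[OF u, unfolded K0] x(1)[unfolded K0] by simp
    qed
    then show "x \<in> D 0 ` carrier (K 1)" using u by (metis One_nat_def image_eqI)
  qed
  fix n
  show "D (Suc n) ` carrier (K (Suc (Suc n))) = {x \<in> carrier (K (Suc n)). D n x = \<zero>\<^bsub>K n\<^esub>}"
  proof (intro equalityI subsetI)
    interpret Qn: Module.module R "Q n" by (rule FM)
    interpret P'n: Module.module R "P' n" by (rule FM)
    fix x assume "x \<in> D (Suc n) ` carrier (K (Suc (Suc n)))"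
    then obtain u where u: "u \<in> carrier (K (Suc (Suc n)))" "x = D (Suc n) u" by auto
    let ?s = "sndp (b (Suc (Suc n))) (a (Suc n)) u"
    note f1 = fstK[OF u(1)] and s1 = sndK[OF u(1)]
    note ds = hom_closed[OF rA(2) s1]
    have x: "x \<in> carrier (K (Suc n))" using D_closed[OF u(1)] u(2) by simp
    have "fstp (b n) (D n x) = dB n (dB (Suc n) (fstp (b (Suc (Suc n))) u) \<oplus>\<^bsub>Q (Suc n)\<^esub> \<phi> (Suc n) ?s)
        \<oplus>\<^bsub>Q n\<^esub> \<phi> n (\<ominus>\<^bsub>P n\<^esub> dA n ?s)"
      unfolding D_parts(1)[OF x] unfolding u(2) D_parts(1)[OF u(1)] D_parts_Suc[OF u(1)] ..
    also have "\<dots> = \<zero>\<^bsub>Q n\<^esub>"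
      unfolding hom_add[OF rB(2) hom_closed[OF rB(2) f1] hom_closed[OF \<phi>1 s1]] rB(6)[OF f1] \<phi>2[OF s1]
        hom_neg[OF FM FM \<phi>1 ds]
      using hom_closed[OF \<phi>1 ds] by (simp add: Qn.r_neg)
    finally have 1: "fstp (b n) (D n x) = \<zero>\<^bsub>Q n\<^esub>" .
    have "sndp (b n) (shift_rank a n) (D n x) = \<ominus>\<^bsub>P' n\<^esub> d' n (\<ominus>\<^bsub>P n\<^esub> dA n ?s)"
      unfolding D_parts(2)[OF x] unfolding u(2) D_parts_Suc[OF u(1)] ..
    also have "\<dots> = \<zero>\<^bsub>P' n\<^esub>" unfolding hom_neg[OF FM FM d'_hom ds] d'_d[OF s1] by simp
    finally have 2: "sndp (b n) (shift_rank a n) (D n x) = \<zero>\<^bsub>P' n\<^esub>" .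
    have z: "\<zero>\<^bsub>K n\<^esub> \<in> carrier (free_module R (b n + shift_rank a n))"
      unfolding cone_rank_def by (rule free_zero_closed)
    have "D n x = \<zero>\<^bsub>K n\<^esub>"
      by (rule pair_eqI[OF D_closed[OF x, unfolded cone_rank_def] z])
        (simp_all add: 1 2 cone_rank_def hom_zero[OF FM FM fstp_hom] hom_zero[OF FM FM sndp_hom])
    then show "x \<in> {x \<in> carrier (K (Suc n)). D n x = \<zero>\<^bsub>K n\<^esub>}" using x by simp
  next
    interpret P'n: Module.module R "P' n" by (rule FM)
    fix x assume "x \<in> {x \<in> carrier (K (Suc n)). D n x = \<zero>\<^bsub>K n\<^esub>}"
    then have x: "x \<in> carrier (K (Suc n))" "D n x = \<zero>\<^bsub>K n\<^esub>" by auto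
    let ?f = "fstp (b (Suc n)) x" and ?s = "sndp (b (Suc n)) (a n) x"
    note fx = fstK[OF x(1)] and sx = sndK[OF x(1)]
    have 1: "dB n ?f \<oplus>\<^bsub>Q n\<^esub> \<phi> n ?s = \<zero>\<^bsub>Q n\<^esub>"
      unfolding D_parts(1)[OF x(1), symmetric] x(2) cone_rank_def by (rule hom_zero[OF FM FM fstp_hom])
    have "\<ominus>\<^bsub>P' n\<^esub> d' n ?s = \<zero>\<^bsub>P' n\<^esub>"
      unfolding D_parts(2)[OF x(1), symmetric] x(2) cone_rank_def by (rule hom_zero[OF FM FM sndp_hom])
    then have 2: "d' n ?s = \<zero>\<^bsub>P' n\<^esub>"
      using hom_closed[OF d'_hom sx] P'n.minus_minus P'n.neg_zero by metis
    have "?s \<in> dA n ` carrier (P (Suc n))"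
    proof (cases n)
      case (Suc m)
      then show ?thesis using rA(8)[of ?s m] 2 sx by simp
    next
      \<comment> \<open>Here \<open>d'\<close> maps to R^0 and carries no information. Instead the
        first component, after augmentation, shows that f maps \<epsilon>A of the second one to
        zero, and f is injective.\<close>
      case 0
      have s0: "?s \<in> carrier (P 0)" and f0: "?f \<in> carrier (Q (Suc 0))" using sx fx 0 by simp_all
      have "\<epsilon>B (dB 0 ?f \<oplus>\<^bsub>Q 0\<^esub> \<phi> 0 ?s) = \<epsilon>B (dB 0 ?f) \<oplus>\<^bsub>B\<^esub> \<epsilon>B (\<phi> 0 ?s)"
        by (rule hom_add[OF rB(3) hom_closed[OF rB(2) f0] hom_closed[OF \<phi>1 s0]])
      then have "f (\<epsilon>A ?s) = \<zero>\<^bsub>B\<^esub>"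
        using 1 0 rB(5)[OF f0] aug[OF s0] hom_zero[OF FM B rB(3)] hom_closed[OF f hom_closed[OF rA(3) s0]] by simp
      then have "\<epsilon>A ?s = \<zero>\<^bsub>A\<^esub>" by (rule f_inj[OF hom_closed[OF rA(3) s0]])
      then show ?thesis using rA(7)[OF s0] 0 by simp
    qed
    then obtain y where "y \<in> carrier (P (Suc n))" "?s = dA n y" by blast
    then show "x \<in> D (Suc n) ` carrier (K (Suc (Suc n)))" using cone_exact[OF x(1) _ _ 1] by blast
  qed
qed

section \<open>Short exact sequences in the first argument, read off the cone\<close>

context
  fixes N :: "('a, 'l) module"
  assumes N: "module R N"
begin

interpretation N: Module.module R N by (rule N)

private lemma cochain_hom:
  assumes v: "v \<in> module_hom R (Q n) N" and u: "u \<in> module_hom R (P' n) N"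
  shows "(\<lambda>x. v (fstp (b n) x) \<oplus>\<^bsub>N\<^esub> u (sndp (b n) (shift_rank a n) x)) \<in> module_hom R (K n) N"
  unfolding cone_rank_def by (intro hom_plus N hom_comp[OF fstp_hom v] hom_comp[OF sndp_hom u])

text \<open>In terms of pairs of cochains, the codifferential of the cone sends (v, u) to (v dB, v
  \<phi> - u d').\<close>

private lemma cochain_D:
  assumes v: "v \<in> module_hom R (Q n) N" and u: "u \<in> module_hom R (P' n) N" and x: "x \<in> carrier (K (Suc n))"
  shows "v (fstp (b n) (D n x)) \<oplus>\<^bsub>N\<^esub> u (sndp (b n) (shift_rank a n) (D n x)) =
    v (dB n (fstp (b (Suc n)) x)) \<oplus>\<^bsub>N\<^esub>
      (v (\<phi> n (sndp (b (Suc n)) (a n) x)) \<ominus>\<^bsub>N\<^esub> u (d' n (sndp (b (Suc n)) (a n) x)))"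
proof -
  note fx = fstK[OF x] and sx = sndK[OF x]
  note c = hom_closed[OF rB(2) fx] hom_closed[OF \<phi>1 sx] hom_closed[OF d'_hom sx]
  show ?thesis
    unfolding D_parts[OF x] hom_add[OF v c(1,2)] hom_neg[OF FM N u c(3)]
    using hom_closed[OF v c(1)] hom_closed[OF v c(2)] hom_closed[OF u c(3)]
    by (simp add: N.minus_eq N.a_assoc)
qed

private abbreviation "inl n y \<equiv> pairp (b n) (shift_rank a n) y \<zero>\<^bsub>P' n\<^esub>"
private abbreviation "inr n z \<equiv> pairp (b n) (shift_rank a n) \<zero>\<^bsub>Q n\<^esub> z"

private lemmas zero_in = free_zero_closed

private lemma inl_hom: "(\<lambda>y. inl n y) \<in> module_hom R (Q n) (K n)"
  unfolding cone_rank_def by (intro pairp_hom FM hom_id hom_const_zero)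

private lemma inr_hom: "(\<lambda>z. inr n z) \<in> module_hom R (P' n) (K n)"
  unfolding cone_rank_def by (intro pairp_hom FM hom_id hom_const_zero)

private lemma cochain_split:
  assumes h: "h \<in> module_hom R (K n) N" and x: "x \<in> carrier (K n)"
  shows "h x = h (inl n (fstp (b n) x)) \<oplus>\<^bsub>N\<^esub> h (inr n (sndp (b n) (shift_rank a n) x))"
proof -
  let ?f = "fstp (b n) x" and ?s = "sndp (b n) (shift_rank a n) x"
  interpret Q: Module.module R "Q n" by (rule FM)
  interpret P': Module.module R "P' n" by (rule FM)
  interpret KK: Module.module R "K n" by (rule FM)
  note x' = x[unfolded cone_rank_def]
  note fx = fst_closed[OF x'] and sx = snd_closed[OF x']
  note cl = hom_closed[OF inl_hom fx] and cr = hom_closed[OF inr_hom sx]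
  have K: "free_module R (b n + shift_rank a n) = K n" by (simp add: cone_rank_def)
  have c: "inl n ?f \<oplus>\<^bsub>K n\<^esub> inr n ?s \<in> carrier (free_module R (b n + shift_rank a n))"
    unfolding K by (rule KK.a_closed[OF cl cr])
  have "x = inl n ?f \<oplus>\<^bsub>K n\<^esub> inr n ?s"
  proof (rule pair_eqI[OF x' c])
    show "fstp (b n) x = fstp (b n) (inl n ?f \<oplus>\<^bsub>K n\<^esub> inr n ?s)"
      unfolding cone_rank_def hom_add[OF fstp_hom cl[unfolded cone_rank_def] cr[unfolded cone_rank_def]]
        fst_pair[OF fx] fst_pair[OF zero_in] using fx by simp
    show "sndp (b n) (shift_rank a n) x = sndp (b n) (shift_rank a n) (inl n ?f \<oplus>\<^bsub>K n\<^esub> inr n ?s)"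
      unfolding cone_rank_def hom_add[OF sndp_hom cl[unfolded cone_rank_def] cr[unfolded cone_rank_def]]
        snd_pair[OF sx] snd_pair[OF zero_in] using sx by simp
  qed
  then show ?thesis using hom_add[OF h cl cr] by simp
qed

private lemma D_inl:
  assumes y: "y \<in> carrier (Q (Suc n))"
  shows "D n (inl (Suc n) y) = inl n (dB n y)"
proof -
  interpret Q: Module.module R "Q n" by (rule FM)
  interpret P': Module.module R "P' n" by (rule FM)
  have z: "\<zero>\<^bsub>P' (Suc n)\<^esub> \<in> carrier (free_module R (a n))" using zero_in by simp
  show ?thesis
    unfolding cone_diff_def fst_pair[OF y] using snd_pair[OF z, of "b (Suc n)" y]
      hom_zero[OF FM FM \<phi>1] hom_zero[OF FM FM d'_hom] hom_closed[OF rB(2) y]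
    by (simp add: P'.neg_zero)
qed

private lemma D_inr:
  assumes z: "z \<in> carrier (P n)" and h: "h \<in> module_hom R (K n) N"
  shows "h (D n (inr (Suc n) z)) = h (inl n (\<phi> n z)) \<ominus>\<^bsub>N\<^esub> h (inr n (d' n z))"
proof -
  interpret Q: Module.module R "Q n" by (rule FM)
  interpret P': Module.module R "P' n" by (rule FM)
  note dz = hom_closed[OF d'_hom z] and pz = hom_closed[OF \<phi>1 z]
  have z0: "\<zero>\<^bsub>Q (Suc n)\<^esub> \<in> carrier (Q (Suc n))" by (rule zero_in)
  have iz: "inr (Suc n) z \<in> carrier (K (Suc n))" using hom_closed[OF inr_hom, of z "Suc n"] z by simp
  have f: "fstp (b n) (D n (inr (Suc n) z)) = \<phi> n z"
    unfolding D_parts(1)[OF iz] fst_pair[OF z0] using snd_pair[OF z, of "b (Suc n)"] pz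
    by (simp add: hom_zero[OF FM FM rB(2)])
  have s: "sndp (b n) (shift_rank a n) (D n (inr (Suc n) z)) = \<ominus>\<^bsub>P' n\<^esub> d' n z"
    unfolding D_parts(2)[OF iz] using snd_pair[OF z, of "b (Suc n)"] by simp
  have "h (inr n (\<ominus>\<^bsub>P' n\<^esub> d' n z)) = \<ominus>\<^bsub>N\<^esub> h (inr n (d' n z))"
    by (rule hom_neg[OF FM N hom_comp[OF inr_hom h] dz])
  then show ?thesis
    unfolding cochain_split[OF h D_closed[OF iz]] f s by (simp add: N.minus_eq)
qed

text \<open>Exactness of H^n(C) -> H^n(B) -> H^n(A), with C the cone: f \<phi> is a coboundary w d',
  which is just what makes (f, w) a cocycle of the cone. A primitive of (f, w) restricts to a
  primitive of f.\<close>

lemma cone_acyclic_target: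
  assumes VC: "acyclic_at R (cone_rank a b) D N n" and VA: "acyclic_at R a dA N n"
  shows "acyclic_at R b dB N n"
  unfolding acyclic_at_def
proof (intro allI impI)
  fix f assume f: "cocycle R b dB N n f"
  then have f1: "f \<in> module_hom R (Q n) N"
    and f2: "\<And>y. y \<in> carrier (Q (Suc n)) \<Longrightarrow> f (dB n y) = \<zero>\<^bsub>N\<^esub>" by (auto simp: cocycle_def)
  have "cobdry R a dA N n (\<lambda>x. f (\<phi> n x))"
    using VA cocycle_chain_map[OF \<phi> f] by (simp add: acyclic_at_def)
  \<comment> \<open>Writing \<open>d'\<close> unites the two cases: in degree 0, where f \<phi>
    itself is zero, w = 0 serves.\<close>
  then have "\<exists>w\<in>module_hom R (P' n) N. \<forall>z\<in>carrier (P n). f (\<phi> n z) = w (d' n z)"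
  proof (cases n)
    case 0
    then show "cobdry R a dA N n (\<lambda>x. f (\<phi> n x)) \<Longrightarrow> ?thesis"
      by (intro bexI[OF _ hom_const_zero[OF N]]) (simp add: cobdry_0)
  qed (simp add: cobdry_Suc)
  then obtain w where w: "w \<in> module_hom R (P' n) N" "\<And>z. z \<in> carrier (P n) \<Longrightarrow> f (\<phi> n z) = w (d' n z)"
    by blast
  let ?h = "\<lambda>x. f (fstp (b n) x) \<oplus>\<^bsub>N\<^esub> w (sndp (b n) (shift_rank a n) x)"
  have "cocycle R (cone_rank a b) D N n ?h"
    unfolding cocycle_def
  proof (intro conjI ballI)
    show "?h \<in> module_hom R (K n) N" by (rule cochain_hom[OF f1 w(1)])
    fix x assume x: "x \<in> carrier (K (Suc n))"
    note c = hom_closed[OF w(1) hom_closed[OF d'_hom sndK[OF x]]]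
    show "?h (D n x) = \<zero>\<^bsub>N\<^esub>"
      unfolding cochain_D[OF f1 w(1) x] f2[OF fstK[OF x]] w(2)[OF sndK[OF x]]
      using c N.minus_eq_zero_iff[OF c c] by simp
  qed
  then have cob: "cobdry R (cone_rank a b) D N n ?h" using VC by (simp add: acyclic_at_def)
  have fl: "?h (inl n y) = f y" if y: "y \<in> carrier (Q n)" for y
    unfolding fst_pair[OF y] snd_pair[OF zero_in] hom_zero[OF FM N w(1)] using hom_closed[OF f1 y] by simp
  show "cobdry R b dB N n f"
  proof (cases n)
    case 0
    have "f y = \<zero>\<^bsub>N\<^esub>" if y: "y \<in> carrier (Q 0)" for y
      using cob fl[of y] hom_closed[OF inl_hom, of y 0] y unfolding 0 cobdry_0 by simp
    then show ?thesis unfolding 0 cobdry_0 by blast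
  next
    case (Suc m)
    obtain h' where h': "h' \<in> module_hom R (K m) N" "\<And>x. x \<in> carrier (K n) \<Longrightarrow> ?h x = h' (D m x)"
      using cob unfolding Suc cobdry_Suc by blast
    have "f y = h' (inl m (dB m y))" if y: "y \<in> carrier (Q (Suc m))" for y
    proof -
      have y': "y \<in> carrier (Q n)" using y Suc by simp
      have "f y = h' (D m (inl n y))" using fl[OF y'] h'(2)[OF hom_closed[OF inl_hom y']] by simp
      also have "D m (inl n y) = inl m (dB m y)" unfolding Suc by (rule D_inl[OF y])
      finally show ?thesis .
    qed
    then show ?thesis unfolding Suc cobdry_Suc by (intro bexI[OF _ hom_comp[OF inl_hom h'(1)]]) blast
  qed
qed

text \<open>Exactness of H^n(B) -> H^n(A) -> H^(n+1)(C): the pair (0, u) is a cocycle of the cone in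
  degree n + 1. A primitive (v, s) of it satisfies u = v \<phi> - s d' with v a cocycle on B; v is a
  coboundary by hypothesis, and so u is one.\<close>

lemma cone_acyclic_source:
  assumes VB: "acyclic_at R b dB N n" and VC: "acyclic_at R (cone_rank a b) D N (Suc n)"
  shows "acyclic_at R a dA N n"
  unfolding acyclic_at_def
proof (intro allI impI)
  fix u assume u: "cocycle R a dA N n u"
  then have u1: "u \<in> module_hom R (P' (Suc n)) N" and u1': "u \<in> module_hom R (P n) N"
    and u2: "\<And>z. z \<in> carrier (P (Suc n)) \<Longrightarrow> u (dA n z) = \<zero>\<^bsub>N\<^esub>" by (auto simp: cocycle_def)
  let ?h = "\<lambda>x. \<zero>\<^bsub>N\<^esub> \<oplus>\<^bsub>N\<^esub> u (sndp (b (Suc n)) (shift_rank a (Suc n)) x)"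
  have z: "(\<lambda>x. \<zero>\<^bsub>N\<^esub>) \<in> module_hom R (Q (Suc n)) N" by (rule hom_const_zero[OF N])
  have "cocycle R (cone_rank a b) D N (Suc n) ?h"
    unfolding cocycle_def
  proof (intro conjI ballI)
    show "?h \<in> module_hom R (K (Suc n)) N" by (rule cochain_hom[OF z u1])
    fix x assume x: "x \<in> carrier (K (Suc (Suc n)))"
    show "?h (D (Suc n) x) = \<zero>\<^bsub>N\<^esub>"
      unfolding cochain_D[OF z u1 x] using u2[OF sndK[OF x]] by (simp add: N.minus_eq)
  qed
  then have "cobdry R (cone_rank a b) D N (Suc n) ?h" using VC by (simp add: acyclic_at_def)
  then obtain h' where h': "h' \<in> module_hom R (K n) N" "\<And>x. x \<in> carrier (K (Suc n)) \<Longrightarrow> ?h x = h' (D n x)"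
    unfolding cobdry_Suc by blast
  have uz: "u z = h' (inl n (\<phi> n z)) \<ominus>\<^bsub>N\<^esub> h' (inr n (d' n z))" if z: "z \<in> carrier (P n)" for z
  proof -
    have z': "z \<in> carrier (P' (Suc n))" using z by simp
    have "u z = ?h (inr (Suc n) z)" unfolding snd_pair[OF z'] using hom_closed[OF u1' z] by simp
    also have "\<dots> = h' (D n (inr (Suc n) z))" by (rule h'(2)[OF hom_closed[OF inr_hom z']])
    also have "\<dots> = h' (inl n (\<phi> n z)) \<ominus>\<^bsub>N\<^esub> h' (inr n (d' n z))" by (rule D_inr[OF z h'(1)])
    finally show ?thesis .
  qed
  have "h' (inl n (dB n y)) = \<zero>\<^bsub>N\<^esub>" if y: "y \<in> carrier (Q (Suc n))" for y
    using h'(2)[OF hom_closed[OF inl_hom y]] unfolding D_inl[OF y] snd_pair[OF zero_in] hom_zero[OF FM N u1] by simp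
  then have "cocycle R b dB N n (\<lambda>y. h' (inl n y))" using hom_comp[OF inl_hom h'(1)] by (simp add: cocycle_def)
  then have cob: "cobdry R b dB N n (\<lambda>y. h' (inl n y))" using VB by (simp add: acyclic_at_def)
  show "cobdry R a dA N n u"
  proof (cases n)
    case 0
    have "u z = \<zero>\<^bsub>N\<^esub>" if z: "z \<in> carrier (P 0)" for z
    proof -
      have "h' (inl 0 (\<phi> 0 z)) = \<zero>\<^bsub>N\<^esub>" using cob hom_closed[OF \<phi>1 z] unfolding 0 cobdry_0 by blast
      moreover have "h' (inr 0 \<zero>\<^bsub>P' 0\<^esub>) = \<zero>\<^bsub>N\<^esub>" using hom_zero[OF FM N hom_comp[OF inr_hom h'(1)]] 0 by simp
      ultimately show ?thesis using uz[of z] z 0 by (simp add: N.minus_eq)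
    qed
    then show ?thesis unfolding 0 cobdry_0 by blast
  next
    case (Suc m)
    obtain w where w: "w \<in> module_hom R (Q m) N" "\<And>y. y \<in> carrier (Q (Suc m)) \<Longrightarrow> h' (inl n y) = w (dB m y)"
      using cob unfolding Suc cobdry_Suc by blast
    have ir: "(\<lambda>z. h' (inr n z)) \<in> module_hom R (P m) N" using hom_comp[OF inr_hom h'(1)] Suc by simp
    have "u z = w (\<phi> m (dA m z)) \<ominus>\<^bsub>N\<^esub> h' (inr n (dA m z))" if z: "z \<in> carrier (P (Suc m))" for z
      using uz[of z] z w(2)[OF hom_closed[OF \<phi>1 z]] \<phi>2[OF z] Suc by simp
    then show ?thesis unfolding Suc cobdry_Suc
      by (intro bexI[OF _ hom_diff[OF N hom_comp[OF \<phi>1 w(1)] ir[unfolded Suc]]]) blast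
  qed
qed

text \<open>Exactness of H^n(A) -> H^(n+1)(C) -> H^(n+1)(B): for a cocycle (v, u) write v = w dB.
  Then w \<phi> - u is a cocycle on A, hence some s d', and (w, s) is a primitive of (v, u).\<close>

lemma cone_acyclic_Suc:
  assumes VB: "acyclic_at R b dB N (Suc n)" and VA: "acyclic_at R a dA N n"
  shows "acyclic_at R (cone_rank a b) D N (Suc n)"
  unfolding acyclic_at_def
proof (intro allI impI)
  fix h assume "cocycle R (cone_rank a b) D N (Suc n) h"
  then have h: "h \<in> module_hom R (K (Suc n)) N"
    "\<And>x. x \<in> carrier (K (Suc (Suc n))) \<Longrightarrow> h (D (Suc n) x) = \<zero>\<^bsub>N\<^esub>" by (auto simp: cocycle_def)
  let ?v = "\<lambda>y. h (inl (Suc n) y)" and ?u = "\<lambda>z. h (inr (Suc n) z)"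
  have v: "?v \<in> module_hom R (Q (Suc n)) N" by (rule hom_comp[OF inl_hom h(1)])
  have u: "?u \<in> module_hom R (P n) N" using hom_comp[OF inr_hom h(1)] by simp
  have "?v (dB (Suc n) y) = \<zero>\<^bsub>N\<^esub>" if y: "y \<in> carrier (Q (Suc (Suc n)))" for y
    using h(2)[OF hom_closed[OF inl_hom y]] unfolding D_inl[OF y] .
  then have "cocycle R b dB N (Suc n) ?v" using v by (simp add: cocycle_def)
  then have "cobdry R b dB N (Suc n) ?v" using VB by (simp add: acyclic_at_def)
  then obtain w where w: "w \<in> module_hom R (Q n) N" "\<And>y. y \<in> carrier (Q (Suc n)) \<Longrightarrow> ?v y = w (dB n y)"
    unfolding cobdry_Suc by blast
  let ?t = "\<lambda>z. w (\<phi> n z) \<ominus>\<^bsub>N\<^esub> ?u z"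
  have t: "?t \<in> module_hom R (P n) N" by (rule hom_diff[OF N hom_comp[OF \<phi>1 w(1)] u])
  have "?t (dA n z) = \<zero>\<^bsub>N\<^esub>" if z: "z \<in> carrier (P (Suc n))" for z
  proof -
    have z': "z \<in> carrier (P' (Suc (Suc n)))" using z by simp
    have "?v (\<phi> (Suc n) z) \<ominus>\<^bsub>N\<^esub> ?u (d' (Suc n) z) = \<zero>\<^bsub>N\<^esub>"
      using D_inr[OF z h(1)] h(2)[OF hom_closed[OF inr_hom z']] by simp
    moreover have "?v (\<phi> (Suc n) z) = w (\<phi> n (dA n z))"
      using w(2)[OF hom_closed[OF \<phi>1 z]] \<phi>2[OF z] by simp
    ultimately show ?thesis by simp
  qed
  then have "cocycle R a dA N n ?t" using t by (simp add: cocycle_def)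
  then have "cobdry R a dA N n ?t" using VA by (simp add: acyclic_at_def)
  then have "\<exists>s\<in>module_hom R (P' n) N. \<forall>z\<in>carrier (P n). ?t z = s (d' n z)"
  proof (cases n)
    case 0
    then show "cobdry R a dA N n ?t \<Longrightarrow> ?thesis"
      by (intro bexI[OF _ hom_const_zero[OF N]]) (simp add: cobdry_0)
  qed (simp add: cobdry_Suc)
  then obtain s where s: "s \<in> module_hom R (P' n) N" "\<And>z. z \<in> carrier (P n) \<Longrightarrow> ?t z = s (d' n z)" by blast
  let ?h = "\<lambda>x. w (fstp (b n) x) \<oplus>\<^bsub>N\<^esub> s (sndp (b n) (shift_rank a n) x)"
  have "h x = ?h (D n x)" if x: "x \<in> carrier (K (Suc n))" for x
  proof -
    note fx = fstK[OF x] and sx = sndK[OF x]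
    let ?z = "sndp (b (Suc n)) (a n) x"
    note c1 = hom_closed[OF w(1) hom_closed[OF \<phi>1 sx]] and c2 = hom_closed[OF u sx]
    have "w (\<phi> n ?z) \<ominus>\<^bsub>N\<^esub> s (d' n ?z) = ?u ?z"
      unfolding s(2)[OF sx, symmetric] using c1 c2
      by (simp add: N.minus_eq N.minus_add N.r_neg1 N.r_neg2)
    then have "?h (D n x) = w (dB n (fstp (b (Suc n)) x)) \<oplus>\<^bsub>N\<^esub> ?u ?z" unfolding cochain_D[OF w(1) s(1) x] by simp
    also have "\<dots> = ?v (fstp (b (Suc n)) x) \<oplus>\<^bsub>N\<^esub> ?u ?z" unfolding w(2)[OF fx] ..
    also have "\<dots> = h x" using cochain_split[OF h(1) x] by simp
    finally show ?thesis ..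
  qed
  then show "cobdry R (cone_rank a b) D N (Suc n) h"
    unfolding cobdry_Suc by (intro bexI[OF _ cochain_hom[OF w(1) s(1)]]) blast
qed

end

end

end

section \<open>The module structure of Ext\<close>

lemma hom_module_simps:
  "carrier (hom_module R M N) = module_hom R M N \<inter> extensional (carrier M)"
  "f \<oplus>\<^bsub>hom_module R M N\<^esub> g = (\<lambda>x\<in>carrier M. f x \<oplus>\<^bsub>N\<^esub> g x)"
  "r \<odot>\<^bsub>hom_module R M N\<^esub> f = (\<lambda>x\<in>carrier M. r \<odot>\<^bsub>N\<^esub> f x)"
  "\<zero>\<^bsub>hom_module R M N\<^esub> = (\<lambda>x\<in>carrier M. \<zero>\<^bsub>N\<^esub>)"
  by (simp_all add: hom_module_def)

lemma restrict_hom_module: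
  "module R M \<Longrightarrow> f \<in> module_hom R M N \<Longrightarrow> restrict f (carrier M) \<in> carrier (hom_module R M N)"
  unfolding hom_module_simps by (intro IntI restrict_extensional) (rule hom_cong, auto)

lemma hom_module_eqI:
  assumes "f \<in> carrier (hom_module R M N)" "g \<in> carrier (hom_module R M N)"
    "\<And>x. x \<in> carrier M \<Longrightarrow> f x = g x"
  shows "f = g"
  using assms by (intro extensionalityI[of f "carrier M" g]) (auto simp: hom_module_simps)

lemma hom_module_module:
  fixes M :: "('a, 'm) module" and N :: "('a, 'n) module"
  assumes M: "module R M" and N: "module R N"
  shows "module R (hom_module R M N)"
proof (rule module_criteria)
  interpret N: Module.module R N by fact
  interpret M: Module.module R M by fact
  show "cring R" by (rule N.is_cring)
  let ?H = "hom_module R M N"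
  have H: "f \<in> module_hom R M N" if "f \<in> carrier ?H" for f using that by (simp add: hom_module_simps)
  have c: "f x \<in> carrier N" if "f \<in> carrier ?H" "x \<in> carrier M" for f x
    using hom_closed[OF H[OF that(1)] that(2)] .
  have res: "restrict f (carrier M) = f" if "f \<in> carrier ?H" for f
    using that by (simp add: hom_module_simps extensional_restrict)
  show "\<zero>\<^bsub>?H\<^esub> \<in> carrier ?H"
    unfolding hom_module_simps(4) by (intro restrict_hom_module M hom_const_zero N)
  show "\<forall>v w. v \<in> carrier ?H \<and> w \<in> carrier ?H \<longrightarrow> v \<oplus>\<^bsub>?H\<^esub> w \<in> carrier ?H"
    unfolding hom_module_simps(2) by (intro allI impI restrict_hom_module M hom_plus N H) auto
  show "\<forall>c v. c \<in> carrier R \<and> v \<in> carrier ?H \<longrightarrow> c \<odot>\<^bsub>?H\<^esub> v \<in> carrier ?H"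
    unfolding hom_module_simps(3) by (intro allI impI restrict_hom_module M hom_scale N H) auto
  show "\<forall>v\<in>carrier ?H. \<exists>neg_v\<in>carrier ?H. v \<oplus>\<^bsub>?H\<^esub> neg_v = \<zero>\<^bsub>?H\<^esub>"
  proof
    fix v assume v: "v \<in> carrier ?H"
    show "\<exists>neg_v\<in>carrier ?H. v \<oplus>\<^bsub>?H\<^esub> neg_v = \<zero>\<^bsub>?H\<^esub>"
      by (rule bexI[OF _ restrict_hom_module[OF M hom_uminus[OF N H[OF v]]]])
        (auto simp: hom_module_simps(2,4) c[OF v] N.r_neg intro!: restrict_ext)
  qed
  show "\<forall>v\<in>carrier ?H. v \<oplus>\<^bsub>?H\<^esub> \<zero>\<^bsub>?H\<^esub> = v"
  proof
    fix v assume v: "v \<in> carrier ?H"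
    have "v \<oplus>\<^bsub>?H\<^esub> \<zero>\<^bsub>?H\<^esub> = restrict v (carrier M)"
      unfolding hom_module_simps(2,4) by (rule restrict_ext) (simp add: c[OF v])
    then show "v \<oplus>\<^bsub>?H\<^esub> \<zero>\<^bsub>?H\<^esub> = v" using res[OF v] by simp
  qed
  show "\<forall>v\<in>carrier ?H. \<one>\<^bsub>R\<^esub> \<odot>\<^bsub>?H\<^esub> v = v"
  proof
    fix v assume v: "v \<in> carrier ?H"
    have "\<one>\<^bsub>R\<^esub> \<odot>\<^bsub>?H\<^esub> v = restrict v (carrier M)"
      unfolding hom_module_simps(3) by (rule restrict_ext) (simp add: c[OF v])
    then show "\<one>\<^bsub>R\<^esub> \<odot>\<^bsub>?H\<^esub> v = v" using res[OF v] by simp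
  qed
qed (auto simp: hom_module_simps(2,3) hom_module_simps(1) hom_closed module.smult_l_distr[OF N]
    module.smult_r_distr[OF N] module.smult_assoc1[OF N] abelian_monoid.a_assoc[OF abelian_group.axioms(1)[OF module.axioms(2)[OF N]]]
    abelian_monoid.a_comm[OF abelian_group.axioms(1)[OF module.axioms(2)[OF N]]] intro!: restrict_ext)

context cring
begin

lemma ext_cocycles_iff:
  "f \<in> ext_cocycles R X Y n \<longleftrightarrow> f \<in> extensional (carrier (res_module R X n)) \<and>
    cocycle R (fst (min_res R X)) (snd (min_res R X)) Y n f"
  by (auto simp: ext_cocycles_def hom_module_simps cocycle_def res_module_def res_diff_def)

lemma ext_coboundaries_iff:
  fixes X :: "('a, 'm) module" and Y :: "('a, 'n) module"
  assumes Y: "module R Y"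
    and d: "\<And>i. snd (min_res R X) i \<in> module_hom R (res_module R X (Suc i)) (res_module R X i)"
  shows "f \<in> ext_coboundaries R X Y n \<longleftrightarrow> f \<in> carrier (hom_module R (res_module R X n) Y) \<and>
    cobdry R (fst (min_res R X)) (snd (min_res R X)) Y n f"
proof (cases n)
  case 0
  have M: "module R (res_module R X 0)" by (simp add: res_module_def free_module_module)
  have z: "\<zero>\<^bsub>hom_module R (res_module R X 0) Y\<^esub> \<in> carrier (hom_module R (res_module R X 0) Y)"
    unfolding hom_module_simps(4) by (intro restrict_hom_module hom_const_zero Y M)
  have "f = \<zero>\<^bsub>hom_module R (res_module R X 0) Y\<^esub> \<longleftrightarrow> f \<in> carrier (hom_module R (res_module R X 0) Y) \<and>
      (\<forall>x\<in>carrier (res_module R X 0). f x = \<zero>\<^bsub>Y\<^esub>)"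
  proof (intro iffI conjI ballI)
    assume "f \<in> carrier (hom_module R (res_module R X 0) Y) \<and> (\<forall>x\<in>carrier (res_module R X 0). f x = \<zero>\<^bsub>Y\<^esub>)"
    then show "f = \<zero>\<^bsub>hom_module R (res_module R X 0) Y\<^esub>"
      by (intro hom_module_eqI[OF _ z]) (auto simp: hom_module_simps(4))
  qed (use z in \<open>auto simp: hom_module_simps(4)\<close>)
  then show ?thesis by (simp add: 0 ext_coboundaries_def cobdry_0 res_module_def)
next
  case (Suc m)
  let ?P = "res_module R X"
  have M: "module R (?P i)" for i by (simp add: res_module_def free_module_module)
  let ?r = "\<lambda>g. \<lambda>x\<in>carrier (?P (Suc m)). g (snd (min_res R X) m x)"
  have r: "?r g \<in> carrier (hom_module R (?P (Suc m)) Y)" if "g \<in> module_hom R (?P m) Y" for g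
    by (rule restrict_hom_module[OF M hom_comp[OF d that]])
  have "f \<in> ?r ` carrier (hom_module R (?P m) Y) \<longleftrightarrow> f \<in> carrier (hom_module R (?P (Suc m)) Y) \<and>
      (\<exists>g\<in>module_hom R (?P m) Y. \<forall>x\<in>carrier (?P (Suc m)). f x = g (snd (min_res R X) m x))"
  proof (intro iffI conjI)
    assume "f \<in> ?r ` carrier (hom_module R (?P m) Y)"
    then obtain g where g: "g \<in> module_hom R (?P m) Y" "f = ?r g" by (auto simp: hom_module_simps)
    show "f \<in> carrier (hom_module R (?P (Suc m)) Y)" unfolding g(2) by (rule r[OF g(1)])
    show "\<exists>g\<in>module_hom R (?P m) Y. \<forall>x\<in>carrier (?P (Suc m)). f x = g (snd (min_res R X) m x)"
      using g by (intro bexI[OF _ g(1)]) simp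
  next
    assume "f \<in> carrier (hom_module R (?P (Suc m)) Y) \<and>
      (\<exists>g\<in>module_hom R (?P m) Y. \<forall>x\<in>carrier (?P (Suc m)). f x = g (snd (min_res R X) m x))"
    then obtain g where f: "f \<in> carrier (hom_module R (?P (Suc m)) Y)" and g: "g \<in> module_hom R (?P m) Y"
      "\<And>x. x \<in> carrier (?P (Suc m)) \<Longrightarrow> f x = g (snd (min_res R X) m x)" by blast
    let ?g = "restrict g (carrier (?P m))"
    have g': "?g \<in> carrier (hom_module R (?P m) Y)" by (rule restrict_hom_module[OF M g(1)])
    have "f = ?r ?g"
    proof (rule hom_module_eqI[OF f r])
      show "?g \<in> module_hom R (?P m) Y" using g' by (simp add: hom_module_simps)
      show "f x = ?r ?g x" if "x \<in> carrier (?P (Suc m))" for x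
        using g(2)[OF that] hom_closed[OF d that] that by simp
    qed
    then show "f \<in> ?r ` carrier (hom_module R (?P m) Y)" using g' by (rule image_eqI)
  qed
  then show ?thesis by (simp add: Suc ext_coboundaries_def cobdry_Suc res_module_def res_diff_def)
qed

lemma cobdry_scale:
  fixes N :: "('a, 'n) module"
  assumes N: "module R N" and r: "r \<in> carrier R" and f: "cobdry R b d N n f"
  shows "cobdry R b d N n (\<lambda>x. r \<odot>\<^bsub>N\<^esub> f x)"
  by (rule cobdry_comp[OF N N hom_scale[OF N hom_id r] f])

end

context noeth_local
begin

context
  fixes X :: "('a, 'm) module" and Y :: "('a, 'n) module" and b d \<epsilon>
  assumes Y: "module R Y"
    and bd: "b = fst (min_res R X)" "d = snd (min_res R X)"
    and res: "free_resolution R b d \<epsilon> X"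
begin

private abbreviation "PX \<equiv> res_module R X"
private abbreviation "HX n \<equiv> hom_module R (PX n) Y"

private lemma PX_eq: "PX n = free_module R (b n)"
  by (simp add: res_module_def bd)

private lemma d_hom: "snd (min_res R X) i \<in> module_hom R (PX (Suc i)) (PX i)"
  using resolutionD(2)[OF res, of i] by (simp add: PX_eq bd(2))

private lemma PX_module: "module R (PX n)"
  unfolding PX_eq by (rule free_module_module)

private lemma HX_module: "module R (HX n)"
  by (rule hom_module_module[OF PX_module Y])

lemma cobdry_imp_cocycle:
  assumes "f \<in> module_hom R (free_module R (b n)) Y" "cobdry R b d Y n f"
  shows "cocycle R b d Y n f"
  unfolding cocycle_def
proof (intro conjI ballI assms(1))
  fix x assume x: "x \<in> carrier (free_module R (b (Suc n)))"
  note dx = hom_closed[OF resolutionD(2)[OF res] x]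
  show "f (d n x) = \<zero>\<^bsub>Y\<^esub>"
  proof (cases n)
    case 0
    then show ?thesis using assms(2) dx by (simp add: cobdry_0)
  next
    case (Suc m)
    then obtain g where g: "g \<in> module_hom R (free_module R (b m)) Y"
      "\<And>x. x \<in> carrier (free_module R (b (Suc m))) \<Longrightarrow> f x = g (d m x)" using assms(2) by (auto simp: cobdry_Suc)
    show ?thesis
      using g(2)[of "d n x"] dx resolutionD(6)[OF res, of x m] x hom_zero[OF free_module_module Y g(1)] Suc by simp
  qed
qed

lemma cocycles_submod: "submod R (ext_cocycles R X Y n) (HX n)"
proof (rule submodI[OF HX_module])
  interpret Y: Module.module R Y by (rule Y)
  show "ext_cocycles R X Y n \<subseteq> carrier (HX n)" by (auto simp: ext_cocycles_def)
  have dc: "snd (min_res R X) n x \<in> carrier (PX n)" if "x \<in> carrier (PX (Suc n))" for x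
    by (rule hom_closed[OF d_hom that])
  note * = ext_cocycles_def res_diff_def mem_Collect_eq
  show "\<zero>\<^bsub>HX n\<^esub> \<in> ext_cocycles R X Y n"
    unfolding * using Module.module.axioms(2)[OF HX_module, THEN abelian_group.axioms(1), THEN abelian_monoid.zero_closed] dc
    by (simp add: hom_module_simps(4))
  show "v \<oplus>\<^bsub>HX n\<^esub> w \<in> ext_cocycles R X Y n" if "v \<in> ext_cocycles R X Y n" "w \<in> ext_cocycles R X Y n" for v w
    using that unfolding * using submodD(4)[OF submod_carrier[OF HX_module]] dc
    by (simp add: hom_module_simps(2))
  show "r \<odot>\<^bsub>HX n\<^esub> v \<in> ext_cocycles R X Y n" if "r \<in> carrier R" "v \<in> ext_cocycles R X Y n" for r v
    using that unfolding * using submodD(5)[OF submod_carrier[OF HX_module]] dc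
    by (simp add: hom_module_simps(3))
qed

private abbreviation "ZX n \<equiv> (HX n)\<lparr>carrier := ext_cocycles R X Y n\<rparr>"

lemma coboundaries_submod: "submod R (ext_coboundaries R X Y n) (ZX n)"
proof (rule submodI[OF submod_module[OF cocycles_submod]])
  interpret Y: Module.module R Y by (rule Y)
  note iff = ext_coboundaries_iff[OF Y d_hom, folded bd]
  note HC = submodD[OF submod_carrier[OF HX_module]]
  show "ext_coboundaries R X Y n \<subseteq> carrier (ZX n)"
  proof
    fix f assume "f \<in> ext_coboundaries R X Y n"
    then have f: "f \<in> carrier (HX n)" "cobdry R b d Y n f" by (simp_all add: iff)
    then have "cocycle R b d Y n f" by (intro cobdry_imp_cocycle) (simp_all add: hom_module_simps PX_eq)
    then show "f \<in> carrier (ZX n)" using f(1) by (simp add: ext_cocycles_iff bd hom_module_simps)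
  qed
  have 0: "cobdry R b d Y n (\<lambda>x. \<zero>\<^bsub>Y\<^esub>)"
    by (cases n) (auto simp: cobdry_0 cobdry_Suc intro!: bexI[OF _ hom_const_zero[OF Y]])
  have "\<zero>\<^bsub>HX n\<^esub> \<in> ext_coboundaries R X Y n"
    unfolding iff by (intro conjI HC(3) cobdry_cong[OF 0]) (simp add: hom_module_simps(4) PX_eq)
  then show "\<zero>\<^bsub>ZX n\<^esub> \<in> ext_coboundaries R X Y n" by simp
  show "v \<oplus>\<^bsub>ZX n\<^esub> w \<in> ext_coboundaries R X Y n" if "v \<in> ext_coboundaries R X Y n" "w \<in> ext_coboundaries R X Y n" for v w
  proof -
    have "v \<oplus>\<^bsub>HX n\<^esub> w \<in> ext_coboundaries R X Y n"
      unfolding iff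
    proof (rule conjI)
      note v = that(1)[unfolded iff] and w = that(2)[unfolded iff]
      show "v \<oplus>\<^bsub>HX n\<^esub> w \<in> carrier (HX n)" using HC(4) v w by blast
      show "cobdry R b d Y n (v \<oplus>\<^bsub>HX n\<^esub> w)"
        by (rule cobdry_cong[OF cobdry_plus[OF Y conjunct2[OF v] conjunct2[OF w]]])
          (simp add: hom_module_simps(2) PX_eq)
    qed
    then show ?thesis by simp
  qed
  show "r \<odot>\<^bsub>ZX n\<^esub> v \<in> ext_coboundaries R X Y n" if "r \<in> carrier R" "v \<in> ext_coboundaries R X Y n" for r v
  proof -
    have "r \<odot>\<^bsub>HX n\<^esub> v \<in> ext_coboundaries R X Y n"
      unfolding iff
    proof (rule conjI)
      note v = that(2)[unfolded iff]
      show "r \<odot>\<^bsub>HX n\<^esub> v \<in> carrier (HX n)" using HC(5) that(1) v by blast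
      show "cobdry R b d Y n (r \<odot>\<^bsub>HX n\<^esub> v)"
        by (rule cobdry_cong[OF cobdry_scale[OF Y that(1) conjunct2[OF v]]])
          (simp add: hom_module_simps(3) PX_eq)
    qed
    then show ?thesis by simp
  qed
qed

text \<open>A cocycle and its restriction to the free module differ only outside the carrier, where
  being a coboundary is not tested. So the extensional maps inside \<open>Ext\<close> and the plain
  functions in \<open>acyclic_at\<close> give the same vanishing.\<close>

lemma zero_Ext_iff: "zero_module (Ext R X Y n) \<longleftrightarrow> acyclic_at R b d Y n"
proof -
  note iff = ext_coboundaries_iff[OF Y d_hom, folded bd]
  have "zero_module (Ext R X Y n) \<longleftrightarrow> ext_cocycles R X Y n \<subseteq> ext_coboundaries R X Y n"
    unfolding Ext_def zero_quot_iff[OF coboundaries_submod] by simp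
  also have "\<dots> \<longleftrightarrow> acyclic_at R b d Y n"
    unfolding acyclic_at_def
  proof (intro iffI allI impI subsetI)
    fix f assume sub: "ext_cocycles R X Y n \<subseteq> ext_coboundaries R X Y n" and f: "cocycle R b d Y n f"
    let ?f = "restrict f (carrier (PX n))"
    have f1: "f \<in> module_hom R (PX n) Y" using f by (simp add: cocycle_def PX_eq)
    have rf: "?f \<in> carrier (HX n)" by (rule restrict_hom_module[OF PX_module f1])
    have "f (d n x) = \<zero>\<^bsub>Y\<^esub>" if "x \<in> carrier (PX (Suc n))" for x
      using f that by (simp add: cocycle_def PX_eq)
    then have "?f \<in> ext_cocycles R X Y n"
      using rf hom_closed[OF d_hom[of n]] by (simp add: ext_cocycles_def res_diff_def bd(2)[symmetric])
    then have "cobdry R b d Y n ?f" using sub iff by blast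
    then show "cobdry R b d Y n f" by (rule cobdry_cong) (simp add: PX_eq)
  next
    fix f assume "\<forall>f. cocycle R b d Y n f \<longrightarrow> cobdry R b d Y n f" and f: "f \<in> ext_cocycles R X Y n"
    then have "cobdry R b d Y n f" by (simp add: ext_cocycles_iff bd)
    moreover have "f \<in> carrier (HX n)" using f by (simp add: ext_cocycles_def)
    ultimately show "f \<in> ext_coboundaries R X Y n" by (simp add: iff)
  qed
  finally show ?thesis .
qed

lemma Ext_module: "module R (Ext R X Y n)"
  unfolding Ext_def by (rule quot_module_module[OF coboundaries_submod])

lemma Ext_fg:
  assumes "fg_module R (HX n)"
  shows "fg_module R (Ext R X Y n)"
  unfolding Ext_def by (rule fg_quot[OF fg_submod_module[OF assms cocycles_submod] coboundaries_submod])

text \<open>Meant for Y the residue module, where it allows \<open>Ext\<close> to be viewed as a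
  vector space over the residue field.\<close>

lemma Ext_annihilated:
  assumes r: "r \<in> carrier R" "\<And>y. y \<in> carrier Y \<Longrightarrow> r \<odot>\<^bsub>Y\<^esub> y = \<zero>\<^bsub>Y\<^esub>"
    and v: "v \<in> carrier (Ext R X Y n)"
  shows "r \<odot>\<^bsub>Ext R X Y n\<^esub> v = \<zero>\<^bsub>Ext R X Y n\<^esub>"
proof -
  interpret Y: Module.module R Y by (rule Y)
  let ?q = "\<lambda>f. ext_coboundaries R X Y n +>\<^bsub>ZX n\<^esub> f"
  obtain f where f: "f \<in> carrier (ZX n)" "v = ?q f"
    using v unfolding Ext_def quot_simps(1)[OF coboundaries_submod] by blast
  then have fh: "f \<in> module_hom R (PX n) Y" by (simp add: ext_cocycles_def hom_module_simps)
  have "r \<odot>\<^bsub>HX n\<^esub> f = \<zero>\<^bsub>HX n\<^esub>"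
    unfolding hom_module_simps(3,4) by (rule restrict_ext) (simp add: r(2) hom_closed[OF fh])
  then have "?q (r \<odot>\<^bsub>ZX n\<^esub> f) = ?q \<zero>\<^bsub>ZX n\<^esub>" by simp
  then show ?thesis
    unfolding Ext_def f(2) quot_simps(4)[OF coboundaries_submod r(1) f(1)]
    using coset_zero[OF coboundaries_submod] quot_simps(2)[OF coboundaries_submod] by simp
qed

end

end

section \<open>Regular elements\<close>

text \<open>This is Hom(k, N) = 0, stated without homomorphisms.\<close>

definition no_socle :: "('a, 'r) ring_scheme \<Rightarrow> ('a, 'b) module \<Rightarrow> bool" where
  "no_socle R N \<longleftrightarrow>
     (\<forall>u\<in>carrier N. (\<forall>r\<in>max_ideal R. r \<odot>\<^bsub>N\<^esub> u = \<zero>\<^bsub>N\<^esub>) \<longrightarrow> u = \<zero>\<^bsub>N\<^esub>)"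

definition ann :: "('a, 'r) ring_scheme \<Rightarrow> ('a, 'b) module \<Rightarrow> 'b \<Rightarrow> 'a set" where
  "ann R N u = {r \<in> carrier R. r \<odot>\<^bsub>N\<^esub> u = \<zero>\<^bsub>N\<^esub>}"

context noeth_local
begin

context
  fixes N :: "('a, 'n) module"
  assumes N: "fg_module R N"
begin

private lemma NM: "module R N"
  using N by (simp add: fg_module_def)

interpretation N: Module.module R N by (rule NM)

private lemma ann_submod: "u \<in> carrier N \<Longrightarrow> submod R (ann R N u) (ring_module R)"
proof -
  assume u: "u \<in> carrier N"
  have "(\<lambda>r. r \<odot>\<^bsub>N\<^esub> u) \<in> module_hom R (ring_module R) N"
    by (rule homI) (simp_all add: u N.smult_l_distr N.smult_assoc1)
  from submod_kernel[OF ring_module_module NM this] show ?thesis by (simp add: ann_def)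
qed

text \<open>The maximal members among the associated primes of \<open>N\<close>. Together they
  contain every zero divisor, and for maximal annihilators primality and finiteness have elementary
  proofs.\<close>

private definition "max_ann =
  {p. (\<exists>u\<in>carrier N. u \<noteq> \<zero>\<^bsub>N\<^esub> \<and> p = ann R N u) \<and>
      (\<forall>u\<in>carrier N. u \<noteq> \<zero>\<^bsub>N\<^esub> \<longrightarrow> p \<subseteq> ann R N u \<longrightarrow> ann R N u = p)}"

private lemma max_annD:
  assumes "p \<in> max_ann"
  obtains u where "u \<in> carrier N" "u \<noteq> \<zero>\<^bsub>N\<^esub>" "p = ann R N u"
  using assms unfolding max_ann_def by blast

private lemma max_ann_submod: "p \<in> max_ann \<Longrightarrow> submod R p (ring_module R)"
  using ann_submod max_annD by metis

private lemma max_ann_maximal: "p \<in> max_ann \<Longrightarrow> q \<in> max_ann \<Longrightarrow> p \<subseteq> q \<Longrightarrow> p = q"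
  unfolding max_ann_def by blast

private lemma max_ann_above:
  assumes u: "u \<in> carrier N" "u \<noteq> \<zero>\<^bsub>N\<^esub>"
  shows "\<exists>p\<in>max_ann. ann R N u \<subseteq> p"
proof -
  let ?\<U> = "{p. (\<exists>v\<in>carrier N. v \<noteq> \<zero>\<^bsub>N\<^esub> \<and> p = ann R N v) \<and> ann R N u \<subseteq> p}"
  have "ann R N u \<in> ?\<U>" using u by blast
  then have ne: "?\<U> \<noteq> {}" by blast
  have "\<exists>W\<in>?\<U>. \<forall>V\<in>?\<U>. W \<subseteq> V \<longrightarrow> V = W"
    by (rule maximal_submod[OF fg_ring ne]) (use ann_submod in blast)
  then obtain W where W: "W \<in> ?\<U>" and W': "\<forall>V\<in>?\<U>. W \<subseteq> V \<longrightarrow> V = W" by (rule bexE)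
  have "W \<in> max_ann"
    unfolding max_ann_def
  proof (intro CollectI conjI ballI impI)
    show "\<exists>v\<in>carrier N. v \<noteq> \<zero>\<^bsub>N\<^esub> \<and> W = ann R N v" using W by blast
    fix v assume v: "v \<in> carrier N" "v \<noteq> \<zero>\<^bsub>N\<^esub>" "W \<subseteq> ann R N v"
    have "ann R N v \<in> ?\<U>" using v W by blast
    then show "ann R N v = W" using W' v(3) by blast
  qed
  then show ?thesis using W by blast
qed

text \<open>ann(u) is contained in ann(b u), so by maximality the two coincide unless b u = 0; and a
  kills b u.\<close>

private lemma max_ann_prime:
  assumes p: "p \<in> max_ann" and ab: "a \<in> carrier R" "b \<in> carrier R" "a \<otimes> b \<in> p"
  shows "a \<in> p \<or> b \<in> p"
proof -
  obtain u where u: "u \<in> carrier N" "u \<noteq> \<zero>\<^bsub>N\<^esub>" "p = ann R N u" using max_annD[OF p] .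
  show ?thesis
  proof (cases "b \<odot>\<^bsub>N\<^esub> u = \<zero>\<^bsub>N\<^esub>")
    case True
    then show ?thesis using ab u by (simp add: ann_def)
  next
    case False
    have "p \<subseteq> ann R N (b \<odot>\<^bsub>N\<^esub> u)"
    proof
      fix r assume "r \<in> p"
      then have r: "r \<in> carrier R" "r \<odot>\<^bsub>N\<^esub> u = \<zero>\<^bsub>N\<^esub>" unfolding u(3) by (simp_all add: ann_def)
      have "r \<odot>\<^bsub>N\<^esub> (b \<odot>\<^bsub>N\<^esub> u) = b \<odot>\<^bsub>N\<^esub> (r \<odot>\<^bsub>N\<^esub> u)"
        using r(1) ab(2) u(1) m_comm by (simp flip: N.smult_assoc1)
      then show "r \<in> ann R N (b \<odot>\<^bsub>N\<^esub> u)" using r ab(2) by (simp add: ann_def)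
    qed
    then have "ann R N (b \<odot>\<^bsub>N\<^esub> u) = p" using p False u(1) ab(2) unfolding max_ann_def by blast
    moreover have "a \<in> ann R N (b \<odot>\<^bsub>N\<^esub> u)"
      using ab u by (simp add: ann_def N.smult_assoc1)
    ultimately show ?thesis by simp
  qed
qed

text \<open>If infinitely many maximal annihilators \<open>ann u\<^sub>i\<close> existed, some \<open>u\<^sub>n\<close> would be a linear
  combination of its predecessors, so that \<open>ann u\<^sub>n\<close> would contain a product of elements outside of it.\<close>

private lemma finite_max_ann: "finite max_ann"
proof (rule ccontr)
  assume "infinite max_ann"
  then obtain p :: "nat \<Rightarrow> 'a set" where p: "inj p" "range p \<subseteq> max_ann"
    using infinite_countable_subset by blast
  have "\<forall>i. \<exists>u\<in>carrier N. u \<noteq> \<zero>\<^bsub>N\<^esub> \<and> p i = ann R N u" using p(2) unfolding max_ann_def by blast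
  then obtain u where u: "\<And>i. u i \<in> carrier N" "\<And>i. p i = ann R N (u i)" by metis
  have pm: "p i \<in> max_ann" for i using p(2) by blast
  define U where "U n = lin N n u ` carrier (free_module R n)" for n
  have l: "lin N n u \<in> module_hom R (free_module R n) N" for n by (intro lin_hom NM u(1))
  have U: "submod R (U n) N" for n unfolding U_def by (rule submod_image[OF free_module_module NM l])
  have uU: "u i \<in> U n" if "i < n" for i n
    unfolding U_def using lin_unitv[OF NM u(1) that]
    by (intro image_eqI[of _ _ "unitv R n i"]) (simp_all add: free_simps)
  have sub: "U n \<subseteq> W" if W: "submod R W N" and "\<And>i. i < n \<Longrightarrow> u i \<in> W" for n W
    unfolding U_def
    using free_image_subset[OF W l[of n]] that(2) lin_unitv[OF NM u(1)] by (auto simp: free_simps)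
  have "\<exists>n. U (Suc n) = U n"
    by (rule ascending_chain_stabilizes[OF N U], rule sub[OF U], rule uU) simp
  then obtain n where n: "U (Suc n) = U n" ..
  have "\<exists>a\<in>carrier R. a \<notin> p n \<and> (\<forall>i<k. a \<odot>\<^bsub>N\<^esub> u i = \<zero>\<^bsub>N\<^esub>)" if "k \<le> n" for k
    using that
  proof (induction k)
    case 0
    have "\<one> \<notin> p n"
    proof
      assume "\<one> \<in> p n"
      then have "u n = \<zero>\<^bsub>N\<^esub>" unfolding u(2) ann_def using u(1) by simp
      then have "p n = carrier R" unfolding u(2) ann_def by auto
      moreover obtain v where "v \<in> carrier N" "v \<noteq> \<zero>\<^bsub>N\<^esub>" "p n = ann R N v" using max_annD[OF pm] .
      ultimately have "\<one> \<in> ann R N v" by simp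
      then show False using \<open>v \<in> carrier N\<close> \<open>v \<noteq> \<zero>\<^bsub>N\<^esub>\<close> by (simp add: ann_def)
    qed
    then show ?case by auto
  next
    case (Suc k)
    obtain a where a: "a \<in> carrier R" "a \<notin> p n" "\<And>i. i < k \<Longrightarrow> a \<odot>\<^bsub>N\<^esub> u i = \<zero>\<^bsub>N\<^esub>"
      using Suc.IH[OF Suc_leD[OF Suc.prems]] by blast
    have "p k \<noteq> p n" using inj_eq[OF p(1)] Suc.prems by simp
    then obtain a' where a': "a' \<in> p k" "a' \<notin> p n" using max_ann_maximal[OF pm pm] by blast
    have a'': "a' \<in> carrier R" "a' \<odot>\<^bsub>N\<^esub> u k = \<zero>\<^bsub>N\<^esub>" using a'(1) unfolding u(2) ann_def by auto
    have "a' \<otimes> a \<notin> p n" using max_ann_prime[OF pm a''(1) a(1)] a(2) a'(2) by blast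
    moreover have "(a' \<otimes> a) \<odot>\<^bsub>N\<^esub> u i = \<zero>\<^bsub>N\<^esub>" if "i < Suc k" for i
    proof (cases "i = k")
      case True
      have "(a' \<otimes> a) \<odot>\<^bsub>N\<^esub> u k = a \<odot>\<^bsub>N\<^esub> (a' \<odot>\<^bsub>N\<^esub> u k)"
        using a(1) a''(1) u(1) m_comm[of a' a] by (simp add: N.smult_assoc1)
      then show ?thesis using True a''(2) a(1) by simp
    next
      case False
      then show ?thesis using a(3)[of i] that a(1) a''(1) u(1) by (simp add: N.smult_assoc1)
    qed
    ultimately show ?case using a(1) a''(1) by (intro bexI[of _ "a' \<otimes> a"]) auto
  qed
  then obtain a where a: "a \<in> carrier R" "a \<notin> p n" "\<And>i. i < n \<Longrightarrow> a \<odot>\<^bsub>N\<^esub> u i = \<zero>\<^bsub>N\<^esub>" by blast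
  have "U n \<subseteq> {v \<in> carrier N. a \<odot>\<^bsub>N\<^esub> v = \<zero>\<^bsub>N\<^esub>}"
    by (rule sub[OF submod_kernel[OF NM NM hom_scale[OF NM hom_id a(1)]]]) (use a(3) u(1) in simp)
  then have "a \<odot>\<^bsub>N\<^esub> u n = \<zero>\<^bsub>N\<^esub>" using uU[of n "Suc n"] n by auto
  then show False using a unfolding u(2) ann_def by simp
qed

private lemma mm_avoids: "no_socle R N \<Longrightarrow> p \<in> max_ann \<Longrightarrow> \<exists>y\<in>mm. y \<notin> p"
proof (rule ccontr)
  assume ns: "no_socle R N" and p: "p \<in> max_ann" and "\<not> (\<exists>y\<in>mm. y \<notin> p)"
  then have "mm \<subseteq> p" by blast
  moreover obtain u where "u \<in> carrier N" "u \<noteq> \<zero>\<^bsub>N\<^esub>" "p = ann R N u" using max_annD[OF p] .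
  ultimately show False using ns unfolding no_socle_def ann_def by blast
qed

text \<open>Distinct members of \<open>max_ann\<close> are incomparable. If x lies in the new prime
  p, add some y of \<open>mm\<close> that lies in all primes of T but not in p: then x + y avoids p
  because x belongs to it, and avoids each q in T because y belongs to q and x does not.\<close>

private lemma prime_avoidance:
  assumes ns: "no_socle R N" and "finite T" "T \<subseteq> max_ann"
  shows "\<exists>x\<in>mm. \<forall>p\<in>T. x \<notin> p"
  using assms(2,3)
proof (induction T)
  case empty
  then show ?case using mm_closed(2) by blast
next
  case (insert p T)
  then obtain x where x: "x \<in> mm" "\<And>q. q \<in> T \<Longrightarrow> x \<notin> q" by auto
  have p: "p \<in> max_ann" using insert.prems by blast
  show ?case
  proof (cases "x \<in> p")
    case False
    then show ?thesis using x by (intro bexI[of _ x]) auto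
  next
    case True
    \<comment> \<open>\<open>y\<close> is the product of an element of \<open>mm\<close> outside p
      with one element of each q in T outside p. Incomparability provides the factors, primality
      keeps the product outside p.\<close>
    have "\<exists>y\<in>mm. y \<notin> p \<and> (\<forall>q\<in>T. y \<in> q)"
      using insert.hyps insert.prems
    proof (induction T)
      case empty
      then show ?case using mm_avoids[OF ns p] by blast
    next
      case (insert q T)
      then obtain y where y: "y \<in> mm" "y \<notin> p" "\<And>q. q \<in> T \<Longrightarrow> y \<in> q" by auto
      have q: "q \<in> max_ann" "q \<noteq> p" using insert.prems(2) insert.prems(1) by auto
      then obtain z where z: "z \<in> q" "z \<notin> p" using max_ann_maximal[OF q(1) p] by blast
      note sq = submodD[OF max_ann_submod[OF q(1)], simplified]
      have zc: "z \<in> carrier R" using z(1) sq(2) by blast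
      have "z \<otimes> y \<in> mm" using zc y(1) by (rule mm_closed(4))
      moreover have "z \<otimes> y \<notin> p" using max_ann_prime[OF p zc mm_carrier[OF y(1)]] z(2) y(2) by blast
      moreover have "z \<otimes> y \<in> q" using sq(5)[OF mm_carrier[OF y(1)] z(1)] m_comm[OF zc mm_carrier[OF y(1)]] by simp
      moreover have "z \<otimes> y \<in> q'" if "q' \<in> T" for q'
        using submodD(5)[OF max_ann_submod, of q' z y] insert.prems(2) that zc y(3)[OF that] by auto
      ultimately show ?case by (intro bexI[of _ "z \<otimes> y"]) auto
    qed
    then obtain y where y: "y \<in> mm" "y \<notin> p" "\<And>q. q \<in> T \<Longrightarrow> y \<in> q" by auto
    have diff: "v \<in> q" if "submod R q (ring_module R)" "u \<in> q" "u \<oplus> v \<in> q" "v \<in> carrier R" for u v q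
    proof -
      have u: "u \<in> carrier R" using submodD(2)[OF that(1)] that(2) by auto
      have "\<ominus> \<one> \<otimes> u \<in> q" using submodD(5)[OF that(1) _ that(2), of "\<ominus> \<one>"] by simp
      then have "\<ominus> u \<oplus> (u \<oplus> v) \<in> q" using submodD(4)[OF that(1) _ that(3), of "\<ominus> u"] u by (simp add: l_minus)
      then show ?thesis using r_neg1 u that(4) by simp
    qed
    show ?thesis
    proof (intro bexI[of _ "x \<oplus> y"] ballI)
      show "x \<oplus> y \<in> mm" using x(1) y(1) by (rule mm_closed(3))
      fix q assume "q \<in> insert p T"
      then consider "q = p" | "q \<in> T" by blast
      then show "x \<oplus> y \<notin> q"
      proof cases
        case 1
        then show ?thesis using diff[OF max_ann_submod[OF p] True] y(1,2) mm_carrier by blast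
      next
        case 2
        then have "q \<in> max_ann" using insert.prems by blast
        then show ?thesis
          using diff[OF max_ann_submod, of q y x] y(3)[OF 2] x(1) x(2)[OF 2] a_comm[of x y] mm_carrier y(1) by metis
      qed
    qed
  qed
qed

text \<open>An element that kills something nonzero lies in a maximal annihilator, whereas prime
  avoidance provides an element of \<open>mm\<close> in none of them.\<close>

lemma exists_nonzerodivisor:
  assumes "no_socle R N"
  shows "\<exists>x\<in>mm. nonzerodivisor_on x N"
proof -
  obtain x where x: "x \<in> mm" "\<And>p. p \<in> max_ann \<Longrightarrow> x \<notin> p"
    using prime_avoidance[OF assms finite_max_ann subset_refl] by blast
  have "u = \<zero>\<^bsub>N\<^esub>" if "u \<in> carrier N" "x \<odot>\<^bsub>N\<^esub> u = \<zero>\<^bsub>N\<^esub>" for u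
  proof (rule ccontr)
    assume "u \<noteq> \<zero>\<^bsub>N\<^esub>"
    from max_ann_above[OF that(1) this] obtain p where "p \<in> max_ann" "ann R N u \<subseteq> p" by blast
    moreover have "x \<in> ann R N u" using that x(1) by (simp add: ann_def)
    ultimately show False using x(2) by blast
  qed
  then show ?thesis using x(1) by (auto simp: nonzerodivisor_on_def)
qed

end

section \<open>Minimal resolutions in degree zero: Hom(X, N) and the socle\<close>

lemma mfr_free: "minimal_free_resolution R b d \<epsilon> X \<Longrightarrow> free_resolution R b d \<epsilon> X"
  by (simp add: minimal_free_resolution_def)

lemma mfr_mm:
  "minimal_free_resolution R b d \<epsilon> X \<Longrightarrow> x \<in> carrier (free_module R (b (Suc i))) \<Longrightarrow> j < b i \<Longrightarrow> d i x j \<in> mm"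
  by (simp add: minimal_free_resolution_def)

lemma mfr_rank_pos:
  fixes X :: "('a, 'm) module"
  assumes X: "module R X" "\<not> zero_module X" and P: "minimal_free_resolution R b d \<epsilon> X"
  shows "0 < b 0"
proof (rule ccontr)
  assume "\<not> 0 < b 0"
  note r = resolutionD[OF mfr_free[OF P]]
  have "x = \<zero>\<^bsub>X\<^esub>" if "x \<in> carrier X" for x
  proof -
    have "x \<in> \<epsilon> ` carrier (free_module R (b 0))" unfolding r(4) by (rule that)
    then obtain y where y: "y \<in> carrier (free_module R (b 0))" "x = \<epsilon> y" by blast
    then have "y = \<zero>\<^bsub>free_module R (b 0)\<^esub>" using free_0[of y] \<open>\<not> 0 < b 0\<close> by simp
    then show ?thesis using y(2) hom_zero[OF free_module_module X(1) r(3)] by simp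
  qed
  then show False using X zero_module_iff by blast
qed

lemma unitv_in: "unitv R n i \<in> carrier (free_module R n)"
  by (simp add: free_simps)

text \<open>A socle element u gives the cochain sending x to x_0 u. It is a cocycle because d 0 has
  coordinates in \<open>mm\<close>, and as only zero is a coboundary in degree 0, its value u at the
  first basis vector vanishes.\<close>

lemma acyclic_at_0_imp_no_socle:
  fixes X :: "('a, 'm) module" and N :: "('a, 'n) module"
  assumes X: "module R X" "\<not> zero_module X" and P: "minimal_free_resolution R b d \<epsilon> X"
    and N: "module R N" and V: "acyclic_at R b d N 0"
  shows "no_socle R N"
  unfolding no_socle_def
proof (intro ballI impI)
  interpret N: Module.module R N by fact
  fix u assume u: "u \<in> carrier N" "\<forall>r\<in>mm. r \<odot>\<^bsub>N\<^esub> u = \<zero>\<^bsub>N\<^esub>"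
  have b: "0 < b 0" by (rule mfr_rank_pos[OF X P])
  let ?f = "\<lambda>x. x 0 \<odot>\<^bsub>N\<^esub> u"
  have "cocycle R b d N 0 ?f"
    unfolding cocycle_def
  proof (intro conjI ballI)
    show "?f \<in> module_hom R (free_module R (b 0)) N"
      using free_coord[OF _ b] b by (intro homI) (simp_all add: free_simps u(1) N.smult_l_distr N.smult_assoc1)
    show "?f (d 0 x) = \<zero>\<^bsub>N\<^esub>" if "x \<in> carrier (free_module R (b (Suc 0)))" for x
      using mfr_mm[OF P that b] u(2) by blast
  qed
  then have "cobdry R b d N 0 ?f" using V by (simp add: acyclic_at_def)
  then have "?f (unitv R (b 0) 0) = \<zero>\<^bsub>N\<^esub>" using unitv_in unfolding cobdry_0 by blast
  then show "u = \<zero>\<^bsub>N\<^esub>" using b u(1) by (simp add: unitv_apply)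
qed

text \<open>When \<open>mm\<close> kills X, the multiples of a basis vector by \<open>mm\<close> are
  boundaries, so a cocycle of degree 0 sends basis vectors into the socle of N.\<close>

lemma no_socle_imp_acyclic_at_0:
  fixes X :: "('a, 'm) module" and N :: "('a, 'n) module"
  assumes X: "module R X" and mX: "\<And>r x. r \<in> mm \<Longrightarrow> x \<in> carrier X \<Longrightarrow> r \<odot>\<^bsub>X\<^esub> x = \<zero>\<^bsub>X\<^esub>"
    and P: "free_resolution R b d \<epsilon> X" and N: "module R N" and ns: "no_socle R N"
  shows "acyclic_at R b d N 0"
  unfolding acyclic_at_def cobdry_0
proof (intro allI impI ballI)
  interpret N: Module.module R N by fact
  interpret F: Module.module R "free_module R (b 0)" by (rule free_module_module)
  note r = resolutionD[OF P]
  fix f x assume "cocycle R b d N 0 f" and x: "x \<in> carrier (free_module R (b 0))"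
  then have f: "f \<in> module_hom R (free_module R (b 0)) N"
    "\<And>x. x \<in> carrier (free_module R (b (Suc 0))) \<Longrightarrow> f (d 0 x) = \<zero>\<^bsub>N\<^esub>" by (auto simp: cocycle_def)
  have e: "f (unitv R (b 0) i) = \<zero>\<^bsub>N\<^esub>" for i
  proof -
    let ?e = "unitv R (b 0) i"
    have "s \<odot>\<^bsub>N\<^esub> f ?e = \<zero>\<^bsub>N\<^esub>" if s: "s \<in> mm" for s
    proof -
      have "\<epsilon> (s \<odot>\<^bsub>free_module R (b 0)\<^esub> ?e) = \<zero>\<^bsub>X\<^esub>"
        using hom_smult[OF r(3) mm_carrier[OF s] unitv_in] mX[OF s hom_closed[OF r(3) unitv_in]] by simp
      then have "s \<odot>\<^bsub>free_module R (b 0)\<^esub> ?e \<in> d 0 ` carrier (free_module R (b (Suc 0)))"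
        by (rule r(7)[OF F.smult_closed[OF mm_carrier[OF s] unitv_in]])
      then have "f (s \<odot>\<^bsub>free_module R (b 0)\<^esub> ?e) = \<zero>\<^bsub>N\<^esub>" using f(2) by auto
      then show ?thesis using hom_smult[OF f(1) mm_carrier[OF s] unitv_in] by simp
    qed
    then show ?thesis using ns hom_closed[OF f(1) unitv_in] unfolding no_socle_def by blast
  qed
  show "f x = \<zero>\<^bsub>N\<^esub>"
    by (rule hom_free_eq[OF N f(1) hom_const_zero[OF N] e]) (use x in \<open>simp add: free_simps\<close>)
qed

section \<open>Depth\<close>

context
  fixes N N' :: "('a, 'n) module" and x p
  assumes N: "module R N" and N': "module R N'" and x: "x \<in> mm" and reg: "nonzerodivisor_on x N"
    and p: "p \<in> module_hom R N N'" "p ` carrier N = carrier N'"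
    and ker: "\<And>u. u \<in> carrier N \<Longrightarrow> p u = \<zero>\<^bsub>N'\<^esub> \<longleftrightarrow> u \<in> (\<lambda>v. x \<odot>\<^bsub>N\<^esub> v) ` carrier N"
begin

private lemma mult_hom: "(\<lambda>v. x \<odot>\<^bsub>N\<^esub> v) \<in> module_hom R N N"
  by (rule hom_scale[OF N hom_id mm_carrier[OF x]])

private lemma mult_inj: "u \<in> carrier N \<Longrightarrow> x \<odot>\<^bsub>N\<^esub> u = \<zero>\<^bsub>N\<^esub> \<Longrightarrow> u = \<zero>\<^bsub>N\<^esub>"
  using reg by (simp add: nonzerodivisor_on_def)

lemma acyclic_at_mod_regular:
  fixes X :: "('a, 'm) module"
  assumes P: "free_resolution R b d \<epsilon> X" and "acyclic_at R b d N n" "acyclic_at R b d N (Suc n)"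
  shows "acyclic_at R b d N' n"
  by (rule acyclic_at_quotient[OF P N N N' mult_hom mult_inj p ker assms(2,3)])

text \<open>Since x kills X, multiplication by x is zero on Ext(X, N), so every class of
  Ext^(j+1)(X, N) comes from Ext^j(X, N'). This shifts the range of vanishing by exactly one; degree
  0 is settled because a module with a regular element in \<open>mm\<close> has no socle.\<close>

lemma acyclic_below_mod_regular:
  fixes X :: "('a, 'm) module"
  assumes X: "module R X" and P: "free_resolution R b d \<epsilon> X"
    and mX: "\<And>r x. r \<in> mm \<Longrightarrow> x \<in> carrier X \<Longrightarrow> r \<odot>\<^bsub>X\<^esub> x = \<zero>\<^bsub>X\<^esub>"
  shows "(\<forall>j<n. acyclic_at R b d N' j) \<longleftrightarrow> (\<forall>j<Suc n. acyclic_at R b d N j)"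
proof
  assume V: "\<forall>j<n. acyclic_at R b d N' j"
  have "no_socle R N" using mult_inj x by (auto simp: no_socle_def)
  then have "acyclic_at R b d N 0" by (intro no_socle_imp_acyclic_at_0[OF X _ P N] mX)
  moreover have "acyclic_at R b d N (Suc j)" if "j < n" for j
    unfolding acyclic_at_def
  proof (intro allI impI)
    fix v assume v: "cocycle R b d N (Suc j) v"
    then have vh: "v \<in> module_hom R (free_module R (b (Suc j))) N" by (simp add: cocycle_def)
    have V': "acyclic_at R b d N' j" using V that by blast
    have iv: "cobdry R b d N (Suc j) (\<lambda>y. x \<odot>\<^bsub>N\<^esub> v y)"
      by (rule cobdry_annihilated[OF X N P mm_carrier[OF x] mX[OF x] v])
    show "cobdry R b d N (Suc j) v"
      by (rule cobdry_sub[OF P N N N' mult_hom mult_inj p ker V' vh iv])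
  qed
  ultimately show "\<forall>j<Suc n. acyclic_at R b d N j" by (simp add: All_less_Suc2)
next
  assume "\<forall>j<Suc n. acyclic_at R b d N j"
  then show "\<forall>j<n. acyclic_at R b d N' j" using acyclic_at_mod_regular[OF P] by simp
qed

end

section \<open>Regular sequences and depth\<close>

context
  fixes M :: "('a, 'n) module"
  assumes fgM: "fg_module R M" and nzM: "\<not> zero_module M"
begin

private lemma MM: "module R M"
  using fgM by (simp add: fg_module_def)

interpretation M: Module.module R M by (rule MM)

private abbreviation "II xs \<equiv> list_times_module R xs M"
private abbreviation "QQ xs \<equiv> quot_module M (II xs)"

private lemma gens_sub: "set xs \<subseteq> mm \<Longrightarrow> {x \<odot>\<^bsub>M\<^esub> u | x u. x \<in> set xs \<and> u \<in> carrier M} \<subseteq> carrier M"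
  by auto

private lemma II_submod: "set xs \<subseteq> mm \<Longrightarrow> submod R (II xs) M"
  unfolding list_times_module_def by (rule M.span_is_submodule[OF gens_sub])

private lemma II_gen: "set xs \<subseteq> mm \<Longrightarrow> x \<in> set xs \<Longrightarrow> u \<in> carrier M \<Longrightarrow> x \<odot>\<^bsub>M\<^esub> u \<in> II xs"
  unfolding list_times_module_def using M.in_own_span[OF gens_sub] by blast

private lemma II_least:
  assumes "submod R W M" "\<And>x u. x \<in> set xs \<Longrightarrow> u \<in> carrier M \<Longrightarrow> x \<odot>\<^bsub>M\<^esub> u \<in> W"
  shows "II xs \<subseteq> W"
  unfolding list_times_module_def by (rule M.span_is_subset[OF _ assms(1)]) (use assms(2) in blast)

private lemma II_mono: "set ys \<subseteq> mm \<Longrightarrow> set xs \<subseteq> set ys \<Longrightarrow> II xs \<subseteq> II ys"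
  by (rule II_least[OF II_submod]) (use II_gen in blast)+

private lemma II_Nil: "II [] = {\<zero>\<^bsub>M\<^esub>}"
  using II_least[OF submod_zero[OF MM], of "[]"] submodD(3)[OF II_submod, of "[]"] by auto

private lemma II_snoc:
  assumes xs: "set xs \<subseteq> mm" and x: "x \<in> mm" and u: "u \<in> II (xs @ [x])"
  shows "\<exists>w\<in>II xs. \<exists>v\<in>carrier M. u = w \<oplus>\<^bsub>M\<^esub> x \<odot>\<^bsub>M\<^esub> v"
proof -
  let ?W = "{w \<oplus>\<^bsub>M\<^esub> x \<odot>\<^bsub>M\<^esub> v | w v. w \<in> II xs \<and> v \<in> carrier M}"
  note I = submodD[OF II_submod[OF xs]]
  have xc: "x \<in> carrier R" using x by simp
  have Ic: "w \<in> carrier M" if "w \<in> II xs" for w using I(2) that by blast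
  have W: "submod R ?W M"
  proof (rule submodI[OF MM])
    show "?W \<subseteq> carrier M" using Ic xc by auto
    have "\<zero>\<^bsub>M\<^esub> = \<zero>\<^bsub>M\<^esub> \<oplus>\<^bsub>M\<^esub> x \<odot>\<^bsub>M\<^esub> \<zero>\<^bsub>M\<^esub>" using xc by simp
    then show "\<zero>\<^bsub>M\<^esub> \<in> ?W" using I(3) by blast
    fix s t assume "s \<in> ?W" "t \<in> ?W"
    then obtain w v w' v' where *: "w \<in> II xs" "v \<in> carrier M" "w' \<in> II xs" "v' \<in> carrier M"
      "s = w \<oplus>\<^bsub>M\<^esub> x \<odot>\<^bsub>M\<^esub> v" "t = w' \<oplus>\<^bsub>M\<^esub> x \<odot>\<^bsub>M\<^esub> v'" by blast
    have "s \<oplus>\<^bsub>M\<^esub> t = (w \<oplus>\<^bsub>M\<^esub> w') \<oplus>\<^bsub>M\<^esub> x \<odot>\<^bsub>M\<^esub> (v \<oplus>\<^bsub>M\<^esub> v')"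
      using * Ic xc by (simp add: M.smult_r_distr M.a_ac)
    then show "s \<oplus>\<^bsub>M\<^esub> t \<in> ?W" using I(4)[OF *(1,3)] M.a_closed[OF *(2,4)] by blast
  next
    fix r s assume r: "r \<in> carrier R" and "s \<in> ?W"
    then obtain w v where *: "w \<in> II xs" "v \<in> carrier M" "s = w \<oplus>\<^bsub>M\<^esub> x \<odot>\<^bsub>M\<^esub> v" by blast
    have "r \<odot>\<^bsub>M\<^esub> s = r \<odot>\<^bsub>M\<^esub> w \<oplus>\<^bsub>M\<^esub> x \<odot>\<^bsub>M\<^esub> (r \<odot>\<^bsub>M\<^esub> v)"
      using * Ic xc r m_comm[OF r xc] by (simp add: M.smult_r_distr flip: M.smult_assoc1)
    then show "r \<odot>\<^bsub>M\<^esub> s \<in> ?W" using I(5)[OF r *(1)] M.smult_closed[OF r *(2)] by blast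
  qed
  have "II (xs @ [x]) \<subseteq> ?W"
  proof (rule II_least[OF W])
    fix y u assume y: "y \<in> set (xs @ [x])" and u: "u \<in> carrier M"
    show "y \<odot>\<^bsub>M\<^esub> u \<in> ?W"
    proof (cases "y = x")
      case True
      have "y \<odot>\<^bsub>M\<^esub> u = \<zero>\<^bsub>M\<^esub> \<oplus>\<^bsub>M\<^esub> x \<odot>\<^bsub>M\<^esub> u" using True u xc by simp
      then show ?thesis using I(3) u by blast
    next
      case False
      then have y': "y \<in> set xs" using y by simp
      have "y \<odot>\<^bsub>M\<^esub> u = y \<odot>\<^bsub>M\<^esub> u \<oplus>\<^bsub>M\<^esub> x \<odot>\<^bsub>M\<^esub> \<zero>\<^bsub>M\<^esub>" using xc u Ic[OF II_gen[OF xs y' u]] by simp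
      then show ?thesis using II_gen[OF xs y' u] M.zero_closed by blast
    qed
  qed
  then show ?thesis using u by blast
qed

text \<open>M/(xs, x)M is the quotient of M/(xs)M by the image of multiplication by x; it is
  presented as a surjection with that kernel, the form in which regular elements were treated
  above.\<close>

private lemma QQ_step:
  assumes xs: "set xs \<subseteq> mm" and x: "x \<in> mm"
  obtains p where "p \<in> module_hom R (QQ xs) (QQ (xs @ [x]))" "p ` carrier (QQ xs) = carrier (QQ (xs @ [x]))"
    "\<forall>u\<in>carrier (QQ xs). p u = \<zero>\<^bsub>QQ (xs @ [x])\<^esub> \<longleftrightarrow> u \<in> (\<lambda>v. x \<odot>\<^bsub>QQ xs\<^esub> v) ` carrier (QQ xs)"
    "\<forall>u\<in>carrier M. p (II xs +>\<^bsub>M\<^esub> u) = II (xs @ [x]) +>\<^bsub>M\<^esub> u"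
proof -
  have xs': "set (xs @ [x]) \<subseteq> mm" using assms by simp
  note I = II_submod[OF xs] and I' = II_submod[OF xs']
  note xc = mm_carrier[OF x]
  have surj: "(\<lambda>u. II xs +>\<^bsub>M\<^esub> u) ` carrier M = carrier (QQ xs)" by (simp add: quot_simps(1)[OF I])
  have k: "II (xs @ [x]) +>\<^bsub>M\<^esub> u = \<zero>\<^bsub>QQ (xs @ [x])\<^esub>"
    if "u \<in> carrier M" "II xs +>\<^bsub>M\<^esub> u = \<zero>\<^bsub>QQ xs\<^esub>" for u
    using that II_mono[OF xs', of xs] by (auto simp: quot_zero_iff[OF I] quot_zero_iff[OF I'])
  obtain p where p: "p \<in> module_hom R (QQ xs) (QQ (xs @ [x]))"
    "\<And>u. u \<in> carrier M \<Longrightarrow> p (II xs +>\<^bsub>M\<^esub> u) = II (xs @ [x]) +>\<^bsub>M\<^esub> u"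
    using hom_factor[OF MM quot_module_module[OF I] quot_module_module[OF I'] quot_proj_hom[OF I] surj
        quot_proj_hom[OF I'] k] by blast
  have "p ` carrier (QQ xs) = carrier (QQ (xs @ [x]))"
    unfolding quot_simps(1)[OF I] quot_simps(1)[OF I'] image_image using p(2) by (rule image_cong[OF refl])
  moreover have "p u = \<zero>\<^bsub>QQ (xs @ [x])\<^esub> \<longleftrightarrow> u \<in> (\<lambda>v. x \<odot>\<^bsub>QQ xs\<^esub> v) ` carrier (QQ xs)"
    if "u \<in> carrier (QQ xs)" for u
  proof -
    obtain u' where u': "u' \<in> carrier M" "u = II xs +>\<^bsub>M\<^esub> u'" using \<open>u \<in> _\<close> unfolding quot_simps(1)[OF I] by blast
    have "p u = \<zero>\<^bsub>QQ (xs @ [x])\<^esub> \<longleftrightarrow> u' \<in> II (xs @ [x])"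
      unfolding u'(2) p(2)[OF u'(1)] by (rule quot_zero_iff[OF I' u'(1)])
    also have "\<dots> \<longleftrightarrow> (\<exists>v\<in>carrier M. u' \<ominus>\<^bsub>M\<^esub> x \<odot>\<^bsub>M\<^esub> v \<in> II xs)"
    proof
      assume "u' \<in> II (xs @ [x])"
      then obtain w v where w: "w \<in> II xs" "v \<in> carrier M" "u' = w \<oplus>\<^bsub>M\<^esub> x \<odot>\<^bsub>M\<^esub> v" using II_snoc[OF xs x] by blast
      have "w \<in> carrier M" using w(1) submodD(2)[OF I] by blast
      then have "u' \<ominus>\<^bsub>M\<^esub> x \<odot>\<^bsub>M\<^esub> v = w" using w xc by (simp add: M.minus_eq M.a_assoc M.r_neg)
      then show "\<exists>v\<in>carrier M. u' \<ominus>\<^bsub>M\<^esub> x \<odot>\<^bsub>M\<^esub> v \<in> II xs"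
        using w(1,2) by (intro bexI[of _ v]) simp_all
    next
      assume "\<exists>v\<in>carrier M. u' \<ominus>\<^bsub>M\<^esub> x \<odot>\<^bsub>M\<^esub> v \<in> II xs"
      then obtain v where v: "v \<in> carrier M" "u' \<ominus>\<^bsub>M\<^esub> x \<odot>\<^bsub>M\<^esub> v \<in> II xs" by blast
      have "u' \<ominus>\<^bsub>M\<^esub> x \<odot>\<^bsub>M\<^esub> v \<oplus>\<^bsub>M\<^esub> x \<odot>\<^bsub>M\<^esub> v \<in> II (xs @ [x])"
        using II_mono[OF xs', of xs] v II_gen[OF xs', of x v] by (intro submodD(4)[OF I']) auto
      then show "u' \<in> II (xs @ [x])" using M.minus_plus_cancel u'(1) v(1) xc by simp
    qed
    also have "\<dots> \<longleftrightarrow> (\<exists>v\<in>carrier M. u = x \<odot>\<^bsub>QQ xs\<^esub> (II xs +>\<^bsub>M\<^esub> v))"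
      unfolding u'(2) using coset_eq_iff[OF I u'(1)] quot_simps(4)[OF I xc] xc by simp
    also have "\<dots> \<longleftrightarrow> u \<in> (\<lambda>v. x \<odot>\<^bsub>QQ xs\<^esub> v) ` carrier (QQ xs)"
      unfolding quot_simps(1)[OF I] by blast
    finally show ?thesis .
  qed
  ultimately show ?thesis using p by (intro that[of p]) simp_all
qed

private lemma QQ_fg: "set xs \<subseteq> mm \<Longrightarrow> fg_module R (QQ xs)"
  by (rule fg_quot[OF fgM II_submod])

private lemma QQ_module: "set xs \<subseteq> mm \<Longrightarrow> module R (QQ xs)"
  by (rule quot_module_module[OF II_submod])

private lemma zero_QQ: "set xs \<subseteq> mm \<Longrightarrow> zero_module (QQ xs) \<longleftrightarrow> carrier M \<subseteq> II xs"
  by (rule zero_quot_iff[OF II_submod])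

text \<open>Nakayama, one element at a time: if M/(xs, x)M were zero, M/(xs)M would equal x times
  itself with x in \<open>mm\<close>.\<close>

private lemma QQ_nonzero:
  assumes xs: "set xs \<subseteq> mm"
  shows "\<not> zero_module (QQ xs)"
  using xs
proof (induction xs rule: rev_induct)
  case Nil
  then show ?case using nzM zero_module_iff[OF MM] zero_QQ[of "[]"] unfolding II_Nil by auto
next
  case (snoc x xs)
  then have xs: "set xs \<subseteq> mm" and x: "x \<in> mm" and xs': "set (xs @ [x]) \<subseteq> mm" by auto
  interpret Q: Module.module R "QQ xs" by (rule QQ_module[OF xs])
  show ?case
  proof
    assume z: "zero_module (QQ (xs @ [x]))"
    obtain p where p: "p \<in> module_hom R (QQ xs) (QQ (xs @ [x]))"
      "\<forall>u\<in>carrier (QQ xs). p u = \<zero>\<^bsub>QQ (xs @ [x])\<^esub> \<longleftrightarrow> u \<in> (\<lambda>v. x \<odot>\<^bsub>QQ xs\<^esub> v) ` carrier (QQ xs)"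
      by (rule QQ_step[OF xs x])
    have "zero_module (QQ xs)"
    proof (rule nakayama[OF QQ_fg[OF xs]])
      fix y assume y: "y \<in> carrier (QQ xs)"
      have "p y = \<zero>\<^bsub>QQ (xs @ [x])\<^esub>" using z hom_closed[OF p(1) y] by (simp add: zero_module_def)
      then obtain v where v: "v \<in> carrier (QQ xs)" "y = x \<odot>\<^bsub>QQ xs\<^esub> v" using p(2) y by blast
      \<comment> \<open>The product of x and v is written as a map from R^1 evaluated at the vector
        (x), to match the hypothesis of \<open>nakayama\<close>.\<close>
      let ?w = "\<lambda>i\<in>{..<Suc 0}. x"
      have w: "?w \<in> {..<Suc 0} \<rightarrow>\<^sub>E carrier R" using x by (simp add: restrict_PiE_iff)
      have "(\<lambda>r. r 0 \<odot>\<^bsub>QQ xs\<^esub> v) \<in> module_hom R (free_module R (Suc 0)) (QQ xs)"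
        using free_coord[where n = "Suc 0" and i = 0] v(1)
        by (intro homI) (simp_all add: free_simps Q.smult_l_distr Q.smult_assoc1)
      then show "\<exists>k g w. g \<in> module_hom R (free_module R k) (QQ xs) \<and> w \<in> {..<k} \<rightarrow>\<^sub>E carrier R \<and>
          (\<forall>j<k. w j \<in> mm) \<and> y = g w"
        using w x v(2) by (intro exI[of _ "Suc 0"] exI[of _ "\<lambda>r. r 0 \<odot>\<^bsub>QQ xs\<^esub> v"] exI[of _ ?w]) simp
    qed
    then show False using snoc.IH[OF xs] by blast
  qed
qed

private definition "reg xs \<longleftrightarrow> set xs \<subseteq> mm \<and> regular_sequence R M xs"

private lemma reg_Nil: "reg []"
  using QQ_nonzero[of "[]"] by (simp add: reg_def regular_sequence_def)

text \<open>The clause of \<open>regular_sequence\<close> about a nonzero quotient holds for every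
  sequence in \<open>mm\<close> by \<open>QQ_nonzero\<close>, so regularity can be checked one
  element at a time.\<close>

private lemma reg_snoc: "reg (xs @ [x]) \<longleftrightarrow> reg xs \<and> x \<in> mm \<and> nonzerodivisor_on x (QQ xs)"
proof
  assume r: "reg (xs @ [x])"
  then have xs: "set xs \<subseteq> mm" "x \<in> mm" by (auto simp: reg_def)
  have nzd: "nonzerodivisor_on ((xs @ [x]) ! i) (QQ (take i (xs @ [x])))" if "i < Suc (length xs)" for i
    using r that by (auto simp: reg_def regular_sequence_def)
  have "nonzerodivisor_on (xs ! i) (QQ (take i xs))" if "i < length xs" for i
    using nzd[of i] that by (simp add: nth_append)
  then show "reg xs \<and> x \<in> mm \<and> nonzerodivisor_on x (QQ xs)"
    using nzd[of "length xs"] xs QQ_nonzero[OF xs(1)] by (simp add: reg_def regular_sequence_def)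
next
  assume r: "reg xs \<and> x \<in> mm \<and> nonzerodivisor_on x (QQ xs)"
  then have s: "set (xs @ [x]) \<subseteq> mm" by (auto simp: reg_def)
  show "reg (xs @ [x])"
    unfolding reg_def regular_sequence_def
  proof (intro conjI allI impI s QQ_nonzero[OF s])
    fix i assume "i < length (xs @ [x])"
    then show "nonzerodivisor_on ((xs @ [x]) ! i) (QQ (take i (xs @ [x])))"
      using r by (cases "i < length xs") (auto simp: reg_def regular_sequence_def nth_append less_Suc_eq)
  qed
qed

text \<open>The quotient by the empty sequence consists of singleton cosets and is not literally M,
  so the start of each induction over sequences needs an isomorphism.\<close>

private lemma Nil_iso:
  obtains u v where "u \<in> module_hom R M (QQ [])" "v \<in> module_hom R (QQ []) M"
    "\<forall>x\<in>carrier M. v (u x) = x" "\<forall>y\<in>carrier (QQ []). u (v y) = y"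
proof -
  have I: "submod R (II []) M" by (rule II_submod) simp
  let ?u = "\<lambda>x. II [] +>\<^bsub>M\<^esub> x"
  have "bij_betw ?u (carrier M) (carrier (QQ []))"
    unfolding bij_betw_def
  proof
    show "inj_on ?u (carrier M)"
      using coset_eq_iff[OF I] M.minus_eq_zero_iff by (auto simp: inj_on_def II_Nil)
  qed (simp add: quot_simps(1)[OF I])
  from bij_hom_inverse[OF MM quot_proj_hom[OF I] this] show ?thesis using that quot_proj_hom[OF I] by metis
qed

private lemma acyclic_at_Nil: "acyclic_at R b d (QQ []) n \<longleftrightarrow> acyclic_at R b d M n"
proof -
  have Q: "module R (QQ [])" by (rule QQ_module) simp
  obtain u v where uv: "u \<in> module_hom R M (QQ [])" "v \<in> module_hom R (QQ []) M"
    "\<forall>x\<in>carrier M. v (u x) = x" "\<forall>y\<in>carrier (QQ []). u (v y) = y" using Nil_iso .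
  show ?thesis
    using acyclic_at_iso[OF MM Q uv(1,2) uv(4)[rule_format]] acyclic_at_iso[OF Q MM uv(2,1) uv(3)[rule_format]] by blast
qed

private lemma reg_extend:
  fixes X :: "('a, 'm) module"
  assumes X: "module R X" "\<not> zero_module X" and P: "minimal_free_resolution R b d \<epsilon> X"
    and xs: "reg xs" and V: "acyclic_at R b d (QQ xs) 0"
  shows "\<exists>x. reg (xs @ [x])"
proof -
  have s: "set xs \<subseteq> mm" using xs by (simp add: reg_def)
  have "no_socle R (QQ xs)" by (rule acyclic_at_0_imp_no_socle[OF X P QQ_module[OF s] V])
  then obtain x where "x \<in> mm" "nonzerodivisor_on x (QQ xs)" using exists_nonzerodivisor[OF QQ_fg[OF s]] by blast
  then show ?thesis using xs reg_snoc by blast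
qed

text \<open>If all Ext^n(X, M) vanished, so would all Ext^n(X, M/(xs)M) for regular xs, and
  vanishing in degree 0 would always allow one more regular element. The submodules (xs)M stabilise,
  so some x would kill the nonzero module M/(xs)M and at the same time be a nonzerodivisor on
  it.\<close>

lemma not_all_acyclic:
  fixes X :: "('a, 'm) module"
  assumes X: "module R X" "\<not> zero_module X" and P: "minimal_free_resolution R b d \<epsilon> X"
  shows "\<exists>n. \<not> acyclic_at R b d M n"
proof (rule ccontr)
  assume "\<not> ?thesis"
  then have V: "acyclic_at R b d M n" for n by blast
  have VQ: "\<forall>n. acyclic_at R b d (QQ xs) n" if "reg xs" for xs
    using that
  proof (induction xs rule: rev_induct)
    case Nil
    then show ?case using V by (simp add: acyclic_at_Nil)
  next
    case (snoc x xs)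
    then have xs: "reg xs" "x \<in> mm" "nonzerodivisor_on x (QQ xs)" "set xs \<subseteq> mm" "set (xs @ [x]) \<subseteq> mm"
      unfolding reg_snoc by (auto simp: reg_def)
    obtain p where p: "p \<in> module_hom R (QQ xs) (QQ (xs @ [x]))" "p ` carrier (QQ xs) = carrier (QQ (xs @ [x]))"
      "\<forall>u\<in>carrier (QQ xs). p u = \<zero>\<^bsub>QQ (xs @ [x])\<^esub> \<longleftrightarrow> u \<in> (\<lambda>v. x \<odot>\<^bsub>QQ xs\<^esub> v) ` carrier (QQ xs)"
      by (rule QQ_step[OF xs(4,2)])
    show ?case
      using acyclic_at_mod_regular[OF QQ_module[OF xs(4)] QQ_module[OF xs(5)] xs(2,3) p(1,2) p(3)[rule_format] mfr_free[OF P]]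
        snoc.IH[OF xs(1)] by blast
  qed
  define S where "S xs = xs @ [SOME x. reg (xs @ [x])]" for xs
  have S: "reg (S xs)" if "reg xs" for xs
    unfolding S_def using reg_extend[OF X P that] VQ[OF that] someI_ex[of "\<lambda>x. reg (xs @ [x])"] by blast
  define s where "s n = (S ^^ n) []" for n
  have s: "reg (s n)" for n by (induction n) (simp_all add: s_def reg_Nil S)
  have sm: "set (s n) \<subseteq> mm" for n using s by (simp add: reg_def)
  have sS: "s (Suc n) = s n @ [SOME x. reg (s n @ [x])]" for n by (simp add: s_def S_def)
  have mono: "II (s n) \<subseteq> II (s (Suc n))" for n by (rule II_mono[OF sm]) (auto simp: sS)
  have "\<exists>k. II (s (Suc k)) = II (s k)"
    by (rule ascending_chain_stabilizes[OF fgM], rule II_submod[OF sm], rule mono)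
  then obtain k where k: "II (s (Suc k)) = II (s k)" ..
  define x where "x = (SOME x. reg (s k @ [x]))"
  have sk: "s (Suc k) = s k @ [x]" by (simp add: sS x_def)
  then have x: "x \<in> mm" "nonzerodivisor_on x (QQ (s k))" using s[of "Suc k"] reg_snoc by auto
  note I = II_submod[OF sm[of k]]
  have "carrier M \<subseteq> II (s k)"
  proof
    fix u assume u: "u \<in> carrier M"
    have "x \<odot>\<^bsub>M\<^esub> u \<in> II (s k)" using II_gen[OF sm[of "Suc k"], of x u] k sk u by simp
    then have "x \<odot>\<^bsub>QQ (s k)\<^esub> (II (s k) +>\<^bsub>M\<^esub> u) = \<zero>\<^bsub>QQ (s k)\<^esub>"
      using quot_simps(4)[OF I mm_carrier[OF x(1)] u] quot_zero_iff[OF I, of "x \<odot>\<^bsub>M\<^esub> u"] u x(1) by simp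
    then have "II (s k) +>\<^bsub>M\<^esub> u = \<zero>\<^bsub>QQ (s k)\<^esub>"
      using x(2) u unfolding nonzerodivisor_on_def quot_simps(1)[OF I] by blast
    then show "u \<in> II (s k)" using quot_zero_iff[OF I u] by blast
  qed
  then show False using QQ_nonzero[OF sm[of k]] zero_QQ[OF sm[of k]] by blast
qed

text \<open>Dividing by a regular sequence of length l lowers the range of vanishing by l. Hence no
  regular sequence is longer than the first degree n of nonvanishing, and every shorter one can be
  extended, because Ext^0 of its quotient still vanishes. Applied later with X the residue
  field.\<close>

lemma depth_char:
  fixes X :: "('a, 'm) module"
  assumes X: "module R X" "\<not> zero_module X" and P: "minimal_free_resolution R b d \<epsilon> X"
    and mX: "\<And>r x. r \<in> mm \<Longrightarrow> x \<in> carrier X \<Longrightarrow> r \<odot>\<^bsub>X\<^esub> x = \<zero>\<^bsub>X\<^esub>"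
  obtains n where "depth R M = enat n" "\<forall>j<n. acyclic_at R b d M j" "\<not> acyclic_at R b d M n"
proof -
  define n where "n = (LEAST n. \<not> acyclic_at R b d M n)"
  have n1: "\<not> acyclic_at R b d M n" unfolding n_def by (rule LeastI_ex[OF not_all_acyclic[OF X P]])
  have n2: "\<forall>j<n. acyclic_at R b d M j" unfolding n_def using not_less_Least by blast
  have Q: "(\<forall>j<m. acyclic_at R b d (QQ xs) j) \<longleftrightarrow> (\<forall>j<m + length xs. acyclic_at R b d M j)" if "reg xs" for xs m
    using that
  proof (induction xs arbitrary: m rule: rev_induct)
    case Nil
    then show ?case by (simp add: acyclic_at_Nil)
  next
    case (snoc x xs)
    then have xs: "reg xs" "x \<in> mm" "nonzerodivisor_on x (QQ xs)" "set xs \<subseteq> mm" "set (xs @ [x]) \<subseteq> mm"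
      unfolding reg_snoc by (auto simp: reg_def)
    obtain p where p: "p \<in> module_hom R (QQ xs) (QQ (xs @ [x]))" "p ` carrier (QQ xs) = carrier (QQ (xs @ [x]))"
      "\<forall>u\<in>carrier (QQ xs). p u = \<zero>\<^bsub>QQ (xs @ [x])\<^esub> \<longleftrightarrow> u \<in> (\<lambda>v. x \<odot>\<^bsub>QQ xs\<^esub> v) ` carrier (QQ xs)"
      by (rule QQ_step[OF xs(4,2)])
    have "(\<forall>j<m. acyclic_at R b d (QQ (xs @ [x])) j) \<longleftrightarrow> (\<forall>j<Suc m. acyclic_at R b d (QQ xs) j)"
      by (rule acyclic_below_mod_regular[OF QQ_module[OF xs(4)] QQ_module[OF xs(5)] xs(2,3) p(1,2)
            p(3)[rule_format] X(1) mfr_free[OF P] mX])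
    then show ?case using snoc.IH[OF xs(1)] by simp
  qed
  have len: "length xs \<le> n" if "reg xs" for xs
  proof -
    have "\<forall>j<length xs. acyclic_at R b d M j" using Q[OF that, of 0] by simp
    then show ?thesis using n1 not_le by blast
  qed
  have "\<exists>xs. reg xs \<and> length xs = k" if "k \<le> n" for k
    using that
  proof (induction k)
    case 0
    then show ?case using reg_Nil by blast
  next
    case (Suc k)
    then obtain xs where xs: "reg xs" "length xs = k" by auto
    have "\<forall>j<1 + length xs. acyclic_at R b d M j" using n2 Suc.prems xs(2) by auto
    then have "acyclic_at R b d (QQ xs) 0" using Q[OF xs(1), of 1] by blast
    then obtain x where "reg (xs @ [x])" using reg_extend[OF X P xs(1)] by blast
    then show ?case using xs(2) by (intro exI[of _ "xs @ [x]"]) simp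
  qed
  then obtain xs where xs: "reg xs" "length xs = n" by blast
  have "depth R M = Sup {enat (length xs) | xs. reg xs}"
    using nzM by (simp add: depth_def reg_def)
  also have "\<dots> = enat n"
  proof (rule antisym)
    show "Sup {enat (length xs) | xs. reg xs} \<le> enat n" by (rule Sup_least) (use len in auto)
    show "enat n \<le> Sup {enat (length xs) | xs. reg xs}" by (rule Sup_upper) (use xs in auto)
  qed
  finally show ?thesis using that n1 n2 by blast
qed

end

end

section \<open>The Auslander-Buchsbaum formula\<close>

context cring
begin

lemma cobdry_finsum:
  fixes N :: "('a, 'n) module"
  assumes N: "module R N" and "finite A"
    and "\<And>i. i \<in> A \<Longrightarrow> f i \<in> module_hom R (free_module R (b n)) N"
    and "\<And>i. i \<in> A \<Longrightarrow> cobdry R b d N n (f i)"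
  shows "cobdry R b d N n (\<lambda>x. \<Oplus>\<^bsub>N\<^esub>i\<in>A. f i x)"
  using assms(2-4)
proof (induction A)
  case empty
  interpret N: Module.module R N by fact
  show ?case
    by (cases n) (auto simp: cobdry_0 cobdry_Suc intro!: bexI[OF _ hom_const_zero[OF N]])
next
  case (insert a A)
  interpret N: Module.module R N by fact
  have "cobdry R b d N n (f a)" "cobdry R b d N n (\<lambda>x. \<Oplus>\<^bsub>N\<^esub>i\<in>A. f i x)"
    using insert.prems insert.IH by simp_all
  from cobdry_plus[OF N this] show ?case
  proof (rule cobdry_cong)
    fix x assume x: "x \<in> carrier (free_module R (b n))"
    have "f i x \<in> carrier N" if "i \<in> insert a A" for i by (rule hom_closed[OF insert.prems(1)[OF that] x])
    then show "(\<Oplus>\<^bsub>N\<^esub>i\<in>insert a A. f i x) = f a x \<oplus>\<^bsub>N\<^esub> (\<Oplus>\<^bsub>N\<^esub>i\<in>A. f i x)"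
      using insert.hyps by (intro N.finsum_insert) auto
  qed
qed

lemma cobdry_coords:
  assumes v: "v \<in> module_hom R (free_module R (b n)) (free_module R k)"
    and c: "\<And>i. i < k \<Longrightarrow> cobdry R b d (ring_module R) n (\<lambda>x. v x i)"
  shows "cobdry R b d (free_module R k) n v"
proof (cases n)
  case 0
  have "v x = \<zero>\<^bsub>free_module R k\<^esub>" if x: "x \<in> carrier (free_module R (b 0))" for x
  proof (rule free_eqI[of _ k])
    show "v x \<in> {..<k} \<rightarrow>\<^sub>E carrier R" using hom_closed[OF v] x 0 by (simp add: free_simps)
    show "\<zero>\<^bsub>free_module R k\<^esub> \<in> {..<k} \<rightarrow>\<^sub>E carrier R" using free_zero_closed[of k] by (simp only: free_simps(1))
    show "v x i = \<zero>\<^bsub>free_module R k\<^esub> i" if "i < k" for i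
      using c[OF that] x that unfolding 0 cobdry_0 by (simp add: free_simps)
  qed
  then show ?thesis unfolding 0 cobdry_0 by blast
next
  case (Suc m)
  have "\<forall>i. \<exists>g. i < k \<longrightarrow> g \<in> module_hom R (free_module R (b m)) (ring_module R) \<and>
      (\<forall>x\<in>carrier (free_module R (b (Suc m))). v x i = g (d m x))"
    using c unfolding Suc cobdry_Suc by blast
  then obtain g where g: "\<And>i. i < k \<Longrightarrow> g i \<in> module_hom R (free_module R (b m)) (ring_module R)"
    "\<And>i x. i < k \<Longrightarrow> x \<in> carrier (free_module R (b (Suc m))) \<Longrightarrow> v x i = g i (d m x)" by metis
  have "v x = (\<lambda>i\<in>{..<k}. g i (d m x))" if x: "x \<in> carrier (free_module R (b (Suc m)))" for x
  proof (rule ext)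
    fix i
    have "v x \<in> {..<k} \<rightarrow>\<^sub>E carrier R" using hom_closed[OF v] x Suc by (simp add: free_simps)
    then have "v x i = undefined" if "\<not> i < k" by (rule PiE_arb) (use that in simp)
    then show "v x i = (\<lambda>i\<in>{..<k}. g i (d m x)) i" using g(2)[OF _ x] by (cases "i < k") simp_all
  qed
  then show ?thesis
    unfolding Suc cobdry_Suc by (intro bexI[OF _ tuple_hom[OF free_module_module g(1)]]) auto
qed

lemma cocycle_comp:
  assumes "module R N" "module R N'" "h \<in> module_hom R N N'" "cocycle R b d N n f"
  shows "cocycle R b d N' n (\<lambda>x. h (f x))"
  using assms(4) hom_zero[OF assms(1-3)] by (auto simp: cocycle_def intro: hom_comp[OF _ assms(3)])

lemma acyclic_at_free:
  assumes "acyclic_at R b d (ring_module R) n"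
  shows "acyclic_at R b d (free_module R k) n"
  unfolding acyclic_at_def
proof (intro allI impI)
  fix v assume v: "cocycle R b d (free_module R k) n v"
  show "cobdry R b d (free_module R k) n v"
  proof (rule cobdry_coords)
    show "v \<in> module_hom R (free_module R (b n)) (free_module R k)" using v by (simp add: cocycle_def)
    show "cobdry R b d (ring_module R) n (\<lambda>x. v x i)" if "i < k" for i
      using cocycle_comp[OF free_module_module ring_module_module coord_hom[OF that] v] assms
      by (simp add: acyclic_at_def)
  qed
qed

text \<open>R is a direct summand of R^k by way of the first basis vector and the first
  coordinate.\<close>

lemma acyclic_at_free_conv:
  assumes V: "acyclic_at R b d (free_module R k) n" and k: "0 < k"
  shows "acyclic_at R b d (ring_module R) n"
proof -
  interpret F: Module.module R "free_module R k" by (rule free_module_module)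
  let ?e = "unitv R k 0"
  have e: "?e \<in> carrier (free_module R k)" by (simp add: free_simps)
  have h: "(\<lambda>r. r \<odot>\<^bsub>free_module R k\<^esub> ?e) \<in> module_hom R (ring_module R) (free_module R k)"
    by (rule homI) (simp_all add: e F.smult_l_distr F.smult_assoc1)
  show ?thesis
    unfolding acyclic_at_def
  proof (intro allI impI)
    fix f assume f: "cocycle R b d (ring_module R) n f"
    have "cobdry R b d (free_module R k) n (\<lambda>x. f x \<odot>\<^bsub>free_module R k\<^esub> ?e)"
      using V cocycle_comp[OF ring_module_module free_module_module h f] by (simp add: acyclic_at_def)
    from cobdry_comp[OF free_module_module ring_module_module coord_hom[OF k] this]
    show "cobdry R b d (ring_module R) n f"
    proof (rule cobdry_cong)
      fix x assume "x \<in> carrier (free_module R (b n))"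
      then have "f x \<in> carrier R" using f hom_closed by (fastforce simp: cocycle_def)
      then show "f x = (f x \<odot>\<^bsub>free_module R k\<^esub> ?e) 0" using k by (simp add: free_simps unitv_apply)
    qed
  qed
qed

end

context noeth_local
begin

text \<open>The coordinates of g v are combinations of those of v with coefficients in
  \<open>mm\<close>, and such multiples of cocycles are coboundaries because \<open>mm\<close> kills
  X. In short, a matrix over \<open>mm\<close> acts as zero on Ext(X, -).\<close>

lemma cobdry_minimal:
  fixes X :: "('a, 'm) module"
  assumes X: "module R X" and P: "free_resolution R b d \<epsilon> X"
    and mX: "\<And>r x. r \<in> mm \<Longrightarrow> x \<in> carrier X \<Longrightarrow> r \<odot>\<^bsub>X\<^esub> x = \<zero>\<^bsub>X\<^esub>"
    and g: "g \<in> module_hom R (free_module R k) (free_module R l)"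
      "\<And>x i. x \<in> carrier (free_module R k) \<Longrightarrow> i < l \<Longrightarrow> g x i \<in> mm"
    and v: "cocycle R b d (free_module R k) n v"
  shows "cobdry R b d (free_module R l) n (\<lambda>x. g (v x))"
proof (rule cobdry_coords)
  have v1: "v \<in> module_hom R (free_module R (b n)) (free_module R k)" using v by (simp add: cocycle_def)
  show "(\<lambda>x. g (v x)) \<in> module_hom R (free_module R (b n)) (free_module R l)" by (rule hom_comp[OF v1 g(1)])
  fix i assume i: "i < l"
  let ?c = "\<lambda>j. g (unitv R k j) i"
  have c: "?c j \<in> mm" for j by (rule g(2)[OF unitv_in i])
  let ?f = "\<lambda>j x. ?c j \<odot>\<^bsub>ring_module R\<^esub> v x j"
  have vj: "cocycle R b d (ring_module R) n (\<lambda>x. v x j)" if "j < k" for j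
    by (rule cocycle_comp[OF free_module_module ring_module_module coord_hom[OF that] v])
  have fh: "?f j \<in> module_hom R (free_module R (b n)) (ring_module R)" if "j < k" for j
    using vj[OF that] mm_carrier[OF c] by (intro hom_scale[OF ring_module_module]) (simp_all add: cocycle_def)
  have fc: "cobdry R b d (ring_module R) n (?f j)" if "j < k" for j
    by (rule cobdry_annihilated[OF X ring_module_module P mm_carrier[OF c] mX[OF c] vj[OF that]])
  have "cobdry R b d (ring_module R) n (\<lambda>x. \<Oplus>\<^bsub>ring_module R\<^esub>j\<in>{..<k}. ?f j x)"
    by (rule cobdry_finsum[OF ring_module_module]) (use fh fc in auto)
  then show "cobdry R b d (ring_module R) n (\<lambda>x. g (v x) i)"
  proof (rule cobdry_cong)
    interpret I: Module.module R "ring_module R" by (rule ring_module_module)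
    fix x assume x: "x \<in> carrier (free_module R (b n))"
    have vx: "v x \<in> {..<k} \<rightarrow>\<^sub>E carrier R" using hom_closed[OF v1 x] by (simp add: free_simps)
    have "g (v x) i = lin (ring_module R) k ?c (v x)"
      by (rule hom_free_lin[OF ring_module_module hom_comp[OF g(1) coord_hom[OF i]] vx])
    also have "\<dots> = (\<Oplus>\<^bsub>ring_module R\<^esub>j\<in>{..<k}. ?f j x)"
      unfolding lin_def
    proof (rule I.finsum_cong'[OF refl])
      show "(\<lambda>j. ?f j x) \<in> {..<k} \<rightarrow> carrier (ring_module R)"
        using free_coord[OF vx] mm_carrier[OF c] by simp
      show "v x j \<odot>\<^bsub>ring_module R\<^esub> ?c j = ?f j x" if "j \<in> {..<k}" for j
        using free_coord[OF vx, of j] mm_carrier[OF c] that m_comm by simp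
    qed
    finally show "g (v x) i = (\<Oplus>\<^bsub>ring_module R\<^esub>j\<in>{..<k}. ?f j x)" .
  qed
qed

section \<open>The residue field as first argument of Ext\<close>

lemma residue_fg: "fg_module R (residue_module R)"
  unfolding residue_module_def by (rule fg_quot[OF fg_ring mm_submod])

lemma residue_module_module: "module R (residue_module R)"
  using residue_fg by (simp add: fg_module_def)

lemma residue_nonzero: "\<not> zero_module (residue_module R)"
  unfolding residue_module_def zero_quot_iff[OF mm_submod] using one_notin_mm by auto

lemma residue_annihilated:
  assumes r: "r \<in> mm" and x: "x \<in> carrier (residue_module R)"
  shows "r \<odot>\<^bsub>residue_module R\<^esub> x = \<zero>\<^bsub>residue_module R\<^esub>"
proof -
  obtain y where y: "y \<in> carrier (ring_module R)" "x = mm +>\<^bsub>ring_module R\<^esub> y"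
    using x unfolding residue_module_def quot_simps(1)[OF mm_submod] by blast
  have "r \<odot>\<^bsub>ring_module R\<^esub> y \<in> mm" using mm_mult_right[OF r] y(1) by simp
  then show ?thesis
    unfolding residue_module_def y(2) quot_simps(4)[OF mm_submod mm_carrier[OF r] y(1)]
    using quot_zero_iff[OF mm_submod, of "r \<odot>\<^bsub>ring_module R\<^esub> y"] mm_carrier[OF r] y(1) by simp
qed

definition residue_ext_zero :: "('a, 'k) module \<Rightarrow> nat \<Rightarrow> bool" where
  "residue_ext_zero N n \<longleftrightarrow> acyclic_at R (fst (min_res R (residue_module R))) (snd (min_res R (residue_module R))) N n"

lemma depth_residue_ext:
  fixes M :: "('a, 'n) module"
  assumes "fg_module R M" "\<not> zero_module M"
  obtains n where "depth R M = enat n" "\<forall>j<n. residue_ext_zero M j" "\<not> residue_ext_zero M n"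
proof -
  obtain \<epsilon> where "minimal_free_resolution R (fst (min_res R (residue_module R)))
      (snd (min_res R (residue_module R))) \<epsilon> (residue_module R)"
    by (rule min_res_props[OF residue_fg])
  from depth_char[OF assms residue_module_module residue_nonzero this residue_annihilated]
  show ?thesis using that unfolding residue_ext_zero_def by metis
qed

text \<open>One resolution of the residue field has to serve modules of several types in the same
  argument. Since types cannot be quantified, the characterisation is repeated for three type
  variables.\<close>

lemma residue_ext_zero_resolution:
  obtains b d \<epsilon> where "free_resolution R b d \<epsilon> (residue_module R)"
    "\<forall>(N :: ('a, 'k) module) n. residue_ext_zero N n \<longleftrightarrow> acyclic_at R b d N n"
    "\<forall>(N :: ('a, 'l) module) n. residue_ext_zero N n \<longleftrightarrow> acyclic_at R b d N n"
    "\<forall>(N :: ('a, 'n) module) n. residue_ext_zero N n \<longleftrightarrow> acyclic_at R b d N n"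
proof -
  obtain \<epsilon> where "minimal_free_resolution R (fst (min_res R (residue_module R)))
      (snd (min_res R (residue_module R))) \<epsilon> (residue_module R)"
    by (rule min_res_props[OF residue_fg])
  from mfr_free[OF this] show ?thesis by (rule that) (simp_all add: residue_ext_zero_def)
qed

text \<open>The depth drops by one from \<open>Z\<close> to \<open>Y\<close> because some class of \<open>Ext(k, Z)\<close> dies in \<open>Ext(k, F)\<close>.\<close>

lemma depth_step:
  fixes Z :: "('a, 'k) module" and F :: "('a, 'l) module" and Y :: "('a, 'n) module"
    and X :: "('a, 'm) module"
  assumes P: "free_resolution R b d \<epsilon> X"
    and Z: "module R Z" and F: "module R F" and Y: "module R Y"
    and i: "i \<in> module_hom R Z F" and i_inj: "\<And>z. z \<in> carrier Z \<Longrightarrow> i z = \<zero>\<^bsub>F\<^esub> \<Longrightarrow> z = \<zero>\<^bsub>Z\<^esub>"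
    and p: "p \<in> module_hom R F Y" and p_surj: "p ` carrier F = carrier Y"
    and exact: "\<And>x. x \<in> carrier F \<Longrightarrow> p x = \<zero>\<^bsub>Y\<^esub> \<longleftrightarrow> x \<in> i ` carrier Z"
    and VF: "\<forall>j<q. acyclic_at R b d F j" and VZ: "\<forall>j<n. acyclic_at R b d Z j" and nq: "n \<le> q"
    and v: "cocycle R b d Z n v" "\<not> cobdry R b d Z n v" "cobdry R b d F n (\<lambda>x. i (v x))"
  shows "\<exists>m. n = Suc m \<and> (\<forall>j<m. acyclic_at R b d Y j) \<and> \<not> acyclic_at R b d Y m"
proof (cases n)
  case 0
  have v1: "v \<in> module_hom R (free_module R (b 0)) Z" using v(1) 0 by (simp add: cocycle_def)
  have "cobdry R b d Z n v"
    using v(3) i_inj[OF hom_closed[OF v1]] unfolding 0 cobdry_0 by blast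
  then show ?thesis using v(2) by blast
next
  case (Suc m)
  have v1: "v \<in> module_hom R (free_module R (b (Suc m))) Z" using v(1) Suc by (simp add: cocycle_def)
  have "acyclic_at R b d Y j" if "j < m" for j
  proof (rule acyclic_at_quotient[OF P Z F Y i i_inj p p_surj exact])
    show "acyclic_at R b d F j" using VF that nq Suc by simp
    show "acyclic_at R b d Z (Suc j)" using VZ that Suc by simp
  qed
  moreover have "\<not> acyclic_at R b d Y m"
  proof
    assume V: "acyclic_at R b d Y m"
    have "cobdry R b d Z (Suc m) v"
      by (rule cobdry_sub[OF P Z F Y i i_inj p p_surj exact V v1]) (use v(3) Suc in simp_all)
    then show False using v(2) Suc by simp
  qed
  ultimately show ?thesis using Suc by blast
qed

lemma acyclic_at_bij:
  fixes N :: "('a, 'k) module" and N' :: "('a, 'l) module"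
  assumes N: "module R N" and N': "module R N'" and f: "f \<in> module_hom R N N'"
    and bij: "bij_betw f (carrier N) (carrier N')"
  shows "acyclic_at R b d N' n \<longleftrightarrow> acyclic_at R b d N n"
proof -
  obtain g where g: "g \<in> module_hom R N' N" "\<And>x. x \<in> carrier N \<Longrightarrow> g (f x) = x"
    "\<And>y. y \<in> carrier N' \<Longrightarrow> f (g y) = y" using bij_hom_inverse[OF N f bij] by metis
  show ?thesis using acyclic_at_iso[OF N N' f g(1) g(3)] acyclic_at_iso[OF N' N g(1) f g(2)] by blast
qed

lemma inj_hom_bij:
  assumes N: "module R N" "module R N'" and f: "f \<in> module_hom R N N'" and surj: "f ` carrier N = U"
    and inj: "\<And>x. x \<in> carrier N \<Longrightarrow> f x = \<zero>\<^bsub>N'\<^esub> \<Longrightarrow> x = \<zero>\<^bsub>N\<^esub>"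
  shows "bij_betw f (carrier N) U"
proof -
  interpret N: Module.module R N by fact
  interpret N': Module.module R N' by fact
  have "x = y" if "x \<in> carrier N" "y \<in> carrier N" "f x = f y" for x y
  proof -
    have "f (x \<ominus>\<^bsub>N\<^esub> y) = \<zero>\<^bsub>N'\<^esub>"
      unfolding hom_minus[OF N f that(1,2)] using N'.minus_eq_zero_iff hom_closed[OF f] that by simp
    then show ?thesis using inj[of "x \<ominus>\<^bsub>N\<^esub> y"] that N.minus_eq_zero_iff by simp
  qed
  then show ?thesis using surj by (auto simp: bij_betw_def inj_on_def)
qed

section \<open>Modules whose minimal resolution ends in degree p\<close>

context
  fixes X :: "('a, 'n) module" and b d \<epsilon> and p :: nat
  assumes X: "fg_module R X" and P: "minimal_free_resolution R b d \<epsilon> X"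
    and bp: "0 < b p" and bz: "\<And>i. p < i \<Longrightarrow> b i = 0"
begin

private lemma XM: "module R X"
  using X by (simp add: fg_module_def)

private lemmas r = resolutionD[OF mfr_free[OF P]]
private lemmas FM = free_module_module

private abbreviation "FF i \<equiv> free_module R (b i)"

private lemma Fz: "p < i \<Longrightarrow> x \<in> carrier (FF i) \<Longrightarrow> x = \<zero>\<^bsub>FF i\<^esub>"
  using free_0[of x] bz[of i] by simp

lemma acyclic_above_length:
  fixes N :: "('a, 'k) module"
  assumes N: "module R N" and n: "p < n"
  shows "acyclic_at R b d N n"
  unfolding acyclic_at_def
proof (intro allI impI)
  fix f assume "cocycle R b d N n f"
  then have f: "f \<in> module_hom R (FF n) N" by (simp add: cocycle_def)
  obtain m where m: "n = Suc m" using n by (cases n) auto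
  have "f x = \<zero>\<^bsub>N\<^esub>" if "x \<in> carrier (FF n)" for x using Fz[OF n that] hom_zero[OF FM N f] by simp
  then show "cobdry R b d N n f" unfolding m cobdry_Suc by (intro bexI[OF _ hom_const_zero[OF N]]) blast
qed

text \<open>In the last degree every map is a cocycle, in particular the one sending x to x_0 y. If
  it is a coboundary, it factors through the minimal differential (or is zero when p = 0), so y
  comes from a vector over \<open>mm\<close>. For all y at once this contradicts Nakayama.\<close>

lemma not_acyclic_at_length:
  fixes N :: "('a, 'k) module"
  assumes N: "fg_module R N" "\<not> zero_module N"
  shows "\<not> acyclic_at R b d N p"
proof
  assume V: "acyclic_at R b d N p"
  have NM: "module R N" using N(1) by (simp add: fg_module_def)
  interpret N: Module.module R N by fact
  have "zero_module N"
  proof (rule nakayama[OF N(1)])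
    fix y assume y: "y \<in> carrier N"
    let ?f = "\<lambda>x. x 0 \<odot>\<^bsub>N\<^esub> y"
    have fh: "?f \<in> module_hom R (FF p) N"
      using free_coord[OF _ bp] bp by (intro homI) (simp_all add: free_simps y N.smult_l_distr N.smult_assoc1)
    have "?f (d p x) = \<zero>\<^bsub>N\<^esub>" if x: "x \<in> carrier (FF (Suc p))" for x
    proof -
      have "d p x = \<zero>\<^bsub>FF p\<^esub>" using Fz[OF _ x] hom_zero[OF FM FM r(2)] by simp
      then show ?thesis using bp y by (simp add: free_simps)
    qed
    then have "cobdry R b d N p ?f" using V fh by (simp add: acyclic_at_def cocycle_def)
    moreover have fe: "?f (unitv R (b p) 0) = y" using bp y by (simp add: unitv_apply)
    ultimately show "\<exists>k g w. g \<in> module_hom R (free_module R k) N \<and> w \<in> {..<k} \<rightarrow>\<^sub>E carrier R \<and>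
        (\<forall>j<k. w j \<in> mm) \<and> y = g w"
    proof (cases p)
      case 0
      then have "y = \<zero>\<^bsub>N\<^esub>" using \<open>cobdry R b d N p ?f\<close> fe unitv_in unfolding cobdry_0 0 by metis
      moreover have "(\<lambda>i\<in>{..<0}. \<zero>) \<in> {..<0} \<rightarrow>\<^sub>E carrier R" by simp
      ultimately show ?thesis using hom_const_zero[OF NM, of "free_module R 0"]
        by (intro exI[of _ "0::nat"] exI[of _ "\<lambda>x. \<zero>\<^bsub>N\<^esub>"]) auto
    next
      case (Suc m)
      obtain g where g: "g \<in> module_hom R (FF m) N" "\<And>x. x \<in> carrier (FF (Suc m)) \<Longrightarrow> ?f x = g (d m x)"
        using \<open>cobdry R b d N p ?f\<close> unfolding Suc cobdry_Suc by blast
      let ?w = "d m (unitv R (b p) 0)"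
      have e: "unitv R (b p) 0 \<in> carrier (FF (Suc m))" using unitv_in Suc by simp
      have "?w \<in> {..<b m} \<rightarrow>\<^sub>E carrier R" using hom_closed[OF r(2) e] by (simp add: free_simps)
      moreover have "\<forall>j<b m. ?w j \<in> mm" using mfr_mm[OF P e] by blast
      moreover have "y = g ?w" using g(2)[OF e] fe by simp
      ultimately show ?thesis using g(1) by blast
    qed
  qed
  then show False using N(2) by blast
qed

text \<open>The syzygy of order i + 1, realised inside \<open>FF i\<close>.\<close>

private abbreviation "ZM i \<equiv> (FF i)\<lparr>carrier := d i ` carrier (FF (Suc i))\<rparr>"

private lemma ZM_submod: "submod R (d i ` carrier (FF (Suc i))) (FF i)"
  by (rule submod_image[OF FM FM r(2)])

private lemma ZM_module: "module R (ZM i)"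
  by (rule submod_module[OF ZM_submod])

private lemma d_onto: "d i \<in> module_hom R (FF (Suc i)) (ZM i)" "d i ` carrier (FF (Suc i)) = carrier (ZM i)"
  by (auto intro!: hom_into_submod[OF r(2)])

private lemma d_exact: "x \<in> carrier (FF (Suc i)) \<Longrightarrow> d i x = \<zero>\<^bsub>ZM i\<^esub> \<longleftrightarrow> x \<in> (\<lambda>z. z) ` carrier (ZM (Suc i))"
  using r(6)[of _ i] r(8)[of x i] by auto

private lemma eps_exact: "x \<in> carrier (FF 0) \<Longrightarrow> \<epsilon> x = \<zero>\<^bsub>X\<^esub> \<longleftrightarrow> x \<in> (\<lambda>z. z) ` carrier (ZM 0)"
  using r(5) r(7)[of x] by auto

text \<open>From the last syzygy, a free module whose Ext(k, -) starts in degree q, down to X, the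
  starting degree falls by one at each of p steps. The first step needs that a minimal inclusion of
  a free module is zero on Ext(k, -); afterwards the degree is below q, where Ext(k,
  \<open>FF i\<close>) vanishes anyway.\<close>

lemma auslander_buchsbaum_residue_ext:
  assumes q: "\<forall>j<q. residue_ext_zero (ring_module R) j" "\<not> residue_ext_zero (ring_module R) q"
  shows "\<exists>n. n + p = q \<and> (\<forall>j<n. residue_ext_zero X j) \<and> \<not> residue_ext_zero X n"
proof -
  obtain kb kd \<kappa> where k: "free_resolution R kb kd \<kappa> (residue_module R)"
    "\<forall>(N :: ('a, 'a) module) n. residue_ext_zero N n \<longleftrightarrow> acyclic_at R kb kd N n"
    "\<forall>(N :: ('a, 'n) module) n. residue_ext_zero N n \<longleftrightarrow> acyclic_at R kb kd N n"
    by (rule residue_ext_zero_resolution)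
  let ?A = "\<lambda>N. acyclic_at R kb kd N"
  have q1: "\<forall>j<q. acyclic_at R kb kd (free_module R m) j" for m
    using q(1) acyclic_at_free k(2) by blast
  have q2: "\<not> acyclic_at R kb kd (free_module R m) q" if "0 < m" for m
    using q(2) acyclic_at_free_conv[OF _ that] k(2) by blast
  have "\<exists>n. n + p = q \<and> (\<forall>j<n. acyclic_at R kb kd X j) \<and> \<not> acyclic_at R kb kd X n"
  proof (cases p)
    case 0
    have "bij_betw \<epsilon> (carrier (FF 0)) (carrier X)"
    proof (rule inj_hom_bij[OF FM XM r(3,4)])
      fix x assume x: "x \<in> carrier (FF 0)" "\<epsilon> x = \<zero>\<^bsub>X\<^esub>"
      then obtain y where "y \<in> carrier (FF (Suc 0))" "x = d 0 y" using r(7) by blast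
      then show "x = \<zero>\<^bsub>FF 0\<^esub>" using Fz[of "Suc 0" y] 0 hom_zero[OF FM FM r(2)] by simp
    qed
    note iso = acyclic_at_bij[OF FM XM r(3) this]
    show ?thesis using q1 q2 bp 0 by (intro exI[of _ q]) (simp add: iso)
  next
    case (Suc p')
    \<comment> \<open>\<open>E i\<close> says that Ext(k, \<open>ZM i\<close>) starts in degree q -
      (p' - i), and that some nonzero class there dies in \<open>FF i\<close>. The second half is
      what \<open>depth_step\<close> consumes.\<close>
    define E where "E i \<longleftrightarrow> (\<exists>n v. n + (p' - i) = q \<and> (\<forall>j<n. acyclic_at R kb kd (ZM i) j) \<and>
        cocycle R kb kd (ZM i) n v \<and> \<not> cobdry R kb kd (ZM i) n v \<and> cobdry R kb kd (FF i) n v)" for i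
    have step: "\<exists>m. n = Suc m \<and> (\<forall>j<m. acyclic_at R kb kd (ZM i) j) \<and> \<not> acyclic_at R kb kd (ZM i) m"
      if "n \<le> q" "\<forall>j<n. acyclic_at R kb kd (ZM (Suc i)) j" "cocycle R kb kd (ZM (Suc i)) n v"
        "\<not> cobdry R kb kd (ZM (Suc i)) n v" "cobdry R kb kd (FF (Suc i)) n v" for i n v
      by (rule depth_step[where i = "\<lambda>x. x" and Z = "ZM (Suc i)" and F = "FF (Suc i)" and Y = "ZM i"
            and p = "d i" and q = q and v = v, OF k(1) ZM_module FM ZM_module hom_from_submod[OF ZM_submod] _ d_onto d_exact
            q1 that(2,1,3,4,5)]) simp_all
    have base: "E p'"
    proof -
      have bij: "bij_betw (d p') (carrier (FF (Suc p'))) (carrier (ZM p'))"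
      proof (rule inj_hom_bij[OF FM ZM_module d_onto])
        fix x assume x: "x \<in> carrier (FF (Suc p'))" "d p' x = \<zero>\<^bsub>ZM p'\<^esub>"
        then obtain y where "y \<in> carrier (FF (Suc (Suc p')))" "x = d (Suc p') y" using r(8)[of x p'] by auto
        then show "x = \<zero>\<^bsub>FF (Suc p')\<^esub>" using Fz[of "Suc (Suc p')" y] Suc hom_zero[OF FM FM r(2)] by simp
      qed
      note iso = acyclic_at_bij[OF FM ZM_module d_onto(1) bij]
      obtain g where g: "g \<in> module_hom R (ZM p') (FF (Suc p'))"
        "\<And>y. y \<in> carrier (ZM p') \<Longrightarrow> d p' (g y) = y" using bij_hom_inverse[OF FM d_onto(1) bij] by metis
      have "\<not> acyclic_at R kb kd (ZM p') q" using iso q2 bp Suc by simp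
      then obtain v where v: "cocycle R kb kd (ZM p') q v" "\<not> cobdry R kb kd (ZM p') q v"
        unfolding acyclic_at_def by blast
      \<comment> \<open>The inclusion of \<open>ZM p'\<close> into \<open>FF p'\<close> is d p'
        after the isomorphism g; as d p' is a matrix over \<open>mm\<close>, every class dies
        there.\<close>
      have "cobdry R kb kd (FF p') q (\<lambda>x. d p' (g (v x)))"
        by (rule cobdry_minimal[OF residue_module_module k(1) residue_annihilated r(2) mfr_mm[OF P]
              cocycle_comp[OF ZM_module FM g(1) v(1)]])
      then have "cobdry R kb kd (FF p') q v"
      proof (rule cobdry_cong)
        fix x assume "x \<in> carrier (free_module R (kb q))"
        then have "v x \<in> carrier (ZM p')" using v(1) hom_closed unfolding cocycle_def by metis
        then show "v x = d p' (g (v x))" by (rule g(2)[symmetric])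
      qed
      then show ?thesis unfolding E_def using v q1 iso by (intro exI[of _ q] exI[of _ v]) simp
    qed
    have "E 0"
    proof (rule inc_induct[of 0 p' E])
      show "E p'" by (rule base)
      fix i assume i: "i < p'" and "E (Suc i)"
      then obtain n v where nv: "n + (p' - Suc i) = q" "\<forall>j<n. acyclic_at R kb kd (ZM (Suc i)) j"
        "cocycle R kb kd (ZM (Suc i)) n v" "\<not> cobdry R kb kd (ZM (Suc i)) n v"
        "cobdry R kb kd (FF (Suc i)) n v" unfolding E_def by blast
      from step[OF _ nv(2-5)] nv(1) obtain m where m: "n = Suc m"
        "\<forall>j<m. acyclic_at R kb kd (ZM i) j" "\<not> acyclic_at R kb kd (ZM i) m" by auto
      then obtain w where w: "cocycle R kb kd (ZM i) m w" "\<not> cobdry R kb kd (ZM i) m w"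
        unfolding acyclic_at_def by blast
      have "cocycle R kb kd (FF i) m w"
        by (rule cocycle_comp[OF ZM_module FM hom_from_submod[OF ZM_submod] w(1)])
      \<comment> \<open>Strictly below q nothing survives in a free module, so from here on any
        nonzero class will do.\<close>
      moreover have "m < q" using m(1) nv(1) by simp
      ultimately have "cobdry R kb kd (FF i) m w" using q1[of "b i"] by (simp add: acyclic_at_def)
      moreover have "m + (p' - i) = q" using m(1) nv(1) i by simp
      ultimately show "E i" unfolding E_def using m(2) w by blast
    qed simp
    then obtain n v where nv: "n + p' = q" "\<forall>j<n. acyclic_at R kb kd (ZM 0) j"
        "cocycle R kb kd (ZM 0) n v" "\<not> cobdry R kb kd (ZM 0) n v" "cobdry R kb kd (FF 0) n v"
      unfolding E_def by auto
    have "\<exists>m. n = Suc m \<and> (\<forall>j<m. acyclic_at R kb kd X j) \<and> \<not> acyclic_at R kb kd X m"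
      by (rule depth_step[where i = "\<lambda>x. x" and Z = "ZM 0" and F = "FF 0" and Y = X
            and p = \<epsilon> and q = q and v = v, OF k(1) ZM_module FM XM hom_from_submod[OF ZM_submod] _ r(3,4) eps_exact
            q1 nv(2) _ nv(3,4,5)]) (use nv(1) in simp_all)
    then show ?thesis using nv(1) Suc by auto
  qed
  then show ?thesis using k(3) by blast
qed

lemma auslander_buchsbaum:
  assumes nz: "\<not> zero_module X"
  obtains q n where "depth R (ring_module R) = enat q" "depth R X = enat n" "n + p = q"
proof -
  have "\<not> zero_module (ring_module R)"
  proof
    assume "zero_module (ring_module R)"
    then have "\<one> = \<zero>" using one_closed by (auto simp: zero_module_def)
    then show False using one_notin_mm mm_closed(2) by simp
  qed
  then obtain q where q: "depth R (ring_module R) = enat q" "\<forall>j<q. residue_ext_zero (ring_module R) j" "\<not> residue_ext_zero (ring_module R) q"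
    using depth_residue_ext[OF fg_ring] by metis
  obtain n where n: "n + p = q" "\<forall>j<n. residue_ext_zero X j" "\<not> residue_ext_zero X n"
    using auslander_buchsbaum_residue_ext[OF q(2,3)] by blast
  obtain n' where n': "depth R X = enat n'" "\<forall>j<n'. residue_ext_zero X j" "\<not> residue_ext_zero X n'"
    by (rule depth_residue_ext[OF X nz])
  have "n = n'" using n(2,3) n'(2,3) by (metis linorder_neqE_nat)
  then show ?thesis using that q(1) n'(1) n(1) by blast
qed

end

end

section \<open>Betti numbers and complexity\<close>

context noeth_local
begin

abbreviation "kk \<equiv> R Quot mm"

lemma field_residue: "field kk"
  by (rule maximalideal.quotient_is_field[OF mm_maximal is_cring])

lemma kk_carrier: "carrier kk = (\<lambda>r. mm +> r) ` carrier R"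
  by (auto simp: FactRing_def A_RCOSETS_def')

section \<open>Modules killed by the maximal ideal as vector spaces over the residue field\<close>

context
  fixes V :: "('a, 'm) module"
  assumes V: "module R V" and mV: "\<And>r v. r \<in> mm \<Longrightarrow> v \<in> carrier V \<Longrightarrow> r \<odot>\<^bsub>V\<^esub> v = \<zero>\<^bsub>V\<^esub>"
begin

interpretation V: Module.module R V by (rule V)
interpretation mm: ideal mm R by (rule mm_ideal)

private abbreviation "VV \<equiv> residue_space V"

private lemma VV_simps:
  "carrier VV = carrier V" "\<zero>\<^bsub>VV\<^esub> = \<zero>\<^bsub>V\<^esub>" "x \<oplus>\<^bsub>VV\<^esub> y = x \<oplus>\<^bsub>V\<^esub> y"
  by (simp_all add: residue_space_def)

text \<open>Members of a coset differ by elements of \<open>mm\<close>, which kill V. So the image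
  whose only element is selected in \<open>residue_space\<close> is indeed a singleton.\<close>

private lemma VV_smult:
  assumes r: "r \<in> carrier R" and v: "v \<in> carrier V"
  shows "(mm +> r) \<odot>\<^bsub>VV\<^esub> v = r \<odot>\<^bsub>V\<^esub> v"
proof -
  have "s \<odot>\<^bsub>V\<^esub> v = r \<odot>\<^bsub>V\<^esub> v" if s: "s \<in> mm +> r" for s
  proof -
    obtain h where h: "h \<in> mm" "s = h \<oplus> r" using s by (auto simp: a_r_coset_def')
    show ?thesis using mV[OF h(1) v] h v r mm_carrier[OF h(1)] by (simp add: V.smult_l_distr)
  qed
  then have "(\<lambda>s. s \<odot>\<^bsub>V\<^esub> v) ` (mm +> r) = (\<lambda>s. r \<odot>\<^bsub>V\<^esub> v) ` (mm +> r)" by (rule image_cong[OF refl])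
  also have "\<dots> = {r \<odot>\<^bsub>V\<^esub> v}" using mm.a_rcos_self[OF r] by auto
  finally show ?thesis by (simp add: residue_space_def)
qed

private lemma kk_ops:
  assumes "r \<in> carrier R" "s \<in> carrier R"
  shows "(mm +> r) \<oplus>\<^bsub>kk\<^esub> (mm +> s) = mm +> (r \<oplus> s)" "(mm +> r) \<otimes>\<^bsub>kk\<^esub> (mm +> s) = mm +> (r \<otimes> s)"
    "\<one>\<^bsub>kk\<^esub> = mm +> \<one>"
  using mm.rcoset_mult_add[OF assms] mm.a_rcos_sum[OF assms] by (simp_all add: FactRing_def)

lemma residue_space_vectorspace: "vectorspace kk VV"
proof -
  interpret K: field kk by (rule field_residue)
  have "Module.module kk VV"
  proof (rule module_criteria)
    show "cring kk" by (rule K.is_cring)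
    show "\<forall>v\<in>carrier VV. \<one>\<^bsub>kk\<^esub> \<odot>\<^bsub>VV\<^esub> v = v"
      unfolding kk_ops(3)[OF one_closed one_closed] by (simp add: VV_simps VV_smult)
    show "\<forall>v\<in>carrier VV. \<exists>neg_v\<in>carrier VV. v \<oplus>\<^bsub>VV\<^esub> neg_v = \<zero>\<^bsub>VV\<^esub>"
      unfolding VV_simps by (metis V.a_inv_closed V.r_neg)
  qed (auto simp: VV_simps kk_carrier kk_ops(1,2) VV_smult V.a_assoc V.a_comm V.a_lcomm V.smult_l_distr V.smult_r_distr
      V.smult_assoc1)
  then show ?thesis by (simp add: vectorspace_def K.field_axioms)
qed

text \<open>\<open>dim\<close> is the least cardinality of a finite spanning set, which says
  something only once such a set is known to exist. Finite generation over \<open>R\<close> supplies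
  one, and then dimension 0 means that the empty set spans.\<close>

lemma dim_zero_imp_zero_module:
  assumes fg: "fg_module R V" and dim: "vectorspace.dim kk VV = 0"
  shows "zero_module V"
proof -
  interpret VS: vectorspace kk VV by (rule residue_space_vectorspace)
  obtain n f where f: "f \<in> module_hom R (free_module R n) V" "f ` carrier (free_module R n) = carrier V"
    using fg_moduleE[OF fg] by metis
  let ?S = "(\<lambda>i. f (unitv R n i)) ` {..<n}"
  have S: "?S \<subseteq> carrier VV" using hom_closed[OF f(1) unitv_in] by (auto simp: VV_simps)
  note W = submodD[OF VS.span_is_submodule[OF S]]
  have "submod R (VS.span ?S) V"
  proof (rule submodI[OF V])
    show "VS.span ?S \<subseteq> carrier V" using W(2) by (simp add: VV_simps)
    show "\<zero>\<^bsub>V\<^esub> \<in> VS.span ?S" using W(3) by (simp add: VV_simps)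
    show "v \<oplus>\<^bsub>V\<^esub> w \<in> VS.span ?S" if "v \<in> VS.span ?S" "w \<in> VS.span ?S" for v w
      using W(4)[OF that] by (simp add: VV_simps)
    show "c \<odot>\<^bsub>V\<^esub> v \<in> VS.span ?S" if c: "c \<in> carrier R" and v: "v \<in> VS.span ?S" for c v
    proof -
      have "v \<in> carrier V" using W(2) v by (auto simp: VV_simps)
      moreover have "(mm +> c) \<odot>\<^bsub>VV\<^esub> v \<in> VS.span ?S" using W(5)[OF _ v] c by (simp add: kk_carrier)
      ultimately show ?thesis using VV_smult[OF c] by simp
    qed
  qed
  then have "f x \<in> VS.span ?S" if "x \<in> carrier (free_module R n)" for x
    by (rule free_image_subset[OF _ f(1)]) (use VS.in_own_span[OF S] that in \<open>auto simp: free_simps\<close>)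
  then have "carrier VV \<subseteq> VS.span ?S" unfolding VV_simps f(2)[symmetric] by auto
  then have "VS.span ?S = carrier VV" using W(2) by blast
  then have ex: "\<exists>k A. finite A \<and> card A = k \<and> A \<subseteq> carrier VV \<and> VS.span A = carrier VV"
    using S by blast
  have "\<exists>A. finite A \<and> card A = VS.dim \<and> A \<subseteq> carrier VV \<and> VS.span A = carrier VV"
    unfolding VS.dim_def by (rule LeastI_ex[OF ex])
  then have "VS.span {} = carrier VV" using dim by auto
  moreover have "VS.span {} = {\<zero>\<^bsub>VV\<^esub>}" by (auto simp: VS.span_def VS.lincomb_def)
  ultimately show ?thesis by (simp add: zero_module_def VV_simps)
qed

end

lemma residue_proj:
  obtains \<pi> where "\<pi> \<in> module_hom R (ring_module R) (residue_module R)"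
    "\<pi> ` carrier R = carrier (residue_module R)" "\<forall>r\<in>carrier R. \<pi> r = \<zero>\<^bsub>residue_module R\<^esub> \<longleftrightarrow> r \<in> mm"
  using that[OF quot_proj_hom[OF mm_submod, folded residue_module_def]] quot_simps(1)[OF mm_submod]
    quot_zero_iff[OF mm_submod] by (simp add: residue_module_def)

text \<open>A vector c is sent to the map with value \<pi> (c i) at the i-th basis vector. This
  surjection makes the Hom module, and with it \<open>Ext\<close>, finitely generated, as required
  for drawing conclusions from dimension 0.\<close>

lemma hom_free_residue_fg: "fg_module R (hom_module R (free_module R n) (residue_module R))"
proof -
  let ?k = "residue_module R" and ?F = "free_module R n"
  let ?H = "hom_module R ?F ?k"
  note FM = free_module_module and K = residue_module_module
  interpret K: Module.module R ?k by (rule K)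
  obtain \<pi> where \<pi>: "\<pi> \<in> module_hom R (ring_module R) ?k" "\<pi> ` carrier R = carrier ?k" using residue_proj by metis
  define L where "L c = lin ?k n (\<lambda>i. if i < n then \<pi> (c i) else \<zero>\<^bsub>?k\<^esub>)" for c
  have pc: "(if i < n then \<pi> (c i) else \<zero>\<^bsub>?k\<^esub>) \<in> carrier ?k" if "c \<in> carrier ?F" for c i
    using hom_closed[OF \<pi>(1)] free_coord[of c n i] that by (simp add: free_simps)
  have L: "L c \<in> module_hom R ?F ?k" if "c \<in> carrier ?F" for c
    unfolding L_def by (intro lin_hom K pc that)
  have Le: "L c (unitv R n i) = \<pi> (c i)" if "c \<in> carrier ?F" "i < n" for c i
    unfolding L_def using lin_unitv[OF K pc[OF that(1)] that(2)] that(2) by simp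
  define T where "T c = restrict (L c) (carrier ?F)" for c
  have T: "T c \<in> carrier ?H" if "c \<in> carrier ?F" for c
    unfolding T_def by (rule restrict_hom_module[OF FM L[OF that]])
  interpret F: Module.module R ?F by (rule FM)
  interpret H: Module.module R ?H by (rule hom_module_module[OF FM K])
  have hm: "h \<in> module_hom R ?F ?k" if "h \<in> carrier ?H" for h using that by (simp add: hom_module_simps)
  have eqI: "h = h'" if "h \<in> carrier ?H" "h' \<in> carrier ?H" "\<And>i. i < n \<Longrightarrow> h (unitv R n i) = h' (unitv R n i)" for h h'
    by (rule hom_module_eqI[OF that(1,2)], rule hom_free_eq[OF K hm[OF that(1)] hm[OF that(2)] that(3)])
      (simp_all add: free_simps)
  have Te: "T c (unitv R n i) = \<pi> (c i)" if "c \<in> carrier ?F" "i < n" for c i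
    using Le[OF that] unitv_in by (simp add: T_def)
  have "T \<in> module_hom R ?F ?H"
  proof (rule homI)
    fix c c' assume c: "c \<in> carrier ?F" "c' \<in> carrier ?F"
    show "T (c \<oplus>\<^bsub>?F\<^esub> c') = T c \<oplus>\<^bsub>?H\<^esub> T c'"
    proof (rule eqI[OF T[OF F.a_closed[OF c]] H.a_closed[OF T[OF c(1)] T[OF c(2)]]])
      fix i assume i: "i < n"
      have "(c \<oplus>\<^bsub>?F\<^esub> c') i = c i \<oplus> c' i" using i by (simp add: free_simps)
      then show "T (c \<oplus>\<^bsub>?F\<^esub> c') (unitv R n i) = (T c \<oplus>\<^bsub>?H\<^esub> T c') (unitv R n i)"
        using Te[OF _ i] c F.a_closed[OF c] hom_add[OF \<pi>(1), of "c i" "c' i"] free_coord[of c n i] free_coord[of c' n i] i unitv_in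
        by (simp add: hom_module_simps(2) free_simps(1))
    qed
  next
    fix r c assume r: "r \<in> carrier R" and c: "c \<in> carrier ?F"
    show "T (r \<odot>\<^bsub>?F\<^esub> c) = r \<odot>\<^bsub>?H\<^esub> T c"
    proof (rule eqI[OF T[OF F.smult_closed[OF r c]] H.smult_closed[OF r T[OF c]]])
      fix i assume i: "i < n"
      have "(r \<odot>\<^bsub>?F\<^esub> c) i = r \<otimes> c i" using i by (simp add: free_simps)
      then show "T (r \<odot>\<^bsub>?F\<^esub> c) (unitv R n i) = (r \<odot>\<^bsub>?H\<^esub> T c) (unitv R n i)"
        using Te[OF _ i] c F.smult_closed[OF r c] hom_smult[OF \<pi>(1) r, of "c i"] free_coord[of c n i] i unitv_in
        by (simp add: hom_module_simps(3) free_simps(1))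
    qed
  qed (rule T)
  moreover have "T ` carrier ?F = carrier ?H"
  proof (intro equalityI subsetI)
    fix h assume h: "h \<in> carrier ?H"
    have "\<exists>r\<in>carrier R. \<pi> r = h (unitv R n i)" for i
    proof -
      have "h (unitv R n i) \<in> \<pi> ` carrier R" unfolding \<pi>(2) by (rule hom_closed[OF hm[OF h] unitv_in])
      then show ?thesis by auto
    qed
    then obtain c where c: "\<And>i. c i \<in> carrier R" "\<And>i. \<pi> (c i) = h (unitv R n i)" by metis
    have c': "restrict c {..<n} \<in> carrier ?F" unfolding free_simps(1) restrict_PiE_iff using c(1) by simp
    have "h = T (restrict c {..<n})" by (rule eqI[OF h T[OF c']]) (simp add: Te[OF c'] c(2))
    then show "h \<in> T ` carrier ?F" using c' by (rule image_eqI)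
  qed (use T in blast)
  ultimately show ?thesis by (rule fg_image[OF fg_free H.module_axioms])
qed

text \<open>The first coordinate followed by the map to k is a cocycle by minimality. As a
  coboundary it would vanish at the first basis vector: it is zero in degree 0, and otherwise
  evaluates a map to k at a vector over \<open>mm\<close>. Its value there is the class of 1, which
  is nonzero.\<close>

lemma minimal_rank_zero:
  assumes P: "minimal_free_resolution R b d \<epsilon> X" and V: "acyclic_at R b d (residue_module R) n"
  shows "b n = 0"
proof (rule ccontr)
  assume "b n \<noteq> 0"
  then have b: "0 < b n" by simp
  note r = resolutionD[OF mfr_free[OF P]]
  let ?k = "residue_module R"
  interpret K: Module.module R ?k by (rule residue_module_module)
  obtain \<pi> where \<pi>: "\<pi> \<in> module_hom R (ring_module R) ?k" "\<forall>r\<in>carrier R. \<pi> r = \<zero>\<^bsub>?k\<^esub> \<longleftrightarrow> r \<in> mm"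
    using residue_proj by metis
  let ?f = "\<lambda>x. \<pi> (x 0)" and ?e = "unitv R (b n) 0"
  have "cocycle R b d ?k n ?f"
    unfolding cocycle_def
  proof (intro conjI ballI)
    show "?f \<in> module_hom R (free_module R (b n)) ?k" by (rule hom_comp[OF coord_hom[OF b] \<pi>(1)])
    show "?f (d n x) = \<zero>\<^bsub>?k\<^esub>" if "x \<in> carrier (free_module R (b (Suc n)))" for x
      using mfr_mm[OF P that b] \<pi>(2) by simp
  qed
  then have cob: "cobdry R b d ?k n ?f" using V by (simp add: acyclic_at_def)
  have "\<pi> \<one> = \<zero>\<^bsub>?k\<^esub>"
  proof (cases n)
    case 0
    then have "?f ?e = \<zero>\<^bsub>?k\<^esub>" using cob unitv_in unfolding 0 cobdry_0 by blast
    then show ?thesis using b by (simp add: unitv_apply)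
  next
    case (Suc m)
    obtain g where g: "g \<in> module_hom R (free_module R (b m)) ?k"
      "\<And>x. x \<in> carrier (free_module R (b (Suc m))) \<Longrightarrow> ?f x = g (d m x)" using cob unfolding Suc cobdry_Suc by blast
    have e: "?e \<in> carrier (free_module R (b (Suc m)))" using unitv_in Suc by simp
    let ?w = "d m ?e"
    have w: "?w \<in> {..<b m} \<rightarrow>\<^sub>E carrier R" using hom_closed[OF r(2) e] by (simp add: free_simps)
    have "g ?w = (\<Oplus>\<^bsub>?k\<^esub>i\<in>{..<b m}. ?w i \<odot>\<^bsub>?k\<^esub> g (unitv R (b m) i))"
      using hom_free_lin[OF residue_module_module g(1) w] by (simp add: lin_def)
    also have "\<dots> = (\<Oplus>\<^bsub>?k\<^esub>i\<in>{..<b m}. \<zero>\<^bsub>?k\<^esub>)"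
      using residue_annihilated[OF mfr_mm[OF P e] hom_closed[OF g(1) unitv_in]] by (intro K.finsum_cong') auto
    also have "\<dots> = \<zero>\<^bsub>?k\<^esub>" by (rule K.finsum_zero)
    finally have "?f ?e = \<zero>\<^bsub>?k\<^esub>" using g(2)[OF e] by simp
    then show ?thesis using b by (simp add: unitv_apply)
  qed
  then show False using \<pi>(2) one_notin_mm by simp
qed

lemma betti_zero_imp_rank_zero:
  fixes X :: "('a, 'm) module"
  assumes X: "fg_module R X" and "betti R X n = 0"
  shows "fst (min_res R X) n = 0"
proof -
  obtain \<epsilon> where P: "minimal_free_resolution R (fst (min_res R X)) (snd (min_res R X)) \<epsilon> X"
    by (rule min_res_props[OF X])
  let ?E = "Ext R X (residue_module R) n"
  note res = residue_module_module refl refl mfr_free[OF P]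
  have E: "module R ?E" by (rule Ext_module[OF res])
  have "fg_module R (hom_module R (res_module R X n) (residue_module R))"
    unfolding res_module_def by (rule hom_free_residue_fg)
  then have fg: "fg_module R ?E" by (rule Ext_fg[OF res])
  have m: "r \<odot>\<^bsub>?E\<^esub> v = \<zero>\<^bsub>?E\<^esub>" if "r \<in> mm" "v \<in> carrier ?E" for r v
    using Ext_annihilated[OF res mm_carrier[OF that(1)] residue_annihilated[OF that(1)] that(2)] by simp
  have "zero_module ?E"
    by (rule dim_zero_imp_zero_module[OF E m fg]) (use assms(2) in \<open>simp_all add: betti_def\<close>)
  then have "acyclic_at R (fst (min_res R X)) (snd (min_res R X)) (residue_module R) n"
    using zero_Ext_iff[OF res] by blast
  then show ?thesis by (rule minimal_rank_zero[OF P])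
qed

end

text \<open>An infimum in \<open>enat\<close> over a nonempty set is attained, so the exponent t = 0
  itself is admissible. Then the Betti numbers are eventually at most a/n, hence smaller than
  1.\<close>

lemma complexity_zero_imp_betti_zero:
  assumes "complexity R X = 0"
  shows "\<exists>m. \<forall>n>m. betti R X n = 0"
proof -
  let ?S = "{enat t | t. \<exists>a::real. \<forall>\<^sub>F n in sequentially. real (betti R X n) \<le> a * real n powr (real t - 1)}"
  have "?S \<noteq> {}"
  proof
    assume e: "?S = {}"
    have "complexity R X = \<infinity>" unfolding complexity_def e by (simp add: top_enat_def)
    then show False using assms by simp
  qed
  then have "Inf ?S \<in> ?S" unfolding ex_in_conv[symmetric] by (elim exE) (rule wellorder_InfI)
  then have "0 \<in> ?S" using assms unfolding complexity_def by simp
  then obtain a :: real where "\<forall>\<^sub>F n in sequentially. real (betti R X n) \<le> a * real n powr (real 0 - 1)"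
    by (auto simp: zero_enat_def)
  then obtain m where m: "\<And>n. n \<ge> m \<Longrightarrow> real (betti R X n) \<le> a * real n powr (real 0 - 1)"
    unfolding eventually_sequentially by blast
  obtain m' :: nat where m': "a < real m'" using reals_Archimedean2 by blast
  have "betti R X n = 0" if n: "n > max m m'" for n
  proof -
    have pos: "real n > 0" and an: "a < real n" using n m' by auto
    have "real (betti R X n) \<le> a * real n powr (- 1)" using m[of n] n by simp
    also have "\<dots> = a / real n" using pos by (simp add: powr_minus divide_inverse)
    also have "\<dots> < 1" using an pos by simp
    finally show ?thesis by simp
  qed
  then show ?thesis by blast
qed

text \<open>The ranks vanish eventually along with the Betti numbers, and the rank in degree 0 is
  positive; \<open>p\<close> is the largest degree of positive rank.\<close>

lemma (in noeth_local) complexity_zero_length: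
  fixes X :: "('a, 'm) module"
  assumes X: "fg_module R X" "\<not> zero_module X" and "complexity R X = 0"
  obtains p where "0 < fst (min_res R X) p" "\<forall>i>p. fst (min_res R X) i = 0"
proof -
  let ?b = "fst (min_res R X)"
  obtain \<epsilon> where P: "minimal_free_resolution R ?b (snd (min_res R X)) \<epsilon> X" by (rule min_res_props[OF X(1)])
  have XM: "module R X" using X(1) by (simp add: fg_module_def)
  obtain m where m: "\<forall>n>m. betti R X n = 0" using complexity_zero_imp_betti_zero[OF assms(3)] by blast
  have z: "?b n = 0" if "n > m" for n using betti_zero_imp_rank_zero[OF X(1)] m that by blast
  have bnd: "n \<le> m" if "0 < ?b n" for n by (rule ccontr) (use z[of n] that in simp)
  have b0: "0 < ?b 0" by (rule mfr_rank_pos[OF XM X(2) P])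
  let ?p = "Greatest (\<lambda>n. 0 < ?b n)"
  have "0 < ?b ?p" by (rule GreatestI_nat[of "\<lambda>n. 0 < ?b n", OF b0 bnd])
  moreover have "?b i = 0" if "?p < i" for i
    using Greatest_le_nat[of "\<lambda>n. 0 < ?b n" i m] bnd that by (meson leD neq0_conv)
  ultimately show ?thesis using that by blast
qed

section \<open>The exact sequence of \<open>K\<^sub>\<eta>\<close>\<close>

lemma direct_sum_simps:
  "carrier (direct_sum M N) = carrier M \<times> carrier N" "\<zero>\<^bsub>direct_sum M N\<^esub> = (\<zero>\<^bsub>M\<^esub>, \<zero>\<^bsub>N\<^esub>)"
  "v \<oplus>\<^bsub>direct_sum M N\<^esub> w = (fst v \<oplus>\<^bsub>M\<^esub> fst w, snd v \<oplus>\<^bsub>N\<^esub> snd w)"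
  "r \<odot>\<^bsub>direct_sum M N\<^esub> v = (r \<odot>\<^bsub>M\<^esub> fst v, r \<odot>\<^bsub>N\<^esub> snd v)"
  by (simp_all add: direct_sum_def)

lemma hom_Pair:
  "f \<in> module_hom R L M \<Longrightarrow> g \<in> module_hom R L N \<Longrightarrow> (\<lambda>x. (f x, g x)) \<in> module_hom R L (direct_sum M N)"
  by (rule homI) (simp_all add: direct_sum_simps hom_closed hom_add hom_smult)

lemma hom_snd: "snd \<in> module_hom R (direct_sum M N) N"
  by (rule homI) (auto simp: direct_sum_simps)

text \<open>The pushout is the sum of B and C modulo the pairs (f a, - g a). If (y, 0) is such a
  pair, then g a = 0, so a = 0 and y = 0. The second coordinate is well defined modulo the image of
  g, which gives the map onto the cokernel of g.\<close>

lemma pushout_exact: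
  fixes A :: "('a, 'd) module" and B :: "('a, 'b) module" and C :: "('a, 'c) module"
  assumes A: "module R A" and B: "module R B" and C: "module R C"
    and f: "f \<in> module_hom R A B" and g: "g \<in> module_hom R A C"
    and g_inj: "\<And>a. a \<in> carrier A \<Longrightarrow> g a = \<zero>\<^bsub>C\<^esub> \<Longrightarrow> a = \<zero>\<^bsub>A\<^esub>"
  obtains i p where "module R (pushout_module A B C f g)"
    "i \<in> module_hom R B (pushout_module A B C f g)"
    "\<forall>y\<in>carrier B. i y = \<zero>\<^bsub>pushout_module A B C f g\<^esub> \<longrightarrow> y = \<zero>\<^bsub>B\<^esub>"
    "p \<in> module_hom R (pushout_module A B C f g) (quot_module C (g ` carrier A))"
    "p ` carrier (pushout_module A B C f g) = carrier (quot_module C (g ` carrier A))"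
    "\<forall>x\<in>carrier (pushout_module A B C f g).
      p x = \<zero>\<^bsub>quot_module C (g ` carrier A)\<^esub> \<longleftrightarrow> x \<in> i ` carrier B"
proof -
  interpret A: Module.module R A by fact
  interpret B: Module.module R B by fact
  interpret C: Module.module R C by fact
  let ?D = "direct_sum B C" and ?G = "g ` carrier A"
  have D: "module R ?D" by (rule direct_sum_is_module[OF B C])
  have G: "submod R ?G C" by (rule submod_image[OF A C g])
  let ?h = "\<lambda>a. (f a, \<ominus>\<^bsub>C\<^esub> g a)"
  define W where "W = ?h ` carrier A"
  have h: "?h \<in> module_hom R A ?D" by (rule hom_Pair[OF f hom_uminus[OF C g]])
  have W: "submod R W ?D" unfolding W_def by (rule submod_image[OF A D h])
  define K where "K = pushout_module A B C f g"
  have K_eq: "K = quot_module ?D W" by (simp add: K_def pushout_module_def W_def)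
  have K: "module R K" unfolding K_eq by (rule quot_module_module[OF W])
  let ?q = "\<lambda>x. W +>\<^bsub>?D\<^esub> x"
  have q: "?q \<in> module_hom R ?D K" unfolding K_eq by (rule quot_proj_hom[OF W])
  have q_surj: "?q ` carrier ?D = carrier K" unfolding K_eq quot_simps(1)[OF W] ..
  have q_zero: "?q x = \<zero>\<^bsub>K\<^esub> \<longleftrightarrow> x \<in> W" if "x \<in> carrier ?D" for x
    unfolding K_eq by (rule quot_zero_iff[OF W that])
  let ?j = "\<lambda>y. (y, \<zero>\<^bsub>C\<^esub>)"
  have j: "?j \<in> module_hom R B ?D" by (rule hom_Pair[OF hom_id hom_const_zero[OF C]])
  let ?i = "\<lambda>y. ?q (?j y)"
  have i: "?i \<in> module_hom R B K" by (rule hom_comp[OF j q])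
  have i_inj: "y = \<zero>\<^bsub>B\<^esub>" if y: "y \<in> carrier B" "?i y = \<zero>\<^bsub>K\<^esub>" for y
  proof -
    have "?j y \<in> W" using q_zero[of "?j y"] y by (simp add: direct_sum_simps)
    then obtain a where a: "a \<in> carrier A" "y = f a" "\<zero>\<^bsub>C\<^esub> = \<ominus>\<^bsub>C\<^esub> g a" unfolding W_def by auto
    have "g a = \<ominus>\<^bsub>C\<^esub> (\<ominus>\<^bsub>C\<^esub> g a)" using hom_closed[OF g a(1)] by simp
    then have "g a = \<zero>\<^bsub>C\<^esub>" unfolding a(3)[symmetric] by (simp add: C.neg_zero)
    then show ?thesis using g_inj[OF a(1)] hom_zero[OF A B f] a(2) by simp
  qed
  let ?s = "\<lambda>x. ?G +>\<^bsub>C\<^esub> snd x"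
  have s: "?s \<in> module_hom R ?D (quot_module C ?G)" by (rule hom_comp[OF hom_snd quot_proj_hom[OF G]])
  have s_zero: "?s x = \<zero>\<^bsub>quot_module C ?G\<^esub> \<longleftrightarrow> snd x \<in> ?G" if "x \<in> carrier ?D" for x
    using quot_zero_iff[OF G, of "snd x"] that by (auto simp: direct_sum_simps)
  have sW: "?s x = \<zero>\<^bsub>quot_module C ?G\<^esub>" if x: "x \<in> carrier ?D" "?q x = \<zero>\<^bsub>K\<^esub>" for x
  proof -
    have "x \<in> W" using q_zero[OF x(1)] x(2) by simp
    then obtain a where "a \<in> carrier A" "x = ?h a" unfolding W_def by blast
    then have "snd x \<in> ?G" using submod_neg[OF G, of "g a"] by simp
    then show ?thesis using s_zero[OF x(1)] by simp
  qed
  obtain p where p: "p \<in> module_hom R K (quot_module C ?G)" "\<And>x. x \<in> carrier ?D \<Longrightarrow> p (?q x) = ?s x"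
    using hom_factor[OF D K quot_module_module[OF G] q q_surj s sW] by metis
  have p_surj: "p ` carrier K = carrier (quot_module C ?G)"
  proof -
    have "p ` carrier K = (\<lambda>x. p (?q x)) ` carrier ?D" unfolding q_surj[symmetric] by (simp only: image_image)
    also have "\<dots> = ?s ` carrier ?D" using p(2) by (rule image_cong[OF refl])
    also have "\<dots> = (\<lambda>z. ?G +>\<^bsub>C\<^esub> z) ` (snd ` carrier ?D)" by (simp only: image_image)
    also have "snd ` carrier ?D = carrier C"
      unfolding direct_sum_simps(1) using B.zero_closed by (intro snd_image_times[THEN trans]) auto
    finally show ?thesis by (simp add: quot_simps(1)[OF G])
  qed
  have p_exact: "p x = \<zero>\<^bsub>quot_module C ?G\<^esub> \<longleftrightarrow> x \<in> ?i ` carrier B" if x: "x \<in> carrier K" for x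
  proof -
    have "x \<in> ?q ` carrier ?D" unfolding q_surj by (rule x)
    then obtain x' where x': "x' \<in> carrier ?D" "x = ?q x'" by (rule imageE)
    obtain y z where yz: "x' = (y, z)" by (cases x')
    then have y: "y \<in> carrier B" and z: "z \<in> carrier C" using x'(1) by (simp_all add: direct_sum_simps)
    have "p x = ?s x'" unfolding x'(2) by (rule p(2)[OF x'(1)])
    moreover have "snd x' = z" by (simp add: yz)
    ultimately have px: "p x = \<zero>\<^bsub>quot_module C ?G\<^esub> \<longleftrightarrow> z \<in> ?G" using s_zero[OF x'(1)] by simp
    show ?thesis
      unfolding px
    proof
      assume "z \<in> ?G"
      then obtain a where a: "a \<in> carrier A" "z = g a" by blast
      note fa = hom_closed[OF f a(1)]
      have w: "?h a \<in> W" unfolding W_def using a(1) by (rule imageI)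
      have wc: "?h a \<in> carrier ?D" by (rule hom_closed[OF h a(1)])
      \<comment> \<open>Adding (f a, - g a), which is zero in the pushout, turns the second
        coordinate z = g a into 0.\<close>
      have "?q (?h a \<oplus>\<^bsub>?D\<^esub> x') = ?q (?h a) \<oplus>\<^bsub>K\<^esub> ?q x'" by (rule hom_add[OF q wc x'(1)])
      also have "\<dots> = ?q x'"
      proof -
        interpret K: Module.module R K by (rule K)
        show ?thesis using q_zero[OF wc] w hom_closed[OF q x'(1)] by simp
      qed
      also have "?h a \<oplus>\<^bsub>?D\<^esub> x' = ?j (f a \<oplus>\<^bsub>B\<^esub> y)"
        using z a(2) by (simp add: direct_sum_simps yz C.l_neg)
      finally have "x = ?i (f a \<oplus>\<^bsub>B\<^esub> y)" using x'(2) by simp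
      then show "x \<in> ?i ` carrier B" using B.a_closed[OF fa y] by (rule image_eqI)
    next
      assume "x \<in> ?i ` carrier B"
      then obtain b where b: "b \<in> carrier B" "x = ?i b" by blast
      have jb: "?j b \<in> carrier ?D" by (rule hom_closed[OF j b(1)])
      have "p x = \<zero>\<^bsub>quot_module C ?G\<^esub>"
        unfolding b(2) p(2)[OF jb] s_zero[OF jb] using submodD(3)[OF G] by simp
      then show "z \<in> ?G" using px by simp
    qed
  qed
  show ?thesis
    by (rule that[of ?i p]) (use K i i_inj p(1) p_surj p_exact in \<open>simp_all add: K_def\<close>)
qed

context noeth_local
begin

section \<open>Syzygies, their resolutions and their inclusions\<close>

context
  fixes X :: "('a, 'm) module" and b d \<epsilon>
  assumes bd: "b = fst (min_res R X)" "d = snd (min_res R X)"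
    and res: "free_resolution R b d \<epsilon> X"
begin

private lemmas rX = resolutionD[OF res]

private abbreviation "IM n \<equiv> d n ` carrier (free_module R (b (Suc n)))"

private lemma IM_submod: "submod R (IM n) (free_module R (b n))"
  by (rule submod_image[OF free_module_module free_module_module rX(2)])

lemma syzygy_eq: "syzygy R X n = quot_module (free_module R (b n)) (IM n)"
  by (simp add: syzygy_def res_module_def res_diff_def bd)

lemma syzygy_module: "module R (syzygy R X n)"
  unfolding syzygy_eq by (rule quot_module_module[OF IM_submod])

lemma syzygy_resolution:
  "free_resolution R (\<lambda>i. b (i + n)) (\<lambda>i. d (i + n)) (\<lambda>x. IM n +>\<^bsub>free_module R (b n)\<^esub> x) (syzygy R X n)"
  unfolding resolution_def
proof (intro conjI allI)
  show "module R (free_module R (b (i + n)))" for i by (rule free_module_module)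
  show "d (i + n) \<in> module_hom R (free_module R (b (Suc i + n))) (free_module R (b (i + n)))" for i
    using rX(2)[of "i + n"] by simp
  show "(\<lambda>x. IM n +>\<^bsub>free_module R (b n)\<^esub> x) \<in> module_hom R (free_module R (b (0 + n))) (syzygy R X n)"
    unfolding syzygy_eq using quot_proj_hom[OF IM_submod] by simp
  show "(\<lambda>x. IM n +>\<^bsub>free_module R (b n)\<^esub> x) ` carrier (free_module R (b (0 + n))) = carrier (syzygy R X n)"
    unfolding syzygy_eq by (simp add: quot_simps(1)[OF IM_submod])
  show "d (0 + n) ` carrier (free_module R (b (1 + n))) =
      {x \<in> carrier (free_module R (b (0 + n))). IM n +>\<^bsub>free_module R (b n)\<^esub> x = \<zero>\<^bsub>syzygy R X n\<^esub>}"
    unfolding syzygy_eq using quot_zero_iff[OF IM_submod[of n]] submodD(2)[OF IM_submod[of n]] by auto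
  show "d (Suc i + n) ` carrier (free_module R (b (Suc (Suc i) + n))) =
      {x \<in> carrier (free_module R (b (Suc i + n))). d (i + n) x = \<zero>\<^bsub>free_module R (b (i + n))\<^esub>}" for i
    using res[unfolded resolution_def] by simp
qed

text \<open>Degree 0 is excluded: there the truncated resolution has only the zero coboundary,
  whereas for m > 0 the full one also has those coming from degree m - 1.\<close>

lemma acyclic_at_shift:
  assumes "0 < n"
  shows "acyclic_at R (\<lambda>i. b (i + m)) (\<lambda>i. d (i + m)) N n \<longleftrightarrow> acyclic_at R b d N (n + m)"
  using assms by (cases n) (simp_all add: acyclic_at_def cocycle_def cobdry_Suc)

text \<open>Consecutive differentials compose to zero, so d m is constant on the coset and
  \<open>the_elem\<close> returns its value.\<close>

lemma syzygy_incl_eq: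
  assumes x: "x \<in> carrier (free_module R (b (Suc m)))"
  shows "syzygy_incl R X (Suc m) (IM (Suc m) +>\<^bsub>free_module R (b (Suc m))\<^esub> x) = d m x"
proof -
  let ?F = "free_module R (b (Suc m))" and ?G = "free_module R (b m)"
  interpret F0: Module.module R ?G by (rule free_module_module)
  have "d m y = d m x" if y: "y \<in> IM (Suc m) +>\<^bsub>?F\<^esub> x" for y
  proof -
    obtain h where h: "h \<in> IM (Suc m)" "y = h \<oplus>\<^bsub>?F\<^esub> x" using y by (auto simp: a_r_coset_def')
    have hc: "h \<in> carrier ?F" by (rule subsetD[OF submodD(2)[OF IM_submod] h(1)])
    have "d m h = \<zero>\<^bsub>?G\<^esub>" using h(1) rX(6)[of _ m] by auto
    then show ?thesis unfolding h(2) hom_add[OF rX(2) hc x] using hom_closed[OF rX(2) x] by simp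
  qed
  then have "d m ` (IM (Suc m) +>\<^bsub>?F\<^esub> x) = (\<lambda>y. d m x) ` (IM (Suc m) +>\<^bsub>?F\<^esub> x)" by (rule image_cong[OF refl])
  also have "\<dots> = {d m x}" using coset_self[OF IM_submod x] by auto
  finally show ?thesis by (simp add: syzygy_incl_def res_diff_def bd)
qed

lemma syzygy_incl_hom: "syzygy_incl R X (Suc m) \<in> module_hom R (syzygy R X (Suc m)) (free_module R (b m))"
proof -
  let ?F = "free_module R (b (Suc m))"
  interpret F: Module.module R ?F by (rule free_module_module)
  note q = quot_simps[OF IM_submod[of "Suc m"]]
  show ?thesis
    unfolding syzygy_eq
    by (rule homI) (auto simp: q syzygy_incl_eq hom_closed[OF rX(2)] hom_add[OF rX(2)] hom_smult[OF rX(2)])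
qed

lemma syzygy_incl_inj:
  assumes "a \<in> carrier (syzygy R X (Suc m))" "syzygy_incl R X (Suc m) a = \<zero>\<^bsub>free_module R (b m)\<^esub>"
  shows "a = \<zero>\<^bsub>syzygy R X (Suc m)\<^esub>"
proof -
  obtain x where x: "x \<in> carrier (free_module R (b (Suc m)))" "a = IM (Suc m) +>\<^bsub>free_module R (b (Suc m))\<^esub> x"
    using assms(1) unfolding syzygy_eq quot_simps(1)[OF IM_submod] by blast
  then have "x \<in> IM (Suc m)" using rX(8)[OF x(1)] assms(2) syzygy_incl_eq[OF x(1)] by simp
  then show ?thesis unfolding x(2) syzygy_eq using quot_zero_iff[OF IM_submod x(1)] by simp
qed

lemma syzygy_incl_image: "syzygy_incl R X (Suc m) ` carrier (syzygy R X (Suc m)) = IM m"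
  unfolding syzygy_eq[of "Suc m"] quot_simps(1)[OF IM_submod] image_image
  using syzygy_incl_eq by (rule image_cong[OF refl])

end

text \<open>The cokernel of the inclusion of the syzygy of order m + 1 into the free module in
  degree m is the syzygy of order m, so the pushout sequence has the right end; it is then carried
  along the isomorphism with K. The degree is written \<open>Suc m\<close> to make the degree minus
  one available as \<open>m\<close>.\<close>

lemma is_K_exact:
  fixes X :: "('a, 'm) module" and Y :: "('a, 'n) module" and K :: "('a, 'k) module"
  assumes X: "fg_module R X" and Y: "module R Y" and K: "is_K R X Y (Suc m) \<eta> K"
  obtains i p where "i \<in> module_hom R Y K" "\<forall>y\<in>carrier Y. i y = \<zero>\<^bsub>K\<^esub> \<longrightarrow> y = \<zero>\<^bsub>Y\<^esub>"
    "p \<in> module_hom R K (syzygy R X m)" "p ` carrier K = carrier (syzygy R X m)"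
    "\<forall>x\<in>carrier K. p x = \<zero>\<^bsub>syzygy R X m\<^esub> \<longleftrightarrow> x \<in> i ` carrier Y"
proof -
  let ?b = "fst (min_res R X)" and ?d = "snd (min_res R X)"
  obtain \<epsilon> where P: "minimal_free_resolution R ?b ?d \<epsilon> X" by (rule min_res_props[OF X])
  note res = refl[of ?b] refl[of ?d] mfr_free[OF P]
  let ?L = "\<lambda>f. pushout_module (syzygy R X (Suc m)) Y (free_module R (?b m)) f (syzygy_incl R X (Suc m))"
  obtain f where f: "f \<in> module_hom R (syzygy R X (Suc m)) Y" and iso: "module_isomorphic R K (?L f)"
    using K unfolding is_K_def represents_def by (auto simp: res_module_def)
  have img: "quot_module (free_module R (?b m)) (syzygy_incl R X (Suc m) ` carrier (syzygy R X (Suc m))) = syzygy R X m"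
    unfolding syzygy_incl_image[OF res] syzygy_eq[OF res, of m] ..
  obtain i p where ip: "module R (?L f)" "i \<in> module_hom R Y (?L f)"
    "\<forall>y\<in>carrier Y. i y = \<zero>\<^bsub>?L f\<^esub> \<longrightarrow> y = \<zero>\<^bsub>Y\<^esub>"
    "p \<in> module_hom R (?L f) (syzygy R X m)" "p ` carrier (?L f) = carrier (syzygy R X m)"
    "\<forall>x\<in>carrier (?L f). p x = \<zero>\<^bsub>syzygy R X m\<^esub> \<longleftrightarrow> x \<in> i ` carrier Y"
    by (rule pushout_exact[OF syzygy_module[OF res] Y free_module_module f syzygy_incl_hom[OF res]
          syzygy_incl_inj[OF res], unfolded img])
  obtain h where KM: "module R K" and h: "h \<in> module_hom R K (?L f)" "bij_betw h (carrier K) (carrier (?L f))"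
    using iso unfolding module_isomorphic_def by blast
  obtain g where g: "g \<in> module_hom R (?L f) K" "\<And>x. x \<in> carrier K \<Longrightarrow> g (h x) = x"
    "\<And>y. y \<in> carrier (?L f) \<Longrightarrow> h (g y) = y" using bij_hom_inverse[OF KM h] by metis
  show ?thesis
  proof (rule that[of "\<lambda>y. g (i y)" "\<lambda>x. p (h x)"])
    show "(\<lambda>y. g (i y)) \<in> module_hom R Y K" by (rule hom_comp[OF ip(2) g(1)])
    show "(\<lambda>x. p (h x)) \<in> module_hom R K (syzygy R X m)" by (rule hom_comp[OF h(1) ip(4)])
    show "\<forall>y\<in>carrier Y. g (i y) = \<zero>\<^bsub>K\<^esub> \<longrightarrow> y = \<zero>\<^bsub>Y\<^esub>"
    proof (intro ballI impI)
      fix y assume y: "y \<in> carrier Y" "g (i y) = \<zero>\<^bsub>K\<^esub>"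
      have "i y = h (g (i y))" by (rule g(3)[OF hom_closed[OF ip(2) y(1)], symmetric])
      then have "i y = \<zero>\<^bsub>?L f\<^esub>" unfolding y(2) using hom_zero[OF KM ip(1) h(1)] by simp
      then show "y = \<zero>\<^bsub>Y\<^esub>" using ip(3) y(1) by blast
    qed
    have "(\<lambda>x. p (h x)) ` carrier K = p ` (h ` carrier K)" by (simp only: image_image)
    then show "(\<lambda>x. p (h x)) ` carrier K = carrier (syzygy R X m)"
      using h(2) ip(5) by (simp add: bij_betw_def)
    show "\<forall>x\<in>carrier K. p (h x) = \<zero>\<^bsub>syzygy R X m\<^esub> \<longleftrightarrow> x \<in> (\<lambda>y. g (i y)) ` carrier Y"
    proof
      fix x assume x: "x \<in> carrier K"
      have "p (h x) = \<zero>\<^bsub>syzygy R X m\<^esub> \<longleftrightarrow> h x \<in> i ` carrier Y" using ip(6) hom_closed[OF h(1) x] by blast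
      also have "\<dots> \<longleftrightarrow> x \<in> (\<lambda>y. g (i y)) ` carrier Y"
      proof
        assume "h x \<in> i ` carrier Y"
        then obtain y where "y \<in> carrier Y" "h x = i y" by blast
        then show "x \<in> (\<lambda>y. g (i y)) ` carrier Y" using g(2)[OF x] by (intro image_eqI[of _ _ y]) simp_all
      next
        assume "x \<in> (\<lambda>y. g (i y)) ` carrier Y"
        then obtain y where y: "y \<in> carrier Y" "x = g (i y)" by blast
        then have "h x = i y" using g(3)[OF hom_closed[OF ip(2) y(1)]] by simp
        then show "h x \<in> i ` carrier Y" using y(1) by (rule image_eqI)
      qed
      finally show "p (h x) = \<zero>\<^bsub>syzygy R X m\<^esub> \<longleftrightarrow> x \<in> (\<lambda>y. g (i y)) ` carrier Y" .
    qed
  qed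
qed

section \<open>Vanishing of Ext along a chain of modules\<close>

definition ext_zero :: "('a, 'm) module \<Rightarrow> ('a, 'n) module \<Rightarrow> nat \<Rightarrow> bool" where
  "ext_zero X N n \<longleftrightarrow> acyclic_at R (fst (min_res R X)) (snd (min_res R X)) N n"

lemma zero_Ext_iff_ext_zero:
  assumes "fg_module R X" "module R N"
  shows "zero_module (Ext R X N n) \<longleftrightarrow> ext_zero X N n"
proof -
  obtain \<epsilon> where P: "minimal_free_resolution R (fst (min_res R X)) (snd (min_res R X)) \<epsilon> X"
    by (rule min_res_props[OF assms(1)])
  show ?thesis unfolding ext_zero_def by (rule zero_Ext_iff[OF assms(2) refl refl mfr_free[OF P]])
qed

text \<open>The exact sequence \<open>0 \<rightarrow> X \<rightarrow> K \<rightarrow> \<Omega>\<^sup>m(X) \<rightarrow> 0\<close> together with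
  \<open>Ext\<^sup>n(\<Omega>\<^sup>m(X), N) = Ext\<^sup>n\<^sup>+\<^sup>m(X, N)\<close> for \<open>n > 0\<close>.\<close>

lemma is_K_vanishing:
  fixes X :: "('a, 'm) module" and K :: "('a, 'k) module" and N :: "('a, 'n) module"
  assumes X: "fg_module R X" and K: "fg_module R K" and N: "module R N"
    and isK: "is_K R X X (Suc m) \<eta> K"
  shows "0 < n \<Longrightarrow> ext_zero X N n \<Longrightarrow> ext_zero X N (n + m) \<Longrightarrow> ext_zero K N n"
    and "ext_zero K N n \<Longrightarrow> ext_zero X N (Suc n + m) \<Longrightarrow> ext_zero X N n"
    and "ext_zero K N (Suc n) \<Longrightarrow> ext_zero X N n \<Longrightarrow> ext_zero X N (Suc n + m)"
proof -
  let ?a = "fst (min_res R X)" and ?dA = "snd (min_res R X)"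
  let ?b = "fst (min_res R K)" and ?dB = "snd (min_res R K)"
  obtain \<epsilon>A where "minimal_free_resolution R ?a ?dA \<epsilon>A X" by (rule min_res_props[OF X])
  note PA = mfr_free[OF this]
  obtain \<epsilon>B where "minimal_free_resolution R ?b ?dB \<epsilon>B K" by (rule min_res_props[OF K])
  note PB = mfr_free[OF this]
  note resA = refl[of ?a] refl[of ?dA] PA
  have XM: "module R X" and KM: "module R K" using X K by (simp_all add: fg_module_def)
  obtain i p where ip: "i \<in> module_hom R X K" "\<forall>y\<in>carrier X. i y = \<zero>\<^bsub>K\<^esub> \<longrightarrow> y = \<zero>\<^bsub>X\<^esub>"
    "p \<in> module_hom R K (syzygy R X m)" "p ` carrier K = carrier (syzygy R X m)"
    "\<forall>x\<in>carrier K. p x = \<zero>\<^bsub>syzygy R X m\<^esub> \<longleftrightarrow> x \<in> i ` carrier X"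
    by (rule is_K_exact[OF X XM isK])
  obtain \<phi> where \<phi>: "chain_map R ?a ?dA ?b ?dB \<phi>"
    "\<forall>x\<in>carrier (free_module R (?a 0)). \<epsilon>B (\<phi> 0 x) = i (\<epsilon>A x)"
    by (rule chain_lift[OF XM KM PA PB ip(1)])
  note cone = cone_resolution[OF PA PB \<phi>(1) XM KM syzygy_module[OF resA] ip(1) ip(2)[rule_format] ip(3,4)
      ip(5)[rule_format] \<phi>(2)[rule_format]]
  let ?C = "acyclic_at R (cone_rank ?a ?b) (cone_diff R ?a ?dA ?b ?dB \<phi>) N"
  \<comment> \<open>Both the cone and the truncated minimal resolution of X resolve the syzygy of
    order m. In positive degrees the latter computes the Ext of X in degrees raised by m.\<close>
  have C: "?C n \<longleftrightarrow> ext_zero X N (n + m)" if "0 < n" for n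
  proof -
    have "?C n \<longleftrightarrow> acyclic_at R (\<lambda>i. ?a (i + m)) (\<lambda>i. ?dA (i + m)) N n"
      using acyclic_at_indep[OF syzygy_module[OF resA] syzygy_module[OF resA] N cone syzygy_resolution[OF resA] hom_id hom_id refl]
        acyclic_at_indep[OF syzygy_module[OF resA] syzygy_module[OF resA] N syzygy_resolution[OF resA] cone hom_id hom_id refl]
      by blast
    also have "\<dots> \<longleftrightarrow> ext_zero X N (n + m)" unfolding ext_zero_def by (rule acyclic_at_shift[OF resA that])
    finally show ?thesis .
  qed
  show "0 < n \<Longrightarrow> ext_zero X N n \<Longrightarrow> ext_zero X N (n + m) \<Longrightarrow> ext_zero K N n"
    using cone_acyclic_target[OF PA PB \<phi>(1) N] C[of n] unfolding ext_zero_def by blast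
  show "ext_zero K N n \<Longrightarrow> ext_zero X N (Suc n + m) \<Longrightarrow> ext_zero X N n"
    using cone_acyclic_source[OF PA PB \<phi>(1) N] C[of "Suc n"] unfolding ext_zero_def by blast
  show "ext_zero K N (Suc n) \<Longrightarrow> ext_zero X N n \<Longrightarrow> ext_zero X N (Suc n + m)"
    using cone_acyclic_Suc[OF PA PB \<phi>(1) N] C[of "Suc n"] unfolding ext_zero_def by blast
qed

lemma ext_zero_not_all:
  fixes X :: "('a, 'm) module" and N :: "('a, 'n) module"
  assumes X: "fg_module R X" "\<not> zero_module X" and N: "fg_module R N" "\<not> zero_module N"
  shows "\<exists>n. \<not> ext_zero X N n"
proof -
  obtain \<epsilon> where P: "minimal_free_resolution R (fst (min_res R X)) (snd (min_res R X)) \<epsilon> X"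
    by (rule min_res_props[OF X(1)])
  have "module R X" using X(1) by (simp add: fg_module_def)
  from not_all_acyclic[OF N this X(2) P] show ?thesis unfolding ext_zero_def .
qed

text \<open>The length p of the minimal resolution plays two roles: by Auslander-Buchsbaum it is the
  difference of the depths, and by Nakayama it is the last degree in which Ext(X, N) is
  nonzero.\<close>

lemma ext_zero_complexity_zero:
  fixes X :: "('a, 'm) module" and N :: "('a, 'n) module"
  assumes X: "fg_module R X" "\<not> zero_module X" "complexity R X = 0"
    and N: "fg_module R N" "\<not> zero_module N"
  obtains q n p where "depth R (ring_module R) = enat q" "depth R X = enat n" "n + p = q"
    "\<forall>j>p. ext_zero X N j" "\<not> ext_zero X N p"
proof -
  obtain \<epsilon> where P: "minimal_free_resolution R (fst (min_res R X)) (snd (min_res R X)) \<epsilon> X"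
    by (rule min_res_props[OF X(1)])
  obtain p where p: "0 < fst (min_res R X) p" "\<forall>i>p. fst (min_res R X) i = 0"
    by (rule complexity_zero_length[OF X])
  note a = X(1) P p(1) p(2)[rule_format]
  have NM: "module R N" using N(1) by (simp add: fg_module_def)
  obtain q n where "depth R (ring_module R) = enat q" "depth R X = enat n" "n + p = q"
    by (rule auslander_buchsbaum[OF a X(2)])
  moreover have "\<forall>j>p. ext_zero X N j" using acyclic_above_length[OF a NM] by (simp add: ext_zero_def)
  moreover have "\<not> ext_zero X N p" using not_acyclic_at_length[OF a N] by (simp add: ext_zero_def)
  ultimately show ?thesis by (rule that)
qed

text \<open>A gap in \<open>Ext(X, N)\<close> as long as the periods of the chain allow forces vanishing above \<open>p\<close>:
  the connecting maps \<open>Ext\<^sup>j(K\<^sub>i, N) \<rightarrow> Ext\<^sup>j\<^sup>+\<^sup>n(K\<^sub>i, N)\<close> are bijective for \<open>j > p\<close>, where \<open>n\<close> is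
  the degree of the next class.\<close>

lemma ext_zero_step:
  fixes X :: "('a, 'm) module" and K :: "('a, 'k) module" and N :: "('a, 'n) module"
  assumes X: "fg_module R X" "\<not> zero_module X" and K: "fg_module R K"
    and N: "fg_module R N" "\<not> zero_module N" and isK: "is_K R X X (Suc m) \<eta> K"
    and VK: "\<forall>j>p. ext_zero K N j" "\<not> ext_zero K N p"
    and t: "p < t" and VX: "\<forall>j. t \<le> j \<and> j \<le> t + m \<longrightarrow> ext_zero X N j"
  shows "(\<forall>j>p. ext_zero X N j) \<and> \<not> ext_zero X N p"
proof -
  have NM: "module R N" using N(1) by (simp add: fg_module_def)
  note v = is_K_vanishing[OF X(1) K NM isK]
  \<comment> \<open>Upwards: the window consists of m + 1 consecutive degrees, and every degree
    beyond it is reached from the degree lower by m + 1.\<close>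
  have up: "ext_zero X N j" if "t \<le> j" for j
    using that
  proof (induction j rule: less_induct)
    case (less j)
    show ?case
    proof (cases "j \<le> t + m")
      case False
      define l where "l = j - Suc m"
      then have l: "j = Suc l + m" "t \<le> l" using False by auto
      have "ext_zero X N (Suc l + m)"
        by (rule v(3)) (use VK(1) t l less.IH[of l] in auto)
      then show ?thesis using l by simp
    qed (use VX less.prems in blast)
  qed
  \<comment> \<open>Downwards: a degree below \<open>t\<close> follows from the degree higher by m +
    1, so the induction is on the distance to \<open>t\<close>.\<close>
  have all: "ext_zero X N j" if "p < j" for j
    using that
  proof (induction "t - j" arbitrary: j rule: less_induct)
    case less
    show ?case
    proof (cases "t \<le> j")
      case False
      have "ext_zero X N (Suc j + m)" by (rule less.hyps) (use False less.prems in auto)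
      moreover have "ext_zero K N j" using VK(1) less.prems by blast
      ultimately show ?thesis using v(2) by blast
    qed (rule up)
  qed
  \<comment> \<open>For p > 0 vanishing at p would pass to K. In degree 0 the comparison of the
    syzygy with X breaks down, but for p = 0 all Ext(X, N) would vanish, which is impossible for
    nonzero modules.\<close>
  have "\<not> ext_zero X N p"
  proof
    assume V: "ext_zero X N p"
    show False
    proof (cases "p = 0")
      case True
      then have "ext_zero X N n" for n using V all by (cases "n = 0") auto
      then show False using ext_zero_not_all[OF X N] by blast
    next
      case False
      have "ext_zero X N (p + m)" using V all[of "p + m"] by (cases "m = 0") auto
      then show False using v(1)[OF _ V] VK(2) False by blast
    qed
  qed
  then show ?thesis using all by blast
qed

text \<open>Here \<open>m l\<close> is the degree of a class minus one. The window shrinks from K 0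
  towards K c, while the conclusion travels from K c back to K 0; stating \<open>E i\<close> as an
  implication lets one induction do both.\<close>

lemma ext_zero_chain:
  fixes K :: "nat \<Rightarrow> ('a, 'm) module" and N :: "('a, 'n) module"
  assumes K: "\<And>i. i \<le> c \<Longrightarrow> fg_module R (K i)" "\<And>i. i \<le> c \<Longrightarrow> \<not> zero_module (K i)"
    and N: "fg_module R N" "\<not> zero_module N"
    and isK: "\<And>i. i < c \<Longrightarrow> is_K R (K i) (K i) (Suc (m i)) (\<eta> i) (K (Suc i))"
    and Kc: "\<forall>j>p. ext_zero (K c) N j" "\<not> ext_zero (K c) N p"
    and t: "p < t" and V: "\<forall>j. t \<le> j \<and> j \<le> t + (\<Sum>l=0..<c. m l) \<longrightarrow> ext_zero (K 0) N j"
  shows "(\<forall>j>p. ext_zero (K 0) N j) \<and> \<not> ext_zero (K 0) N p"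
proof -
  have NM: "module R N" using N(1) by (simp add: fg_module_def)
  define E where "E i \<longleftrightarrow> ((\<forall>j. t \<le> j \<and> j \<le> t + (\<Sum>l=i..<c. m l) \<longrightarrow> ext_zero (K i) N j) \<longrightarrow>
      (\<forall>j>p. ext_zero (K i) N j) \<and> \<not> ext_zero (K i) N p)" for i
  have "E 0"
  proof (rule inc_induct[of 0 c E])
    show "E c" using Kc by (simp add: E_def)
    fix i assume i: "i < c" and IH: "E (Suc i)"
    show "E i"
      unfolding E_def
    proof
      assume V: "\<forall>j. t \<le> j \<and> j \<le> t + (\<Sum>l=i..<c. m l) \<longrightarrow> ext_zero (K i) N j"
      have s: "(\<Sum>l=i..<c. m l) = m i + (\<Sum>l=Suc i..<c. m l)" using i by (rule sum.atLeast_Suc_lessThan)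
      have Ki: "fg_module R (K i)" "\<not> zero_module (K i)" "fg_module R (K (Suc i))" using K i by auto
      \<comment> \<open>A zero of the next module costs zeros in the degrees j and j + m i, which is
        where \<open>m i\<close> degrees of the window are spent.\<close>
      have "ext_zero (K (Suc i)) N j" if j: "t \<le> j" "j \<le> t + (\<Sum>l=Suc i..<c. m l)" for j
      proof (rule is_K_vanishing(1)[OF Ki(1,3) NM isK[OF i]])
        show "0 < j" using j(1) t by simp
        show "ext_zero (K i) N j" "ext_zero (K i) N (j + m i)" using V j unfolding s by simp_all
      qed
      then have "(\<forall>j>p. ext_zero (K (Suc i)) N j) \<and> \<not> ext_zero (K (Suc i)) N p" using IH by (simp add: E_def)
      then show "(\<forall>j>p. ext_zero (K i) N j) \<and> \<not> ext_zero (K i) N p"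
        using V unfolding s by (intro ext_zero_step[OF Ki N isK[OF i] _ _ t]) auto
    qed
  qed simp
  then show ?thesis using V by (simp add: E_def)
qed

end

text \<open>With p the difference of the depths, (i) gives (iii) by way of the chain, (iii) implies
  (ii) because p is finite, and (ii) leaves room for a window beyond both p and the supremum, which
  is (i).\<close>

theorem theorem3p1:
  fixes R :: "('a, 'r) ring_scheme"
    and M :: "('a, 'b) module" and N :: "('a, 'c) module"
    and c :: nat and K :: "nat \<Rightarrow> ('a, 'b) module"
    and deg :: "nat \<Rightarrow> nat" and \<eta> :: "nat \<Rightarrow> ((nat \<Rightarrow> 'a) \<Rightarrow> 'b) set"
  assumes "noetherian_local_ring R"
    and "fg_module R M" and "\<not> zero_module M" and "reducible_complexity R M"
    and "fg_module R N" and "\<not> zero_module N"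
    and "complexity R M = 0 \<Longrightarrow> c = 0"
    and "K 0 = M"
    and "\<And>i. i \<in> {1..c} \<Longrightarrow> fg_module R (K i)"
    and "\<And>i. i \<in> {1..c} \<Longrightarrow> 0 < deg i"
    and "\<And>i. i \<in> {1..c} \<Longrightarrow> \<eta> i \<in> carrier (Ext R (K (i - 1)) (K (i - 1)) (deg i))"
    and "\<And>i. i \<in> {1..c} \<Longrightarrow> is_K R (K (i - 1)) (K (i - 1)) (deg i) (\<eta> i) (K i)"
    and "\<And>i. i \<in> {1..c} \<Longrightarrow> depth R (K i) = depth R M"
    and "\<And>i. i \<in> {1..c} \<Longrightarrow> complexity R (K i) < complexity R (K (i - 1))"
    and "complexity R (K c) = 0"
  shows
    "((\<exists>t::int. ereal (real_of_int t)
          > ereal_of_enat (depth R (ring_module R)) - ereal_of_enat (depth R M) \<and>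
        (\<forall>i::int. 0 \<le> i \<and> i \<le> (\<Sum>j=1..c. int (deg j)) - int c \<longrightarrow> Ext_vanishes R M N (t + i)))
      \<longleftrightarrow> p_ext R M N < \<infinity>) \<and>
     (p_ext R M N < \<infinity> \<longleftrightarrow>
       p_ext R M N = ereal_of_enat (depth R (ring_module R)) - ereal_of_enat (depth R M))"
proof -
  interpret noeth_local R by (rule noeth_local.intro[OF assms(1)])
  have NM: "module R N" using assms(5) by (simp add: fg_module_def)
  have fgK: "fg_module R (K i)" if "i \<le> c" for i
    using that assms(2,8) assms(9)[of i] by (cases "i = 0") auto
  obtain n where n: "depth R M = enat n" by (rule depth_residue_ext[OF assms(2,3)])
  \<comment> \<open>A zero module would have infinite depth, whereas every module of the chain has
    the finite depth of M.\<close>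
  have nzK: "\<not> zero_module (K i)" if "i \<le> c" for i
  proof (cases "i = 0")
    case False
    then have "depth R (K i) = enat n" using assms(13)[of i] that n by simp
    then show ?thesis by (auto simp: depth_def)
  qed (use assms(3,8) in simp)
  obtain q n' p where qn: "depth R (ring_module R) = enat q" "depth R (K c) = enat n'" "n' + p = q"
    and Kc: "\<forall>j>p. ext_zero (K c) N j" "\<not> ext_zero (K c) N p"
    by (rule ext_zero_complexity_zero[OF fgK nzK assms(15,5,6)]) simp_all
  \<comment> \<open>All modules of the chain share the depth of M, so the p found for K c is depth A
    - depth M.\<close>
  have "n' = n" using qn(2) n assms(8) assms(13)[of c] by (cases "c = 0") auto
  then have D: "ereal_of_enat (depth R (ring_module R)) - ereal_of_enat (depth R M) = ereal (real p)"
    using qn n by simp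
  \<comment> \<open>The links are renumbered from 0. Truncated subtraction is harmless because the
    degrees are positive.\<close>
  define S where "S = (\<Sum>l=0..<c. deg (Suc l) - 1)"
  have isK: "is_K R (K i) (K i) (Suc (deg (Suc i) - 1)) (\<eta> (Suc i)) (K (Suc i))" if "i < c" for i
    using assms(12)[of "Suc i"] assms(10)[of "Suc i"] that by simp
  have S: "(\<Sum>j=1..c. int (deg j)) - int c = int S"
  proof -
    have "(\<Sum>j=1..c. int (deg j)) = (\<Sum>l=0..<c. int (deg (Suc l)))"
      by (simp add: sum.atLeast1_atMost_eq lessThan_atLeast0)
    also have "\<dots> = (\<Sum>l=0..<c. int (deg (Suc l) - 1) + 1)"
      by (rule sum.cong[OF refl]) (use assms(10) in \<open>simp add: of_nat_diff Suc_le_eq\<close>)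
    also have "\<dots> = int S + int c" by (simp add: S_def sum.distrib)
    finally show ?thesis by simp
  qed
  have van: "Ext_vanishes R M N j \<longleftrightarrow> (0 \<le> j \<longrightarrow> ext_zero M N (nat j))" for j
    unfolding Ext_vanishes_def using zero_Ext_iff_ext_zero[OF assms(2) NM] by simp
  let ?i = "\<exists>t::int. ereal (real_of_int t) > ereal (real p) \<and>
      (\<forall>i::int. 0 \<le> i \<and> i \<le> int S \<longrightarrow> Ext_vanishes R M N (t + i))"
  have 1: "p_ext R M N = ereal (real p)" if ?i
  proof -
    obtain t :: int where t: "int p < t" "\<And>i. 0 \<le> i \<Longrightarrow> i \<le> int S \<Longrightarrow> Ext_vanishes R M N (t + i)"
      using \<open>?i\<close> by (metis ereal_less_eq(3) linorder_not_le of_int_less_iff of_int_of_nat_eq)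
    have "ext_zero M N j" if "nat t \<le> j" "j \<le> nat t + S" for j
    proof -
      have "Ext_vanishes R M N (t + (int j - t))" by (rule t(2)) (use that t(1) in auto)
      then show ?thesis by (simp add: van)
    qed
    then have "(\<forall>j>p. ext_zero (K 0) N j) \<and> \<not> ext_zero (K 0) N p"
      by (intro ext_zero_chain[OF fgK nzK assms(5,6) isK Kc, of "nat t"]) (use t(1) assms(8) in \<open>auto simp: S_def\<close>)
    then have A: "\<And>j. p < j \<Longrightarrow> ext_zero M N j" "\<not> ext_zero M N p" using assms(8) by auto
    show ?thesis
      unfolding p_ext_def
    proof (rule antisym)
      show "Sup {ereal (real_of_int j) | j. \<not> Ext_vanishes R M N j} \<le> ereal (real p)"
      proof (rule Sup_least)
        fix x assume "x \<in> {ereal (real_of_int j) | j. \<not> Ext_vanishes R M N j}"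
        then obtain j where j: "x = ereal (real_of_int j)" "0 \<le> j" "\<not> ext_zero M N (nat j)" by (auto simp: van)
        have "nat j \<le> p" using A(1) j(3) not_le by blast
        then show "x \<le> ereal (real p)" using j(1,2) by auto
      qed
      have "\<not> Ext_vanishes R M N (int p)" using A(2) by (simp add: van)
      then show "ereal (real p) \<le> Sup {ereal (real_of_int j) | j. \<not> Ext_vanishes R M N j}"
        by (intro Sup_upper) (auto intro!: exI[of _ "int p"])
    qed
  qed
  have 2: ?i if fin: "p_ext R M N < \<infinity>"
  proof -
    obtain k :: nat where k: "p_ext R M N < ereal (real k)"
      using fin less_PInf_Ex_of_nat[of "p_ext R M N"] by auto
    have V: "Ext_vanishes R M N j" if "int k \<le> j" for j
    proof (rule ccontr)
      assume "\<not> Ext_vanishes R M N j"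
      then have "ereal (real_of_int j) \<le> p_ext R M N" unfolding p_ext_def by (intro Sup_upper) auto
      also have "\<dots> < ereal (real k)" by (rule k)
      finally show False using that by simp
    qed
    \<comment> \<open>From k on everything vanishes, and \<open>Suc p\<close> secures the strict
      bound on t.\<close>
    show ?thesis by (rule exI[of _ "int (max k (Suc p))"]) (auto intro: V)
  qed
  have "p_ext R M N < \<infinity>" if "p_ext R M N = ereal (real p)" using that by simp
  then show ?thesis unfolding D S using 1 2 by blast
qed

end
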